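(* Let $d\geq 3$ be odd. The map $$\Xi:(\mathbb{C}^{d+1}\setminus\mathcal{Z}_d)/\mathbb{R}^{*}\to B_d(1):\quad \{a_0:\cdots:a_d\}\mapsto\phi(z)=\dfrac{\sum_{k=0}^{d} a_{k} z^{k}}{\sum_{k=0}^{d} (-1)^{k}\,\overline{a_{d-k}}\, z^{k}}$$ is a real analytic bijection. In particular, $B_d(1)$ and $\mathcal{B}_d(1)$ are connected and $$\dim_{\mathbb{R}}(B_d(1))=2d+1,\qquad \dim_{\mathbb{R}}(\mathcal{B}_d(1))=2d-2.$$
   Context: $\mathrm{Rat}_d$ is the space of complex rational maps of degree $d\ge2$, identified (via coefficients) with the complement in $\mathbb{P}^{2d+1}(\mathbb{C})$ of the resultant hypersurface, with the induced topology; $\mathrm{M}_d=\mathrm{Rat}_d/\mathrm{PSL}_2(\mathbb{C})$ is the quotient by conjugation. $B_d(1)\subset\mathrm{Rat}_d$ is the locus of rational maps $\phi$ commuting with $\tau_1(z)=-1/\overline z$, and $\mathcal{B}_d(1)\subset\mathrm{M}_d$ is the locus of their equivalence classes. $\mathcal{Z}_d\subset\mathbb{C}^{d+1}$ is the set of points $(a_0,\dots,a_d)$ such that the resultant (as polynomials of formal degree $d$) of $\sum_{k=0}^d a_kz^k$ and $\sum_{k=0}^d(-1)^k\overline{a_{d-k}}z^k$ is zero. $\mathbb{R}^*=\mathbb{R}\setminus\{0\}$ acts on $\mathbb{C}^{d+1}\setminus\mathcal{Z}_d$ by scalar multiplication, and $\{a_0:\cdots:a_d\}$ denotes the class of $(a_0,\dots,a_d)$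 in the quotient, a connected real manifold (an open dense subset of $\mathbb{P}^{2d+1}(\mathbb{R})$). *)

theory Defs
  imports "HOL-Analysis.Analysis" "Subresultants.Resultant_Prelim"
begin

section \<open>Quotient spaces and coordinate spaces\<close>

definition quotient_topology :: "'a topology \<Rightarrow> ('a \<Rightarrow> 'b) \<Rightarrow> 'b topology" where
  "quotient_topology X q =
     topology (\<lambda>U. U \<subseteq> q ` topspace X \<and> openin X {x \<in> topspace X. q x \<in> U})"

lemma openin_quotient_topology:
  "openin (quotient_topology X q) U \<longleftrightarrow>
     U \<subseteq> q ` topspace X \<and> openin X {x \<in> topspace X. q x \<in> U}"
proof -
  have "istopology (\<lambda>U. U \<subseteq> q ` topspace X \<and> openin X {x \<in> topspace X. q x \<in> U})"
    unfolding istopology_def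
  proof (rule conjI; intro allI impI)
    fix S T
    assume "S \<subseteq> q ` topspace X \<and> openin X {x \<in> topspace X. q x \<in> S}"
      and "T \<subseteq> q ` topspace X \<and> openin X {x \<in> topspace X. q x \<in> T}"
    moreover have "{x \<in> topspace X. q x \<in> S \<inter> T} =
        {x \<in> topspace X. q x \<in> S} \<inter> {x \<in> topspace X. q x \<in> T}"
      by auto
    ultimately show "S \<inter> T \<subseteq> q ` topspace X \<and> openin X {x \<in> topspace X. q x \<in> S \<inter> T}"
      by auto
  next
    fix \<K>
    assume K: "\<forall>K\<in>\<K>. K \<subseteq> q ` topspace X \<and> openin X {x \<in> topspace X. q x \<in> K}"
    have "{x \<in> topspace X. q x \<in> \<Union>\<K>} = (\<Union>K\<in>\<K>. {x \<in> topspace X. q x \<in> K})"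
      by auto
    with K show "\<Union>\<K> \<subseteq> q ` topspace X \<and> openin X {x \<in> topspace X. q x \<in> \<Union>\<K>}"
      by auto
  qed
  then show ?thesis
    by (simp add: quotient_topology_def topology_inverse')
qed

lemma topspace_quotient_topology [simp]: "topspace (quotient_topology X q) = q ` topspace X"
proof
  have "{x \<in> topspace X. q x \<in> q ` topspace X} = topspace X"
    by auto
  then have "openin (quotient_topology X q) (q ` topspace X)"
    by (simp add: openin_quotient_topology)
  then show "q ` topspace X \<subseteq> topspace (quotient_topology X q)"
    by (rule openin_subset)
  show "topspace (quotient_topology X q) \<subseteq> q ` topspace X"
    using openin_quotient_topology[of X q "topspace (quotient_topology X q)"] by simp
qed

lemma quotient_map_quotient_topology: "quotient_map X (quotient_topology X q) q"
  unfolding quotient_map_def by (auto simp: openin_quotient_topology)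

text \<open>\<open>K\<^sup>n\<close> as the sequences in \<open>K\<close> vanishing from index \<open>n\<close> on; for \<open>K = \<real>\<close> this
  is \<^const>\<open>Euclidean_space\<close>.\<close>

definition coord_space :: "nat \<Rightarrow> (nat \<Rightarrow> 'a::{topological_space,zero}) topology" where
  "coord_space n = subtopology (product_topology (\<lambda>_. euclidean) UNIV) {x. \<forall>i\<ge>n. x i = 0}"

lemma coord_space_real: "coord_space n = Euclidean_space n"
  by (simp add: coord_space_def Euclidean_space_def)

text \<open>The points of complex projective \<open>n\<close>-space are orbits of the scalar action of the nonzero
  complex numbers on nonzero vectors.\<close>

definition proj_class :: "(nat \<Rightarrow> complex) \<Rightarrow> (nat \<Rightarrow> complex) set" where
  "proj_class c = {(\<lambda>i. s * c i) |s. s \<noteq> 0}"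

definition complex_proj_space :: "nat \<Rightarrow> (nat \<Rightarrow> complex) set topology" where
  "complex_proj_space n =
     quotient_topology (subtopology (coord_space (Suc n)) {c. c \<noteq> (\<lambda>_. 0)}) proj_class"


section \<open>Rational maps of degree \<open>d\<close>\<close>

definition vec_poly :: "nat \<Rightarrow> (nat \<Rightarrow> complex) \<Rightarrow> complex poly" where
  "vec_poly d a = (\<Sum>k\<le>d. monom (a k) k)"

text \<open>The resultant of two polynomials of formal degree \<open>d\<close>; the actual degrees may be smaller.\<close>

definition formal_resultant :: "nat \<Rightarrow> complex poly \<Rightarrow> complex poly \<Rightarrow> complex" where
  "formal_resultant d p q = Determinant.det (sylvester_mat_sub d d p q)"

text \<open>A point of projective \<open>(2d+1)\<close>-space has as homogeneous coordinates the \<open>d + 1\<close>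
  coefficients of a numerator followed by the \<open>d + 1\<close> coefficients of a denominator.\<close>

definition numer :: "nat \<Rightarrow> (nat \<Rightarrow> complex) \<Rightarrow> nat \<Rightarrow> complex" where
  "numer d c = (\<lambda>k. if k \<le> d then c k else 0)"

definition denom :: "nat \<Rightarrow> (nat \<Rightarrow> complex) \<Rightarrow> nat \<Rightarrow> complex" where
  "denom d c = (\<lambda>k. if k \<le> d then c (Suc d + k) else 0)"

definition join_coeffs ::
    "nat \<Rightarrow> (nat \<Rightarrow> complex) \<Rightarrow> (nat \<Rightarrow> complex) \<Rightarrow> nat \<Rightarrow> complex" where
  "join_coeffs d a b =
     (\<lambda>k. if k \<le> d then a k else if k \<le> 2 * d + 1 then b (k - Suc d) else 0)"

definition Rat :: "nat \<Rightarrow> (nat \<Rightarrow> complex) set set" where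
  "Rat d = {\<phi> \<in> topspace (complex_proj_space (2 * d + 1)).
     \<forall>c\<in>\<phi>. formal_resultant d (vec_poly d (numer d c)) (vec_poly d (denom d c)) \<noteq> 0}"

definition Rat_space :: "nat \<Rightarrow> (nat \<Rightarrow> complex) set topology" where
  "Rat_space d = subtopology (complex_proj_space (2 * d + 1)) (Rat d)"

datatype riemann_sphere = Fin complex | Infty

fun rat_eval :: "nat \<Rightarrow> (nat \<Rightarrow> complex) \<Rightarrow> riemann_sphere \<Rightarrow> riemann_sphere" where
  "rat_eval d c (Fin z) =
     (let p = (\<Sum>k\<le>d. numer d c k * z ^ k); q = (\<Sum>k\<le>d. denom d c k * z ^ k)
      in if q = 0 then Infty else Fin (p / q))"
| "rat_eval d c Infty =
     (if denom d c d = 0 then Infty else Fin (numer d c d / denom d c d))"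

text \<open>The self-map of the sphere given by a point of \<^const>\<open>Rat\<close>; \<^const>\<open>rat_eval\<close> does not
  depend on the choice of homogeneous coordinates.\<close>

definition rat_map :: "nat \<Rightarrow> (nat \<Rightarrow> complex) set \<Rightarrow> riemann_sphere \<Rightarrow> riemann_sphere" where
  "rat_map d \<phi> = the_elem (rat_eval d ` \<phi>)"


section \<open>Conjugacy classes of rational maps\<close>

fun moebius ::
    "complex \<Rightarrow> complex \<Rightarrow> complex \<Rightarrow> complex \<Rightarrow> riemann_sphere \<Rightarrow> riemann_sphere" where
  "moebius a b c d (Fin z) =
     (if c * z + d = 0 then Infty else Fin ((a * z + b) / (c * z + d)))"
| "moebius a b c d Infty = (if c = 0 then Infty else Fin (a / c))"

definition PSL2 :: "(riemann_sphere \<Rightarrow> riemann_sphere) set" where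
  "PSL2 = {moebius a b c d |a b c d. a * d - b * c = 1}"

definition conj_class :: "nat \<Rightarrow> (nat \<Rightarrow> complex) set \<Rightarrow> (nat \<Rightarrow> complex) set set" where
  "conj_class d \<phi> = {\<psi> \<in> Rat d. \<exists>\<mu>\<in>PSL2. rat_map d \<psi> = \<mu> \<circ> rat_map d \<phi> \<circ> inv_into UNIV \<mu>}"

definition moduli_space :: "nat \<Rightarrow> (nat \<Rightarrow> complex) set set topology" where
  "moduli_space d = quotient_topology (Rat_space d) (conj_class d)"


section \<open>Maps commuting with the antipodal map\<close>

fun tau1 :: "riemann_sphere \<Rightarrow> riemann_sphere" where
  "tau1 (Fin z) = (if z = 0 then Infty else Fin (- 1 / cnj z))"
| "tau1 Infty = Fin 0"

definition B1 :: "nat \<Rightarrow> (nat \<Rightarrow> complex) set set" where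
  "B1 d = {\<phi> \<in> Rat d. rat_map d \<phi> \<circ> tau1 = tau1 \<circ> rat_map d \<phi>}"

definition moduli_B1 :: "nat \<Rightarrow> (nat \<Rightarrow> complex) set set set" where
  "moduli_B1 d = conj_class d ` B1 d"

definition antipodal_coeffs :: "nat \<Rightarrow> (nat \<Rightarrow> complex) \<Rightarrow> nat \<Rightarrow> complex" where
  "antipodal_coeffs d a = (\<lambda>k. if k \<le> d then (- 1) ^ k * cnj (a (d - k)) else 0)"

definition Z_locus :: "nat \<Rightarrow> (nat \<Rightarrow> complex) set" where
  "Z_locus d = {a \<in> topspace (coord_space (Suc d)).
     formal_resultant d (vec_poly d a) (vec_poly d (antipodal_coeffs d a)) = 0}"

definition real_class :: "(nat \<Rightarrow> complex) \<Rightarrow> (nat \<Rightarrow> complex) set" where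
  "real_class a = {(\<lambda>k. complex_of_real r * a k) |r. r \<noteq> 0}"

definition param_space :: "nat \<Rightarrow> (nat \<Rightarrow> complex) set topology" where
  "param_space d = quotient_topology
     (subtopology (coord_space (Suc d)) (topspace (coord_space (Suc d)) - Z_locus d)) real_class"

definition Xi :: "nat \<Rightarrow> (nat \<Rightarrow> complex) set \<Rightarrow> (nat \<Rightarrow> complex) set" where
  "Xi d A = the_elem ((\<lambda>a. proj_class (join_coeffs d a (antipodal_coeffs d a))) ` A)"


section \<open>Real analytic maps\<close>

text \<open>Real analyticity at a point of \<open>\<real>\<^sup>n\<close>: the function is the sum of a convergent power series
  in \<open>n\<close> variables on a neighbourhood. The multi-indices are the sequences of natural numbers
  vanishing from index \<open>n\<close> on.\<close>

definition real_analytic_at :: "nat \<Rightarrow> ((nat \<Rightarrow> real) \<Rightarrow> real) \<Rightarrow> (nat \<Rightarrow> real) \<Rightarrow> bool" where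
  "real_analytic_at n f x \<longleftrightarrow>
     (\<exists>r>0. \<exists>c :: (nat \<Rightarrow> nat) \<Rightarrow> real.
        \<forall>y\<in>topspace (Euclidean_space n). (\<forall>i<n. \<bar>y i - x i\<bar> < r) \<longrightarrow>
          ((\<lambda>\<alpha>. c \<alpha> * (\<Prod>i<n. (y i - x i) ^ \<alpha> i)) has_sum f y) {\<alpha>. \<forall>i\<ge>n. \<alpha> i = 0})"

text \<open>Real analyticity of a map between manifolds of dimensions \<open>m\<close> and \<open>n\<close>, each given by a
  set of charts, that is, of pairs of an open set and a coordinate map on it.\<close>

type_synonym 'a chart = "'a set \<times> ('a \<Rightarrow> nat \<Rightarrow> real)"

definition real_analytic_map ::
    "'a topology \<Rightarrow> nat \<Rightarrow> 'a chart set \<Rightarrow> 'b topology \<Rightarrow> nat \<Rightarrow> 'b chart set \<Rightarrow> ('a \<Rightarrow> 'b) \<Rightarrow> bool"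
  where
  "real_analytic_map X m \<A> Y n \<B> f \<longleftrightarrow> continuous_map X Y f \<and>
     (\<forall>(U, u)\<in>\<A>. \<forall>(V, v)\<in>\<B>. \<forall>p\<in>U. f p \<in> V \<longrightarrow>
        (\<forall>i<n. real_analytic_at m (\<lambda>y. v (f (inv_into U u y)) i) (u p)))"

text \<open>The affine coordinates of a point of projective space with respect to its \<open>j\<close>-th
  homogeneous coordinate.\<close>

definition affine_coords :: "nat \<Rightarrow> (nat \<Rightarrow> 'a::field) \<Rightarrow> nat \<Rightarrow> 'a" where
  "affine_coords j x = (\<lambda>i. x (if i < j then i else Suc i) / x j)"

text \<open>The identification of \<open>\<complex>\<^sup>n\<close> with \<open>\<real>\<^sup>2\<^sup>n\<close>.\<close>

definition realify :: "(nat \<Rightarrow> complex) \<Rightarrow> nat \<Rightarrow> real" where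
  "realify z = (\<lambda>i. if even i then Re (z (i div 2)) else Im (z (i div 2)))"

text \<open>The parameter space carries the affine charts of real projective \<open>(2d+1)\<close>-space, and
  \<^const>\<open>Rat\<close> those of complex projective \<open>(2d+1)\<close>-space.\<close>

definition param_charts :: "nat \<Rightarrow> (nat \<Rightarrow> complex) set chart set" where
  "param_charts d =
     {({A \<in> topspace (param_space d). \<forall>a\<in>A. realify a j \<noteq> 0},
       \<lambda>A. the_elem ((\<lambda>a. affine_coords j (realify a)) ` A)) |j. j < 2 * d + 2}"

definition Rat_charts :: "nat \<Rightarrow> (nat \<Rightarrow> complex) set chart set" where
  "Rat_charts d =
     {({\<phi> \<in> Rat d. \<forall>c\<in>\<phi>. c j \<noteq> 0},
       \<lambda>\<phi>. the_elem ((\<lambda>c. realify (affine_coords j c)) ` \<phi>)) |j. j < 2 * d + 2}"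


section \<open>Real dimension\<close>

text \<open>The largest \<open>n\<close> such that the space contains a homeomorphic copy of \<open>\<real>\<^sup>n\<close>. This is the
  usual dimension for manifolds and, more generally, for semialgebraic sets.\<close>

definition real_dim :: "'a topology \<Rightarrow> enat" where
  "real_dim X = Sup {enat n |n. \<exists>f. embedding_map (Euclidean_space n) X f}"

end

theory Submission
  imports "HOL-Homology.Homology" "HOL-Computational_Algebra.Fundamental_Theorem_Algebra" Defs
begin

text \<open>
  A rational map commutes with the antipodal map if and only if it equals its own conjugate by it.
  On pairs of binary forms without a common zero, this conjugation is the antilinear map
  \<open>(p, q) \<mapsto> (q\<^sup>*, - p\<^sup>*)\<close>, where the star denotes the antipodal coefficients. For odd \<open>d\<close> its
  square is the identity, so a line that it preserves contains a vector of the form \<open>(a, a\<^sup>*)\<close>,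
  unique up to a real scalar. This is the bijectivity of the parametrization (\<open>Xi_bij\<close>). In affine
  charts its components are quotients of real affine functions, and these have power series by the
  geometric series (\<open>Xi_analytic\<close>).

  Connectedness comes from the parameters. If a parameter is factored into linear forms, then it is
  nondegenerate precisely when no two of the factors are orthogonal, because the antipode of a zero
  of one factor is a zero of every factor orthogonal to it. Moving one factor along a complex line
  meets only finitely many forbidden positions. In this way all factors are first made equal and then
  moved to one fixed form (\<open>connected_nonZ\<close>).

  For the dimension of the antipodal locus, parameters are normalized by setting one real coordinate
  to 1. These slices have \<open>2d + 1\<close> free real coordinates and map injectively and openly to the
  locus. Openness is proved by lifting sequences: if rational maps converge inside the locus, then
  their parameters converge up to real scalars (\<open>phase_limit\<close>).

  In the moduli space the locus is the quotient of the parameters by \<open>SU(2)\<close> and by the real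
  scalars. The main point is that conjugation by the noncompact group adds nothing, also in the
  limit (\<open>su2_normal_sequence\<close>). A matrix is a product of a unitary, a positive diagonal and a
  unitary matrix (\<open>KAK\<close>), and a diagonal conjugation with entries \<open>t\<close> and \<open>1 / t\<close> between antipodal
  pairs has \<open>t = 1\<close>. In an antipodal pair the \<open>k\<close>-th coefficient of the numerator and the
  \<open>(d - k)\<close>-th of the denominator have the same modulus, and any other \<open>t\<close> destroys this unless
  they vanish or \<open>2k = d + 1\<close>. For \<open>d \<ge> 3\<close> the middle coefficient cannot be the only one, since 0
  would then be a common zero (\<open>diag_tendsto_1\<close>).
  Rotating a fixed point to 0 and normalizing one coefficient gives slices with \<open>2d - 2\<close> free real
  coordinates that map openly, with fibres of bounded size (\<open>slice_open_map\<close>, \<open>slice_fibre\<close>).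

  Because of maps with automorphisms these slices need not map injectively. However, an open
  map with fibres of bounded size is injective near a point whose fibre has the largest size
  (\<open>open_map_injective_part\<close>). So Euclidean space of the dimension of the slices embeds into the
  locus; conversely over any embedded Euclidean space there is an open part that embeds into a
  slice, and invariance of domain bounds its dimension.
\<close>

section \<open>Binary forms and the resultant\<close>

text \<open>Homogenizing makes a zero at infinity a zero like any other. This is what the resultant in
  formal degree \<open>d\<close> detects, since the actual degrees of the polynomials may be smaller.\<close>

definition form :: "nat \<Rightarrow> (nat \<Rightarrow> complex) \<Rightarrow> complex \<Rightarrow> complex \<Rightarrow> complex" where
  "form d a x y = (\<Sum>k\<le>d. a k * x ^ k * y ^ (d - k))"

definition common_zero :: "nat \<Rightarrow> (nat \<Rightarrow> complex) \<Rightarrow> (nat \<Rightarrow> complex) \<Rightarrow> bool" where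
  "common_zero d a b \<longleftrightarrow> (\<exists>x y. (x, y) \<noteq> (0, 0) \<and> form d a x y = 0 \<and> form d b x y = 0)"

lemma coeff_vec_poly: "coeff (vec_poly d a) k = (if k \<le> d then a k else 0)"
  by (auto simp: vec_poly_def coeff_sum coeff_monom sum.delta)

lemma degree_vec_poly: "degree (vec_poly d a) \<le> d"
  by (rule degree_le) (simp add: coeff_vec_poly)

lemma poly_vec_poly: "poly (vec_poly d a) z = (\<Sum>k\<le>d. a k * z ^ k)"
  by (simp add: vec_poly_def poly_sum poly_monom)

lemma form_1: "form d a x 1 = poly (vec_poly d a) x"
  by (simp add: poly_vec_poly form_def)

lemma form_0: "form d a x 0 = a d * x ^ d"
proof -
  have "form d a x 0 = (\<Sum>k\<le>d. if k = d then a d * x ^ d else 0)"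
    unfolding form_def by (rule sum.cong) (auto simp: power_0_left)
  then show ?thesis by simp
qed

lemma form_0_1: "form d a 0 1 = a 0"
proof -
  have "form d a 0 1 = (\<Sum>k\<le>d. if k = 0 then a 0 else 0)"
    unfolding form_def by (rule sum.cong) (auto simp: power_0_left)
  then show ?thesis by simp
qed

lemma form_scale: "form d a (s * x) (s * y) = s ^ d * form d a x y"
  unfolding form_def sum_distrib_left
proof (rule sum.cong)
  fix k assume "k \<in> {..d}"
  then have "s ^ d = s ^ k * s ^ (d - k)" by (simp flip: power_add)
  then show "a k * (s * x) ^ k * (s * y) ^ (d - k) = s ^ d * (a k * x ^ k * y ^ (d - k))"
    by (simp add: power_mult_distrib algebra_simps)
qed simp

lemma form_poly: assumes "y \<noteq> 0" shows "form d a x y = y ^ d * poly (vec_poly d a) (x / y)"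
  using form_scale[of d a y "x / y" 1] assms by (simp add: form_1)

lemma form_inject: assumes "\<And>x y. form d a x y = form d b x y" "k \<le> d" shows "a k = b k"
proof -
  have "poly (vec_poly d a) = poly (vec_poly d b)"
    using assms(1)[of _ 1] by (auto simp: form_1)
  then have "vec_poly d a = vec_poly d b" by (simp only: poly_eq_poly_eq_iff) 
  then show ?thesis using assms(2) by (metis coeff_vec_poly)
qed

lemma form_cmult: "form d (\<lambda>k. s * a k) x y = s * form d a x y"
  by (simp add: form_def sum_distrib_left mult_ac)

lemma form_add: "form d (\<lambda>k. a k + b k) x y = form d a x y + form d b x y"
  by (simp add: form_def sum.distrib algebra_simps)

lemma form_cong: "(\<And>k. k \<le> d \<Longrightarrow> a k = b k) \<Longrightarrow> form d a x y = form d b x y"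
  by (simp add: form_def)

lemma form_zero_exists:
  assumes "d \<ge> 1" shows "\<exists>x y. (x, y) \<noteq> (0, 0) \<and> form d a x y = 0"
proof (cases "a d = 0")
  case True
  then have "form d a 1 0 = 0" by (simp add: form_0)
  then show ?thesis by (intro exI[of _ 1] exI[of _ 0]) auto
next
  case False
  then have "degree (vec_poly d a) = d"
    by (metis coeff_vec_poly degree_vec_poly le_antisym le_degree order_refl)
  then have "\<not> constant (poly (vec_poly d a))"
    using assms by (simp add: constant_degree)
  then obtain z where "poly (vec_poly d a) z = 0"
    using fundamental_theorem_of_algebra by blast
  then show ?thesis by (intro exI[of _ z] exI[of _ 1]) (auto simp: form_1)
qed

text \<open>Over the complex numbers a polynomial without a common root with \<open>q\<close> is coprime to \<open>q\<close>:
  the linear factors of \<open>p\<close> can be cancelled from \<open>v\<close> one root at a time.\<close>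

lemma dvd_mult_no_common_root:
  fixes p q v :: "complex poly"
  assumes "p dvd v * q" "\<And>z. \<not> (poly p z = 0 \<and> poly q z = 0)" "p \<noteq> 0"
  shows "p dvd v"
  using assms
proof (induction "degree p" arbitrary: p v)
  case 0
  then show ?case by (metis is_unit_iff_degree unit_imp_dvd)
next
  case (Suc n)
  then obtain z where z: "poly p z = 0"
    using fundamental_theorem_of_algebra[of p] by (auto simp: constant_degree)
  then obtain p' where p': "p = [:-z, 1:] * p'" by (meson dvdE poly_eq_0_iff_dvd)
  obtain k where k: "v * q = p * k" using Suc.prems(1) by (rule dvdE)
  have "poly v z * poly q z = 0" using arg_cong[OF k, of "\<lambda>p. poly p z"] z by simp
  then have "poly v z = 0" using Suc.prems(2)[of z] z by simp
  then obtain v' where v': "v = [:-z, 1:] * v'" by (meson dvdE poly_eq_0_iff_dvd)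
  have "[:-z, 1:] * (v' * q) = [:-z, 1:] * (p' * k)"
    using k unfolding p' v' by (simp only: mult.assoc)
  then have "v' * q = p' * k" using mult_left_cancel[of "[:-z, 1:]"] by simp
  then have "p' dvd v' * q" by simp
  moreover have p0: "p' \<noteq> 0" using Suc.prems(3) p' by auto
  moreover have "degree p = Suc (degree p')"
    unfolding p' using p0 by (subst degree_mult_eq) auto
  moreover have "\<not> (poly p' w = 0 \<and> poly q w = 0)" for w
    using Suc.prems(2)[of w] by (auto simp: p')
  ultimately have "p' dvd v'" using Suc.hyps(1)[of p' v'] Suc.hyps(2) by simp
  then show ?case unfolding p' v' by (rule mult_dvd_mono[OF dvd_refl])
qed

lemma not_common_zeroD:
  assumes "\<not> common_zero d a b"
  shows "\<not> (poly (vec_poly d a) z = 0 \<and> poly (vec_poly d b) z = 0)" "a d \<noteq> 0 \<or> b d \<noteq> 0"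
proof -
  show "\<not> (poly (vec_poly d a) z = 0 \<and> poly (vec_poly d b) z = 0)"
    using assms unfolding common_zero_def by (metis form_1 prod.inject zero_neq_one)
  show "a d \<noteq> 0 \<or> b d \<noteq> 0"
  proof (rule ccontr)
    assume "\<not> ?thesis"
    then have "form d a 1 0 = 0" "form d b 1 0 = 0" by (auto simp: form_0)
    with assms show False unfolding common_zero_def by (metis prod.inject zero_neq_one)
  qed
qed

lemma common_zero_commute: "common_zero d a b \<longleftrightarrow> common_zero d b a"
  by (auto simp: common_zero_def)

lemma vec_poly_nonzero:
  assumes "\<not> common_zero d a b" "d \<ge> 1"
  shows "vec_poly d a \<noteq> 0"
proof
  assume "vec_poly d a = 0"
  then have "a k = 0" if "k \<le> d" for k
    using coeff_vec_poly[of d a k] that by simp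
  then have "form d a x y = 0" for x y
    by (simp add: form_def)
  then show False using form_zero_exists[OF assms(2), of b] assms(1)
    unfolding common_zero_def by blast
qed

text \<open>Applied to the vector of the monomials of degree \<open>2d - 1\<close>, a row of the Sylvester matrix is
  a monomial of degree \<open>d - 1\<close> times one of the two forms. Both directions of the resultant
  criterion below read off their information from this identity.\<close>

lemma sylvester_row:
  fixes a b :: "nat \<Rightarrow> complex" and d i :: nat
  defines "M \<equiv> sylvester_mat_sub d d (vec_poly d a) (vec_poly d b)"
  assumes i: "i < 2 * d"
  shows "(\<Sum>j<2 * d. M $$ (i, j) * (x ^ (2 * d - 1 - j) * y ^ j)) =
     (if i < d then x ^ (d - 1 - i) * y ^ i * form d a x y
      else x ^ (2 * d - 1 - i) * y ^ (i - d) * form d b x y)"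
proof (cases "i < d")
  case True
  have "(\<Sum>j<2 * d. M $$ (i, j) * (x ^ (2 * d - 1 - j) * y ^ j)) =
     (\<Sum>j\<in>{i..d+i}. a (d + i - j) * (x ^ (2 * d - 1 - j) * y ^ j))"
  proof (rule sum.mono_neutral_cong_right)
    show "{i..d+i} \<subseteq> {..<2*d}" using True by auto
  qed (use True i in \<open>auto simp: M_def sylvester_mat_sub_index coeff_vec_poly\<close>)
  also have "\<dots> = (\<Sum>k\<le>d. a k * (x ^ (2 * d - 1 - (d + i - k)) * y ^ (d + i - k)))"
    by (rule sum.reindex_bij_witness[of _ "\<lambda>k. d + i - k" "\<lambda>j. d + i - j"]) auto
  also have "\<dots> = x ^ (d - 1 - i) * y ^ i * form d a x y"
    unfolding form_def sum_distrib_left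
  proof (rule sum.cong)
    fix k assume k: "k \<in> {..d}"
    then have e: "2 * d - 1 - (d + i - k) = (d - 1 - i) + k" "d + i - k = i + (d - k)"
      using True by auto
    show "a k * (x ^ (2 * d - 1 - (d + i - k)) * y ^ (d + i - k)) =
         x ^ (d - 1 - i) * y ^ i * (a k * x ^ k * y ^ (d - k))"
      by (subst e(1), subst e(2)) (simp add: power_add)
  qed simp
  finally show ?thesis using True by simp
next
  case False
  have "(\<Sum>j<2 * d. M $$ (i, j) * (x ^ (2 * d - 1 - j) * y ^ j)) =
     (\<Sum>j\<in>{i-d..i}. b (i - j) * (x ^ (2 * d - 1 - j) * y ^ j))"
  proof (rule sum.mono_neutral_cong_right)
    show "{i-d..i} \<subseteq> {..<2*d}" using i by auto
  qed (use False i in \<open>auto simp: M_def sylvester_mat_sub_index coeff_vec_poly\<close>)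
  also have "\<dots> = (\<Sum>k\<le>d. b k * (x ^ (2 * d - 1 - (i - k)) * y ^ (i - k)))"
    by (rule sum.reindex_bij_witness[of _ "\<lambda>k. i - k" "\<lambda>j. i - j"]) (use False in auto)
  also have "\<dots> = x ^ (2 * d - 1 - i) * y ^ (i - d) * form d b x y"
    unfolding form_def sum_distrib_left
  proof (rule sum.cong)
    fix k assume k: "k \<in> {..d}"
    then have e: "2 * d - 1 - (i - k) = (2 * d - 1 - i) + k" "i - k = (i - d) + (d - k)"
      using False i by auto
    show "b k * (x ^ (2 * d - 1 - (i - k)) * y ^ (i - k)) =
         x ^ (2 * d - 1 - i) * y ^ (i - d) * (b k * x ^ k * y ^ (d - k))"
      by (subst e(1), subst e(2)) (simp add: power_add)
  qed simp
  finally show ?thesis using False by simp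
qed

text \<open>A common zero makes the vector of monomials a nonzero element of the kernel of the Sylvester
  matrix. Conversely a linear dependence between the rows is a relation \<open>U a + V b = 0\<close> with \<open>U\<close>
  and \<open>V\<close> of degree less than \<open>d\<close>, which cannot hold when \<open>a\<close> and \<open>b\<close> have no common root and one
  of them has degree \<open>d\<close>.\<close>

lemma formal_resultant_eq_0_iff:
  assumes d: "d \<ge> 1"
  shows "formal_resultant d (vec_poly d a) (vec_poly d b) = 0 \<longleftrightarrow> common_zero d a b"
proof -
  define M where "M = sylvester_mat_sub d d (vec_poly d a) (vec_poly d b)"
  have M: "M \<in> carrier_mat (2 * d) (2 * d)"
    unfolding M_def using sylvester_mat_sub_carrier[of d d] by (simp add: mult_2)
  note row = sylvester_row[where a = a and b = b and d = d, folded M_def]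
  show ?thesis
  proof
    assume "common_zero d a b"
    then obtain x y where xy: "(x, y) \<noteq> (0, 0)" "form d a x y = 0" "form d b x y = 0"
      unfolding common_zero_def by blast
    define v where "v = Matrix.vec (2 * d) (\<lambda>j. x ^ (2 * d - 1 - j) * y ^ j)"
    have "v \<noteq> 0\<^sub>v (2 * d)"
    proof
      assume "v = 0\<^sub>v (2 * d)"
      then have *: "x ^ (2 * d - 1 - j) * y ^ j = 0" if "j < 2 * d" for j
      proof -
        have "v $ j = 0" using \<open>v = 0\<^sub>v (2 * d)\<close> that by simp
        then show ?thesis using that by (simp only: v_def index_vec)
      qed
      show False using *[of 0] *[of "2 * d - 1"] xy(1) d by auto
    qed
    moreover have "M *\<^sub>v v = 0\<^sub>v (2 * d)"
    proof
      fix i assume "i < dim_vec (0\<^sub>v (2 * d) :: complex Matrix.vec)"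
      then have i: "i < 2 * d" by simp
      have "(M *\<^sub>v v) $ i = (\<Sum>j<2 * d. M $$ (i, j) * (x ^ (2 * d - 1 - j) * y ^ j))"
        using i M by (simp add: scalar_prod_def v_def lessThan_atLeast0)
      also have "\<dots> = 0" using row[OF i] xy by simp
      finally show "(M *\<^sub>v v) $ i = 0\<^sub>v (2 * d) $ i" using i by simp
    qed (use M in auto)
    moreover have "v \<in> carrier_vec (2 * d)" by (simp add: v_def)
    ultimately show "formal_resultant d (vec_poly d a) (vec_poly d b) = 0"
      unfolding formal_resultant_def M_def[symmetric] using det_0_iff_vec_prod_zero_field[OF M] by blast
  next
    assume "formal_resultant d (vec_poly d a) (vec_poly d b) = 0"
    then have "Determinant.det (transpose_mat M) = 0"
      by (simp add: formal_resultant_def M_def[symmetric] Determinant.det_transpose[OF M])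
    moreover have MT: "transpose_mat M \<in> carrier_mat (2 * d) (2 * d)" using M by simp
    ultimately obtain w where w: "w \<in> carrier_vec (2 * d)" "w \<noteq> 0\<^sub>v (2 * d)"
        "transpose_mat M *\<^sub>v w = 0\<^sub>v (2 * d)"
      using det_0_iff_vec_prod_zero_field[OF MT] by blast
    have col: "(\<Sum>i<2 * d. w $ i * M $$ (i, j)) = 0" if j: "j < 2 * d" for j
    proof -
      have "(transpose_mat M *\<^sub>v w) $ j = (\<Sum>i<2 * d. M $$ (i, j) * w $ i)"
        using j M w(1) by (simp add: scalar_prod_def lessThan_atLeast0)
      then show ?thesis using w(3) j by (simp add: mult.commute)
    qed
    \<comment> \<open>The two halves of the dependence \<open>w\<close> are the coefficients of the two cofactors.\<close>
    define U where "U = (\<Sum>i<d. monom (w $ i) (d - 1 - i))"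
    define V where "V = (\<Sum>i<d. monom (w $ (d + i)) (d - 1 - i))"
    have cU: "coeff U (d - 1 - i) = w $ i" and cV: "coeff V (d - 1 - i) = w $ (d + i)"
      if "i < d" for i
    proof -
      have *: "(d - Suc j = d - Suc i) = (j = i)" if "j < d" for j
        using that \<open>i < d\<close> by auto
      have "coeff U (d - 1 - i) = (\<Sum>j<d. if j = i then w $ i else 0)"
        unfolding U_def coeff_sum by (rule sum.cong) (auto simp: coeff_monom *)
      then show "coeff U (d - 1 - i) = w $ i" using that by simp
      have "coeff V (d - 1 - i) = (\<Sum>j<d. if j = i then w $ (d + i) else 0)"
        unfolding V_def coeff_sum by (rule sum.cong) (auto simp: coeff_monom *)
      then show "coeff V (d - 1 - i) = w $ (d + i)" using that by simp
    qed
    have degU: "degree U < d" and degV: "degree V < d"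
      unfolding U_def V_def using d
      by (auto intro!: le_less_trans[OF degree_sum_le[where n="d - 1"]]
            intro: order_trans[OF degree_monom_le])
    have UV: "U \<noteq> 0 \<or> V \<noteq> 0"
    proof (rule ccontr)
      assume "\<not> ?thesis"
      then have z: "w $ i = 0" "w $ (d + i) = 0" if "i < d" for i
        using cU[OF that] cV[OF that] by auto
      have "w $ i = 0" if "i < 2 * d" for i
        using z(1)[of i] z(2)[of "i - d"] that by (cases "i < d") auto
      then have "w = 0\<^sub>v (2 * d)" using w(1) by auto
      with w(2) show False by simp
    qed
    have "poly (U * vec_poly d a + V * vec_poly d b) x = 0" for x
    proof -
      have "0 = (\<Sum>j<2*d. (\<Sum>i<2 * d. w $ i * M $$ (i, j)) * x ^ (2 * d - 1 - j))"
        using col by simp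
      also have "\<dots> = (\<Sum>i<2*d. w $ i * (\<Sum>j<2*d. M $$ (i, j) * (x ^ (2 * d - 1 - j) * 1 ^ j)))"
        unfolding sum_distrib_left sum_distrib_right
        by (subst sum.swap) (simp add: mult_ac)
      also have "\<dots> = (\<Sum>i<2*d. w $ i * (if i < d then x ^ (d - 1 - i) * form d a x 1
      else x ^ (2 * d - 1 - i) * form d b x 1))"
        by (rule sum.cong[OF refl], subst row) auto
      also have "{..<2*d} = {..<d} \<union> (+) d ` {..<d}"
      proof -
        have "{d..<2*d} = (+) d ` {0..<d}" by (simp add: mult_2)
        moreover have "{..<2*d} = {..<d} \<union> {d..<2*d}" by auto
        ultimately show ?thesis by (simp add: lessThan_atLeast0)
      qed
      also have "(\<Sum>i\<in>{..<d} \<union> (+) d ` {..<d}. w $ i * (if i < d then x ^ (d - 1 - i) * form d a x 1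
          else x ^ (2 * d - 1 - i) * form d b x 1)) =
        (\<Sum>i<d. w $ i * (x ^ (d - 1 - i) * form d a x 1)) +
        (\<Sum>i<d. w $ (d + i) * (x ^ (d - 1 - i) * form d b x 1))"
        by (subst sum.union_disjoint) (auto simp: sum.reindex mult_2 intro!: sum.cong)
      also have "\<dots> = poly (U * vec_poly d a + V * vec_poly d b) x"
        by (simp add: U_def V_def poly_sum poly_monom sum_distrib_right sum_distrib_left form_1 mult_ac)
      finally show ?thesis by simp
    qed
    then have rel: "U * vec_poly d a + V * vec_poly d b = 0"
      using poly_all_0_iff_0 by blast
    show "common_zero d a b"
    proof (rule ccontr)
      assume ncz: "\<not> common_zero d a b"
      have ncz': "\<not> common_zero d b a" using ncz by (simp add: common_zero_commute)
      note root = not_common_zeroD(1)[OF ncz] and root' = not_common_zeroD(1)[OF ncz']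
      have "vec_poly d a dvd V * vec_poly d b"
        using rel by (metis dvd_add_right_iff dvd_0_right dvd_triv_right)
      then have 1: "vec_poly d a dvd V"
        using root vec_poly_nonzero[OF ncz d] by (rule dvd_mult_no_common_root)
      have "vec_poly d b dvd U * vec_poly d a"
        using rel by (metis dvd_add_left_iff dvd_0_right dvd_triv_right)
      then have 2: "vec_poly d b dvd U"
        using root' vec_poly_nonzero[OF ncz' d] by (rule dvd_mult_no_common_root)
      from not_common_zeroD(2)[OF ncz] show False
      proof
        assume a: "a d \<noteq> 0"
        then have "degree (vec_poly d a) \<ge> d" by (simp add: coeff_vec_poly le_degree)
        then have "V = 0" using 1 degV by (metis dvd_imp_degree_le not_le order_trans)
        then have "U = 0" using rel a by (metis add.right_neutral coeff_0 coeff_vec_poly mult_eq_0_iff mult_zero_left order_refl)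
        with \<open>V = 0\<close> UV show False by simp
      next
        assume b: "b d \<noteq> 0"
        then have "degree (vec_poly d b) \<ge> d" by (simp add: coeff_vec_poly le_degree)
        then have "U = 0" using 2 degU by (metis dvd_imp_degree_le not_le order_trans)
        then have "V = 0" using rel b by (metis add.left_neutral coeff_0 coeff_vec_poly mult_eq_0_iff mult_zero_left order_refl)
        with \<open>U = 0\<close> UV show False by simp
      qed
    qed
  qed
qed

section \<open>Rational maps as pairs of binary forms\<close>

text \<open>Homogeneous coordinates on the sphere. In them the rational map, the Moebius transformations
  and the antipodal map are given by formulas without a case distinction at infinity.\<close>

definition pt :: "complex \<Rightarrow> complex \<Rightarrow> riemann_sphere" where
  "pt x y = (if y = 0 then Infty else Fin (x / y))"

lemma pt_surj: obtains x y where "(x, y) \<noteq> (0, 0)" "w = pt x y"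
proof (cases w)
  case (Fin z) then show ?thesis using that[of z 1] by (simp add: pt_def)
next
  case Infty then show ?thesis using that[of 1 0] by (simp add: pt_def)
qed

lemma pt_eq_iff:
  assumes "(x, y) \<noteq> (0, 0)" "(x', y') \<noteq> (0, 0)"
  shows "pt x y = pt x' y' \<longleftrightarrow> x * y' = x' * y"
  using assms by (auto simp: pt_def field_simps)

lemma pt_scale: "s \<noteq> 0 \<Longrightarrow> pt (s * x) (s * y) = pt x y"
  by (simp add: pt_def)

lemma tau1_pt: "(x, y) \<noteq> (0, 0) \<Longrightarrow> tau1 (pt x y) = pt (- cnj y) (cnj x)"
  by (auto simp: pt_def field_simps)

lemma moebius_pt:
  assumes "a * d - b * c \<noteq> 0" "(x, y) \<noteq> (0, 0)"
  shows "moebius a b c d (pt x y) = pt (a * x + b * y) (c * x + d * y)"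
proof (cases "y = 0")
  case True
  then show ?thesis using assms by (auto simp: pt_def)
next
  case False
  have e: "c * (x / y) + d = (c * x + d * y) / y" "a * (x / y) + b = (a * x + b * y) / y"
    using False by (simp_all add: field_simps)
  have g: "(if v / y = 0 then Infty else Fin ((u / y) / (v / y))) = pt u v" for u v
    using False by (simp add: pt_def)
  have "moebius a b c d (pt x y) =
      (if c * (x / y) + d = 0 then Infty else Fin ((a * (x / y) + b) / (c * (x / y) + d)))"
    using False by (simp only: pt_def moebius.simps if_False)
  also have "\<dots> = pt (a * x + b * y) (c * x + d * y)"
    unfolding e by (rule g)
  finally show ?thesis .
qed

lemma lin_nonzero:
  fixes a b c d x y :: complex
  assumes "a * d - b * c \<noteq> 0" "(x, y) \<noteq> (0, 0)"
  shows "(a * x + b * y, c * x + d * y) \<noteq> (0, 0)"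
proof
  assume "(a * x + b * y, c * x + d * y) = (0, 0)"
  then have e: "a * x + b * y = 0" "c * x + d * y = 0" by auto
  have "(a * d - b * c) * x = d * (a * x + b * y) - b * (c * x + d * y)"
    "(a * d - b * c) * y = a * (c * x + d * y) - c * (a * x + b * y)"
    by (simp_all add: algebra_simps)
  then have "(a * d - b * c) * x = 0" "(a * d - b * c) * y = 0" unfolding e by simp_all
  with assms show False by auto
qed

definition cvec :: "nat \<Rightarrow> (nat \<Rightarrow> complex) set" where
  "cvec n = {c. \<forall>i\<ge>n. c i = 0}"

lemma topspace_coord_space: "topspace (coord_space n :: (nat \<Rightarrow> complex) topology) = cvec n"
  by (simp add: coord_space_def cvec_def)

text \<open>The pairs of forms without a common zero, which are those that define maps of degree exactly \<open>d\<close>.\<close>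

definition nondeg :: "nat \<Rightarrow> (nat \<Rightarrow> complex) \<Rightarrow> bool" where
  "nondeg d c \<longleftrightarrow> \<not> common_zero d (numer d c) (denom d c)"

lemma nondegD: "nondeg d c \<Longrightarrow> (x, y) \<noteq> (0, 0) \<Longrightarrow>
   (form d (numer d c) x y, form d (denom d c) x y) \<noteq> (0, 0)"
  by (auto simp: nondeg_def common_zero_def)

lemma nondegI: "(\<And>x y. (x, y) \<noteq> (0, 0) \<Longrightarrow> form d (numer d c) x y = 0 \<Longrightarrow> form d (denom d c) x y = 0 \<Longrightarrow> False)
   \<Longrightarrow> nondeg d c"
  unfolding nondeg_def common_zero_def by blast

lemma join_numer_denom: "c \<in> cvec (2 * d + 2) \<Longrightarrow> join_coeffs d (numer d c) (denom d c) = c"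
  by (auto simp: join_coeffs_def numer_def denom_def cvec_def fun_eq_iff)

lemma numer_join: "a \<in> cvec (Suc d) \<Longrightarrow> numer d (join_coeffs d a b) = a"
  by (auto simp: join_coeffs_def numer_def cvec_def fun_eq_iff)

lemma denom_join: "b \<in> cvec (Suc d) \<Longrightarrow> denom d (join_coeffs d a b) = b"
  by (auto simp: join_coeffs_def denom_def cvec_def fun_eq_iff)

lemma join_cvec: "join_coeffs d a b \<in> cvec (2 * d + 2)"
  by (auto simp: join_coeffs_def cvec_def)

lemma numer_cvec: "numer d c \<in> cvec (Suc d)" and denom_cvec: "denom d c \<in> cvec (Suc d)"
  by (auto simp: numer_def denom_def cvec_def)

lemma antipodal_cvec: "antipodal_coeffs d a \<in> cvec (Suc d)"
  by (auto simp: antipodal_coeffs_def cvec_def)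

lemma cvec_mult: "c \<in> cvec n \<Longrightarrow> (\<lambda>i. s * c i) \<in> cvec n"
  by (auto simp: cvec_def)

lemma form_ext:
  assumes "a \<in> cvec (Suc d)" "b \<in> cvec (Suc d)" "\<And>x y. form d a x y = form d b x y"
  shows "a = b"
proof
  fix k show "a k = b k"
    using form_inject[OF assms(3), of k] assms(1,2) by (cases "k \<le> d") (auto simp: cvec_def)
qed

lemma cvec_ext:
  assumes "c \<in> cvec (2 * d + 2)" "c' \<in> cvec (2 * d + 2)"
    "\<And>x y. form d (numer d c) x y = form d (numer d c') x y"
    "\<And>x y. form d (denom d c) x y = form d (denom d c') x y"
  shows "c = c'"
  using form_ext[OF numer_cvec numer_cvec assms(3)] form_ext[OF denom_cvec denom_cvec assms(4)]
    join_numer_denom[OF assms(1)] join_numer_denom[OF assms(2)] by metis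

lemma numer_mult: "numer d (\<lambda>i. s * c i) = (\<lambda>i. s * numer d c i)"
  and denom_mult: "denom d (\<lambda>i. s * c i) = (\<lambda>i. s * denom d c i)"
  by (auto simp: numer_def denom_def)

lemma nondeg_mult: "s \<noteq> 0 \<Longrightarrow> nondeg d (\<lambda>i. s * c i) \<longleftrightarrow> nondeg d c"
  by (simp add: nondeg_def common_zero_def numer_mult denom_mult form_cmult)

lemma nondeg_nonzero: "nondeg d c \<Longrightarrow> c \<noteq> (\<lambda>_. 0)"
  using nondegD[of d c 1 0] by (auto simp: form_def numer_def denom_def)

lemma rat_eval_pt:
  assumes "(x, y) \<noteq> (0, 0)"
  shows "rat_eval d c (pt x y) = pt (form d (numer d c) x y) (form d (denom d c) x y)"
proof (cases "y = 0")
  case True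
  then show ?thesis using assms by (auto simp: pt_def form_0)
next
  case False
  have "pt (form d (numer d c) x y) (form d (denom d c) x y)
      = pt (y ^ d * (\<Sum>k\<le>d. numer d c k * (x / y) ^ k)) (y ^ d * (\<Sum>k\<le>d. denom d c k * (x / y) ^ k))"
    using False by (simp add: form_poly poly_vec_poly)
  also have "\<dots> = pt (\<Sum>k\<le>d. numer d c k * (x / y) ^ k) (\<Sum>k\<le>d. denom d c k * (x / y) ^ k)"
    using False by (intro pt_scale) auto
  finally show ?thesis using False by (simp add: pt_def Let_def)
qed

lemma sphere_fun_eqI:
  assumes "\<And>x y. (x, y) \<noteq> (0, 0) \<Longrightarrow> f (pt x y) = g (pt x y)"
  shows "f = g"
proof
  fix w
  obtain x y where "(x, y) \<noteq> (0, 0)" "w = pt x y" by (rule pt_surj)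
  then show "f w = g w" using assms by simp
qed

lemma rat_eval_mult: "s \<noteq> 0 \<Longrightarrow> rat_eval d (\<lambda>i. s * c i) = rat_eval d c"
  by (rule sphere_fun_eqI) (simp add: rat_eval_pt numer_mult denom_mult form_cmult pt_scale)

lemma proj_class_self: "c \<in> proj_class c"
  unfolding proj_class_def by (rule CollectI, rule exI[of _ 1]) simp

lemma proj_class_mult: assumes "s \<noteq> 0" shows "proj_class (\<lambda>i. s * c i) = proj_class c"
proof (rule Set.set_eqI, rule iffI)
  fix z assume "z \<in> proj_class (\<lambda>i. s * c i)"
  then obtain t where "t \<noteq> 0" "z = (\<lambda>i. t * (s * c i))" by (auto simp: proj_class_def)
  then show "z \<in> proj_class c" using assms
    unfolding proj_class_def by (intro CollectI exI[of _ "t * s"]) (auto simp: mult.assoc)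
next
  fix z assume "z \<in> proj_class c"
  then obtain t where "t \<noteq> 0" "z = (\<lambda>i. t * c i)" by (auto simp: proj_class_def)
  then show "z \<in> proj_class (\<lambda>i. s * c i)" using assms
    unfolding proj_class_def by (intro CollectI exI[of _ "t / s"]) (auto simp: mult.assoc)
qed

lemma proj_class_eq_iff: "proj_class c = proj_class c' \<longleftrightarrow> (\<exists>s. s \<noteq> 0 \<and> c' = (\<lambda>i. s * c i))"
proof
  assume "proj_class c = proj_class c'"
  then have "c' \<in> proj_class c" using proj_class_self by auto
  then show "\<exists>s. s \<noteq> 0 \<and> c' = (\<lambda>i. s * c i)" by (auto simp: proj_class_def)
qed (auto simp: proj_class_mult)

lemma rat_map_proj: "rat_map d (proj_class c) = rat_eval d c"
proof -
  have "rat_eval d ` proj_class c = {rat_eval d c}"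
    using proj_class_self[of c] by (auto simp: proj_class_def rat_eval_mult)
  then show ?thesis by (simp add: rat_map_def)
qed

definition nondeg_vecs :: "nat \<Rightarrow> (nat \<Rightarrow> complex) set" where
  "nondeg_vecs d = {c \<in> cvec (2 * d + 2). nondeg d c}"

lemma topspace_proj: "topspace (complex_proj_space n) = proj_class ` (cvec (Suc n) - {\<lambda>_. 0})"
  unfolding complex_proj_space_def by (auto simp: topspace_coord_space)

lemma Rat_eq: assumes "d \<ge> 1" shows "Rat d = proj_class ` nondeg_vecs d"
proof (rule Set.set_eqI)
  fix \<phi>
  have "(\<forall>c'\<in>proj_class c. formal_resultant d (vec_poly d (numer d c')) (vec_poly d (denom d c')) \<noteq> 0)
     \<longleftrightarrow> nondeg d c" for c
    unfolding formal_resultant_eq_0_iff[OF assms] nondeg_def[symmetric]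
    using nondeg_mult proj_class_self[of c] unfolding proj_class_def by blast
  moreover have "Suc (2 * d + 1) = 2 * d + 2" by simp
  ultimately show "\<phi> \<in> Rat d \<longleftrightarrow> \<phi> \<in> proj_class ` nondeg_vecs d"
    unfolding Rat_def topspace_proj nondeg_vecs_def using nondeg_nonzero by auto
qed

text \<open>Equality of the values gives \<open>p q' = p' q\<close>. As \<open>p\<close> and \<open>q\<close> have no common root, \<open>p\<close> divides
  \<open>p'\<close>, and by symmetry \<open>p'\<close> divides \<open>p\<close>, so that the pairs are proportional. Hence the points of
  \<^const>\<open>Rat\<close> may be treated as self-maps of the sphere.\<close>

lemma rat_eval_inject:
  assumes d: "d \<ge> 1" and c: "c \<in> nondeg_vecs d" "c' \<in> nondeg_vecs d"
    and eq: "rat_eval d c = rat_eval d c'"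
  shows "proj_class c = proj_class c'"
proof -
  define P Q P' Q' where PQ: "P = vec_poly d (numer d c)" "Q = vec_poly d (denom d c)"
    "P' = vec_poly d (numer d c')" "Q' = vec_poly d (denom d c')"
  have nd: "nondeg d c" "nondeg d c'" and cv: "c \<in> cvec (2 * d + 2)" "c' \<in> cvec (2 * d + 2)"
    using c by (auto simp: nondeg_vecs_def)
  note ncz = nd[unfolded nondeg_def]
  have "poly (P * Q') x = poly (P' * Q) x" for x
  proof -
    have "rat_eval d c (pt x 1) = rat_eval d c' (pt x 1)" using eq by simp
    then have "form d (numer d c) x 1 * form d (denom d c') x 1 =
       form d (numer d c') x 1 * form d (denom d c) x 1"
      using pt_eq_iff[OF nondegD[OF nd(1)] nondegD[OF nd(2)], of x 1 x 1]
      by (simp add: rat_eval_pt)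
    then show ?thesis by (simp add: PQ form_1)
  qed
  then have "poly (P * Q') = poly (P' * Q)" by (rule ext)
  then have rel: "P * Q' = P' * Q" by (simp only: poly_eq_poly_eq_iff)
  have P0: "P \<noteq> 0" "P' \<noteq> 0"
    using vec_poly_nonzero[OF ncz(1) d] vec_poly_nonzero[OF ncz(2) d] by (auto simp: PQ)
  have "P dvd P' * Q" unfolding rel[symmetric] by (rule dvd_triv_left)
  then have "P dvd P'"
    using not_common_zeroD(1)[OF ncz(1)] P0(1) unfolding PQ by (rule dvd_mult_no_common_root)
  have "P' dvd P * Q'" unfolding rel by (rule dvd_triv_left)
  then have "P' dvd P"
    using not_common_zeroD(1)[OF ncz(2)] P0(2) unfolding PQ by (rule dvd_mult_no_common_root)
  obtain k where k: "P' = P * k" using \<open>P dvd P'\<close> by (rule dvdE)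
  obtain l where l: "P = P' * l" using \<open>P' dvd P\<close> by (rule dvdE)
  have "P * (k * l) = P' * l" by (simp only: k mult.assoc)
  also have "\<dots> = P * 1" unfolding l[symmetric] by simp
  finally have "P * (k * l) = P * 1" .
  then have "k * l = 1" using P0(1) mult_left_cancel by blast
  then have "is_unit k" by (metis dvd_triv_left)
  moreover have k0: "k \<noteq> 0" using P0(2) k by auto
  ultimately have "degree k = 0" by (simp add: is_unit_iff_degree)
  then obtain s where s: "k = [:s:]" by (rule degree_eq_zeroE)
  have s0: "s \<noteq> 0" using k0 s by auto
  have P': "P' = smult s P" unfolding k s by (simp add: mult.commute)
  have "P * Q' = P * smult s Q" unfolding rel unfolding P' by simp
  then have Q': "Q' = smult s Q" using P0(1) mult_left_cancel by blast
  have "c' = (\<lambda>i. s * c i)"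
  proof (rule cvec_ext[OF cv(2) cvec_mult[OF cv(1)]])
    have *: "numer d c' k = s * numer d c k" "denom d c' k = s * denom d c k" if "k \<le> d" for k
      using arg_cong[OF P', of "\<lambda>p. coeff p k"] arg_cong[OF Q', of "\<lambda>p. coeff p k"] that
      by (auto simp: PQ coeff_vec_poly)
    fix x y
    show "form d (numer d c') x y = form d (numer d (\<lambda>i. s * c i)) x y"
      unfolding numer_mult by (rule form_cong) (simp add: *)
    show "form d (denom d c') x y = form d (denom d (\<lambda>i. s * c i)) x y"
      unfolding denom_mult by (rule form_cong) (simp add: *)
  qed
  then show ?thesis using s0 proj_class_eq_iff by blast
qed

section \<open>Maps commuting with the antipodal map\<close>

text \<open>In homogeneous coordinates the antipodal map is \<open>(x, y) \<mapsto> (- cnj y, cnj x)\<close>, so up to a sign the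
  antipodal coefficients are those of the form pulled back by the antipodal map and conjugated.\<close>

lemma form_antipodal:
  assumes "odd d"
  shows "form d (antipodal_coeffs d a) x y = - cnj (form d a (- cnj y) (cnj x))"
proof -
  have "cnj (form d a (- cnj y) (cnj x)) = (\<Sum>k\<le>d. cnj (a k) * (- y) ^ k * x ^ (d - k))"
    by (simp add: form_def)
  also have "\<dots> = (\<Sum>k\<le>d. cnj (a (d - k)) * (- y) ^ (d - k) * x ^ k)"
    by (rule sum.reindex_bij_witness[of _ "\<lambda>k. d - k" "\<lambda>k. d - k"]) auto
  also have "\<dots> = - form d (antipodal_coeffs d a) x y"
    unfolding form_def sum_negf[symmetric]
  proof (rule sum.cong)
    fix k assume k: "k \<in> {..d}"
    have "(- y) ^ (d - k) = - ((-1) ^ k) * y ^ (d - k)"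
      using assms k by (cases "even k") (auto simp: power_minus_odd)
    then show "cnj (a (d - k)) * (- y) ^ (d - k) * x ^ k = - (antipodal_coeffs d a k * x ^ k * y ^ (d - k))"
      using k by (simp add: antipodal_coeffs_def)
  qed simp
  finally show ?thesis by simp
qed

lemma antipodal_antipodal: "odd d \<Longrightarrow> a \<in> cvec (Suc d) \<Longrightarrow>
    antipodal_coeffs d (antipodal_coeffs d a) = (\<lambda>k. - a k)"
  by (rule form_ext[OF antipodal_cvec], simp add: cvec_def)
     (simp add: form_antipodal form_cmult[of d "-1", simplified] form_scale[of d a "-1", simplified])

lemma antipodal_mult: "antipodal_coeffs d (\<lambda>k. s * a k) = (\<lambda>k. cnj s * antipodal_coeffs d a k)"
  by (auto simp: antipodal_coeffs_def)

definition anti_join :: "nat \<Rightarrow> (nat \<Rightarrow> complex) \<Rightarrow> nat \<Rightarrow> complex" where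
  "anti_join d a = join_coeffs d a (antipodal_coeffs d a)"

lemma numer_anti: "a \<in> cvec (Suc d) \<Longrightarrow> numer d (anti_join d a) = a"
  and denom_anti: "denom d (anti_join d a) = antipodal_coeffs d a"
  by (simp_all add: anti_join_def numer_join denom_join antipodal_cvec)

lemma anti_cvec: "anti_join d a \<in> cvec (2 * d + 2)"
  unfolding anti_join_def by (rule join_cvec)

lemma anti_mult: "anti_join d (\<lambda>k. complex_of_real r * a k) = (\<lambda>i. complex_of_real r * anti_join d a i)"
  by (auto simp: anti_join_def join_coeffs_def antipodal_mult)

definition nonZ :: "nat \<Rightarrow> (nat \<Rightarrow> complex) set" where
  "nonZ d = topspace (coord_space (Suc d)) - Z_locus d"

lemma nonZ_cvec: "a \<in> nonZ d \<Longrightarrow> a \<in> cvec (Suc d)"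
  by (simp add: nonZ_def topspace_coord_space)

lemma nonZ_iff: "d \<ge> 1 \<Longrightarrow> a \<in> nonZ d \<longleftrightarrow> a \<in> cvec (Suc d) \<and> nondeg d (anti_join d a)"
  by (auto simp: nonZ_def topspace_coord_space Z_locus_def formal_resultant_eq_0_iff nondeg_def
      numer_anti denom_anti)

lemma nonZ_anti: "d \<ge> 1 \<Longrightarrow> a \<in> nonZ d \<Longrightarrow> anti_join d a \<in> nondeg_vecs d"
  unfolding nonZ_iff nondeg_vecs_def using anti_cvec by blast

lemma nonZ_nonzero: "d \<ge> 1 \<Longrightarrow> a \<in> nonZ d \<Longrightarrow> \<exists>k\<le>d. a k \<noteq> 0"
proof (rule ccontr)
  assume "1 \<le> d" "a \<in> nonZ d" "\<not> (\<exists>k\<le>d. a k \<noteq> 0)"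
  moreover from this have "anti_join d a = (\<lambda>_. 0)"
    by (auto simp: anti_join_def join_coeffs_def antipodal_coeffs_def fun_eq_iff)
  ultimately show False using nondeg_nonzero nonZ_iff by metis
qed

text \<open>The denominator of an antipodal pair depends antilinearly on its numerator. A scalar relating
  two such pairs therefore equals its own conjugate, which is why the parameters are classes modulo
  real scalars.\<close>

lemma anti_inject:
  assumes d: "d \<ge> 1" and a: "a \<in> cvec (Suc d)" "b \<in> cvec (Suc d)" "\<exists>k\<le>d. a k \<noteq> 0"
    and eq: "anti_join d b = (\<lambda>i. s * anti_join d a i)"
  obtains r where "s = complex_of_real r" "b = (\<lambda>k. complex_of_real r * a k)"
proof -
  have b: "b = (\<lambda>k. s * a k)"
    using arg_cong[OF eq, of "numer d"] a by (simp add: numer_anti numer_mult)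
  have "antipodal_coeffs d b = (\<lambda>k. s * antipodal_coeffs d a k)"
    using arg_cong[OF eq, of "denom d"] by (simp add: denom_anti denom_mult)
  then have *: "(\<lambda>k. cnj s * antipodal_coeffs d a k) = (\<lambda>k. s * antipodal_coeffs d a k)"
    by (simp only: b antipodal_mult)
  obtain k where "k \<le> d" "a k \<noteq> 0" using a(3) by blast
  then have "antipodal_coeffs d a (d - k) \<noteq> 0" by (simp add: antipodal_coeffs_def)
  then have "cnj s = s" using fun_cong[OF *, of "d - k"] by simp
  then have "s = complex_of_real (Re s)" by (simp add: complex_eq_iff)
  then show thesis using that b by metis
qed

text \<open>A line in the space of pairs that is preserved by the antilinear involution
  \<open>(p, q) \<mapsto> (q\<^sup>*, - p\<^sup>*)\<close> is spanned by an antipodal pair. The scalar \<open>s\<close> by which the involution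
  acts on a vector \<open>c\<close> of the line has modulus 1 because the square of the involution is the
  identity for odd \<open>d\<close>, and multiplying \<open>c\<close> by a square root \<open>r\<close> of \<open>- s\<close> changes \<open>s\<close> to \<open>- 1\<close>.\<close>

lemma antipodal_phase:
  assumes d: "odd d" and c: "c \<in> cvec (2 * d + 2)" "c \<noteq> (\<lambda>_. 0)"
    and 1: "antipodal_coeffs d (denom d c) = (\<lambda>k. s * numer d c k)"
    and 2: "antipodal_coeffs d (numer d c) = (\<lambda>k. - (s * denom d c k))"
  obtains r where "cmod r = 1" "(\<lambda>i. r * c i) = anti_join d (\<lambda>k. r * numer d c k)"
proof -
  define a b where ab: "a = numer d c" "b = denom d c"
  have cv: "a \<in> cvec (Suc d)" "b \<in> cvec (Suc d)" by (auto simp: ab numer_cvec denom_cvec)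
  have "(\<lambda>k. - a k) = (\<lambda>k. - (cnj s * antipodal_coeffs d b k))"
    using antipodal_mult[of d "- s" b] antipodal_antipodal[OF d cv(1)] 2 by (simp add: ab)
  also have "\<dots> = (\<lambda>k. - (cnj s * s * a k))" using 1 by (simp add: ab mult.assoc)
  finally have ea: "(\<lambda>k. - a k) = (\<lambda>k. - (cnj s * s * a k))" .
  have sa: "a k = cnj s * s * a k" for k using fun_cong[OF ea, of k] by simp
  have "(\<lambda>k. - b k) = (\<lambda>k. cnj s * antipodal_coeffs d a k)"
    using antipodal_mult[of d s a] antipodal_antipodal[OF d cv(2)] 1 by (simp add: ab)
  also have "\<dots> = (\<lambda>k. - (cnj s * s * b k))" using 2 by (simp add: ab mult.assoc)
  finally have eb: "(\<lambda>k. - b k) = (\<lambda>k. - (cnj s * s * b k))" .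
  have sb: "b k = cnj s * s * b k" for k using fun_cong[OF eb, of k] by simp
  have "\<exists>k. a k \<noteq> 0 \<or> b k \<noteq> 0"
  proof (rule ccontr)
    assume "\<not> ?thesis"
    then have "a = (\<lambda>_. 0)" "b = (\<lambda>_. 0)" by auto
    then have "c = join_coeffs d (\<lambda>_. 0) (\<lambda>_. 0)"
      using join_numer_denom[OF c(1)] by (simp add: ab)
    then have "c = (\<lambda>_. 0)" by (auto simp: join_coeffs_def)
    then show False using c(2) by simp
  qed
  then obtain k where "a k \<noteq> 0 \<or> b k \<noteq> 0" by blast
  then have "cnj s * s = 1" using sa[of k] sb[of k] by auto
  then have "complex_of_real ((cmod s) ^ 2) = 1" using complex_norm_square[of s] by (metis mult.commute)
  then have s1: "cmod s ^ 2 = 1" using of_real_eq_1_iff by blast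
  then have s1': "cmod s = 1" using norm_ge_zero[of s] by (auto simp: power2_eq_1_iff simp del: norm_ge_zero) 
  define r where "r = csqrt (- s)"
  have r2: "r ^ 2 = - s" by (simp add: r_def)
  have "cmod r ^ 2 = 1" using arg_cong[OF r2, of cmod] s1' by (simp add: norm_power)
  then have r1: "cmod r = 1" using norm_ge_zero[of r] by (auto simp: power2_eq_1_iff simp del: norm_ge_zero) 
  then have rr: "r * cnj r = 1" using complex_norm_square[of r] by simp
  have r: "r = - (cnj r * s)"
  proof -
    have "- (cnj r * s) = cnj r * r ^ 2" by (simp add: r2)
    also have "\<dots> = (r * cnj r) * r" by (simp add: power2_eq_square mult_ac)
    finally show ?thesis using rr by simp
  qed
  have rc: "(\<lambda>i. r * c i) \<in> cvec (2 * d + 2)" using c by (simp add: cvec_mult)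
  have "antipodal_coeffs d (\<lambda>k. r * a k) = (\<lambda>k. - (cnj r * s) * b k)"
    using 2 by (simp add: antipodal_mult ab mult.assoc)
  then have "antipodal_coeffs d (\<lambda>k. r * a k) = (\<lambda>k. r * b k)" using r by simp
  then have "anti_join d (\<lambda>k. r * a k) = join_coeffs d (numer d (\<lambda>i. r * c i)) (denom d (\<lambda>i. r * c i))"
    by (simp add: anti_join_def numer_mult denom_mult ab)
  then show thesis using that[OF r1] join_numer_denom[OF rc] by (simp add: ab)
qed

text \<open>The coefficients of the map conjugated by the antipodal map.\<close>

definition antipode :: "nat \<Rightarrow> (nat \<Rightarrow> complex) \<Rightarrow> nat \<Rightarrow> complex" where
  "antipode d c = join_coeffs d (antipodal_coeffs d (denom d c)) (\<lambda>k. - antipodal_coeffs d (numer d c) k)"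

lemma numer_antipode: "numer d (antipode d c) = antipodal_coeffs d (denom d c)"
  by (simp add: antipode_def numer_join antipodal_cvec)
lemma denom_antipode: "denom d (antipode d c) = (\<lambda>k. - antipodal_coeffs d (numer d c) k)"
proof -
  have "(\<lambda>k. - antipodal_coeffs d (numer d c) k) \<in> cvec (Suc d)"
    using antipodal_cvec by (auto simp: cvec_def)
  then show ?thesis by (simp add: antipode_def denom_join)
qed

lemma antipode_cvec: "antipode d c \<in> cvec (2 * d + 2)"
  unfolding antipode_def by (rule join_cvec)

lemma form_neg: "form d (\<lambda>k. - a k) x y = - form d a x y"
  using form_cmult[of d "-1" a x y] by simp

lemma tau1_tau1: "tau1 (tau1 w) = w"
  by (cases w) auto

lemma rat_eval_antipode:
  assumes "odd d" "nondeg d c"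
  shows "rat_eval d (antipode d c) = tau1 \<circ> rat_eval d c \<circ> tau1"
proof (rule sphere_fun_eqI)
  fix x y :: complex assume xy: "(x, y) \<noteq> (0, 0)"
  then have xy': "(- cnj y, cnj x) \<noteq> (0, 0)" by auto
  show "rat_eval d (antipode d c) (pt x y) = (tau1 \<circ> rat_eval d c \<circ> tau1) (pt x y)"
    using xy xy' assms nondegD[OF assms(2) xy']
    by (simp add: rat_eval_pt tau1_pt numer_antipode denom_antipode form_antipodal form_neg)
qed

lemma nondeg_antipode:
  assumes "odd d" "nondeg d c" shows "nondeg d (antipode d c)"
proof (rule nondegI)
  fix x y :: complex
  assume xy: "(x, y) \<noteq> (0, 0)" and "form d (numer d (antipode d c)) x y = 0" "form d (denom d (antipode d c)) x y = 0"
  then show False using nondegD[OF assms(2), of "- cnj y" "cnj x"] assms(1)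
    by (auto simp: numer_antipode denom_antipode form_antipodal form_neg)
qed

lemma antipode_anti_join: "odd d \<Longrightarrow> a \<in> cvec (Suc d) \<Longrightarrow> antipode d (anti_join d a) = (\<lambda>i. - 1 * anti_join d a i)"
  unfolding antipode_def numer_anti denom_anti antipodal_antipodal
  by (simp add: anti_join_def join_coeffs_def fun_eq_iff)

text \<open>Commuting with the antipodal map means being equal to its own conjugate by it. The pair of
  forms is then proportional to its image under the antilinear involution, and up to a phase it is
  an antipodal pair.\<close>

lemma B1_eq: 
  assumes d: "odd d" shows "B1 d = (\<lambda>a. proj_class (anti_join d a)) ` nonZ d"
proof (rule Set.set_eqI)
  have d1: "d \<ge> 1" using d by (cases d) auto
  have comm: "f \<circ> tau1 = tau1 \<circ> f \<longleftrightarrow> tau1 \<circ> f \<circ> tau1 = f" for f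
  proof -
    have "tau1 \<circ> tau1 = id" by (simp add: fun_eq_iff tau1_tau1)
    then show ?thesis by (metis comp_assoc comp_id id_comp)
  qed
  fix \<phi>
  show "\<phi> \<in> B1 d \<longleftrightarrow> \<phi> \<in> (\<lambda>a. proj_class (anti_join d a)) ` nonZ d"
  proof
    assume "\<phi> \<in> B1 d"
    then obtain c where c: "c \<in> nondeg_vecs d" "\<phi> = proj_class c" 
      and cm: "rat_map d \<phi> \<circ> tau1 = tau1 \<circ> rat_map d \<phi>"
      unfolding B1_def Rat_eq[OF d1] by auto
    have nd: "nondeg d c" "c \<in> cvec (2 * d + 2)" using c by (auto simp: nondeg_vecs_def)
    have "rat_eval d (antipode d c) = rat_eval d c"
      using cm c(2) comm rat_eval_antipode[OF d nd(1)] by (simp add: rat_map_proj)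
    then have "proj_class c = proj_class (antipode d c)"
      using rat_eval_inject[OF d1 c(1), of "antipode d c"] nondeg_antipode[OF d nd(1)] antipode_cvec
      by (simp add: nondeg_vecs_def)
    then obtain s where s: "s \<noteq> 0" "antipode d c = (\<lambda>i. s * c i)" using proj_class_eq_iff by blast
    have 1: "antipodal_coeffs d (denom d c) = (\<lambda>k. s * numer d c k)"
      using arg_cong[OF s(2), of "numer d"] by (simp add: numer_antipode numer_mult)
    have h: "(\<lambda>k. - antipodal_coeffs d (numer d c) k) = (\<lambda>k. s * denom d c k)"
      using arg_cong[OF s(2), of "denom d"] by (simp add: denom_antipode denom_mult)
    have 2: "antipodal_coeffs d (numer d c) = (\<lambda>k. - (s * denom d c k))"
    proof
      fix k show "antipodal_coeffs d (numer d c) k = - (s * denom d c k)"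
        using fun_cong[OF h, of k] by (metis minus_minus)
    qed
    obtain r where r: "cmod r = 1" "(\<lambda>i. r * c i) = anti_join d (\<lambda>k. r * numer d c k)"
      using antipodal_phase[OF d nd(2) nondeg_nonzero[OF nd(1)] 1 2] .
    have r0: "r \<noteq> 0" using r(1) by auto
    have "(\<lambda>k. r * numer d c k) \<in> nonZ d"
      unfolding nonZ_iff[OF d1] r(2)[symmetric] using nd r0 by (simp add: nondeg_mult cvec_mult numer_cvec)
    moreover have "\<phi> = proj_class (anti_join d (\<lambda>k. r * numer d c k))"
      using c(2) r0 by (simp add: r(2)[symmetric] proj_class_mult)
    ultimately show "\<phi> \<in> (\<lambda>a. proj_class (anti_join d a)) ` nonZ d" by blast
  next
    assume "\<phi> \<in> (\<lambda>a. proj_class (anti_join d a)) ` nonZ d"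
    then obtain a where a: "a \<in> nonZ d" "\<phi> = proj_class (anti_join d a)" by blast
    have "nondeg d (anti_join d a)" "a \<in> cvec (Suc d)" using a nonZ_iff[OF d1] by auto
    moreover have "rat_eval d (\<lambda>i. - 1 * anti_join d a i) = rat_eval d (anti_join d a)"
      by (rule rat_eval_mult) simp
    ultimately have "tau1 \<circ> rat_eval d (anti_join d a) \<circ> tau1 = rat_eval d (anti_join d a)"
      using rat_eval_antipode[OF d] antipode_anti_join[OF d] by metis
    then show "\<phi> \<in> B1 d"
      using a comm nonZ_anti[OF d1 a(1)] by (auto simp: B1_def Rat_eq[OF d1] rat_map_proj)
  qed
qed

lemma real_class_self: "a \<in> real_class a"
  unfolding real_class_def by (rule CollectI, rule exI[of _ 1]) simp

lemma Xi_real_class: "Xi d (real_class a) = proj_class (anti_join d a)"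
proof -
  have "(\<lambda>a. proj_class (join_coeffs d a (antipodal_coeffs d a))) ` real_class a = {proj_class (anti_join d a)}"
    using real_class_self[of a]
    by (auto simp: real_class_def anti_join_def[symmetric] anti_mult proj_class_mult)
  then show ?thesis by (simp add: Xi_def)
qed

lemma real_class_mult: assumes "r \<noteq> 0" shows "real_class (\<lambda>k. complex_of_real r * a k) = real_class a"
proof (rule Set.set_eqI, rule iffI)
  fix z assume "z \<in> real_class (\<lambda>k. complex_of_real r * a k)"
  then obtain t where "t \<noteq> 0" "z = (\<lambda>i. complex_of_real t * (complex_of_real r * a i))" by (auto simp: real_class_def)
  then show "z \<in> real_class a" using assms
    unfolding real_class_def by (intro CollectI exI[of _ "t * r"]) (auto simp: mult.assoc)
next
  fix z assume "z \<in> real_class a"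
  then obtain t where "t \<noteq> 0" "z = (\<lambda>i. complex_of_real t * a i)" by (auto simp: real_class_def)
  then show "z \<in> real_class (\<lambda>k. complex_of_real r * a k)" using assms
    unfolding real_class_def by (intro CollectI exI[of _ "t / r"]) (auto simp: mult.assoc)
qed

lemma topspace_param: "topspace (param_space d) = real_class ` nonZ d"
  unfolding param_space_def nonZ_def by (simp add: Int_absorb1)

lemma Xi_bij: assumes d: "odd d" shows "bij_betw (Xi d) (topspace (param_space d)) (B1 d)"
proof -
  have d1: "d \<ge> 1" using d by (cases d) auto
  have "inj_on (Xi d) (real_class ` nonZ d)"
  proof (rule inj_onI, clarsimp simp: Xi_real_class)
    fix a b assume ab: "a \<in> nonZ d" "b \<in> nonZ d" "proj_class (anti_join d a) = proj_class (anti_join d b)"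
    then obtain s where s: "s \<noteq> 0" "anti_join d b = (\<lambda>i. s * anti_join d a i)"
      using proj_class_eq_iff by blast
    obtain r where "s = complex_of_real r" "b = (\<lambda>k. complex_of_real r * a k)"
      using anti_inject[OF d1 nonZ_cvec[OF ab(1)] nonZ_cvec[OF ab(2)] nonZ_nonzero[OF d1 ab(1)] s(2)] .
    then show "real_class a = real_class b" using s(1) by (simp add: real_class_mult)
  qed
  then show ?thesis unfolding bij_betw_def topspace_param B1_eq[OF d]
    by (simp add: image_image Xi_real_class)
qed

section \<open>Conjugation as an action on coefficient vectors\<close>

text \<open>The coefficients of the form after a linear substitution of its variables.\<close>

definition subst_form :: "nat \<Rightarrow> complex \<Rightarrow> complex \<Rightarrow> complex \<Rightarrow> complex \<Rightarrow> (nat \<Rightarrow> complex) \<Rightarrow> nat \<Rightarrow> complex" where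
  "subst_form d \<alpha> \<beta> \<gamma> \<delta> a =
     coeff (\<Sum>k\<le>d. smult (a k) ([:\<beta>, \<alpha>:] ^ k * [:\<delta>, \<gamma>:] ^ (d - k)))"

lemma vec_poly_coeff: assumes "degree p \<le> n" shows "vec_poly n (coeff p) = p"
  by (rule poly_eqI) (use assms coeff_eq_0[of p] in \<open>auto simp: coeff_vec_poly\<close>)

lemma degree_lin_mult: assumes "degree p \<le> n" shows "degree ([:b, a:] * p) \<le> Suc n"
proof -
  have "degree ([:b, a:] * p) \<le> degree [:b, a:] + degree p" by (rule degree_mult_le)
  also have "degree [:b, a:] \<le> 1" by simp
  finally show ?thesis using assms by simp
qed

lemma form_lin_mult:
  fixes p :: "complex poly"
  assumes p: "degree p \<le> n"
  shows "form (Suc n) (coeff ([:b, a:] * p)) x y = (a * x + b * y) * form n (coeff p) x y"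
proof (cases "y = 0")
  case True
  have "coeff ([:b, a:] * p) (Suc n) = a * coeff p n"
    using coeff_eq_0[of p "Suc n"] p by (simp add: coeff_pCons)
  then show ?thesis unfolding True by (simp only: form_0) simp
next
  case False
  have "form (Suc n) (coeff ([:b, a:] * p)) x y = y ^ Suc n * poly ([:b, a:] * p) (x / y)"
    using form_poly[OF False, of "Suc n" "coeff ([:b, a:] * p)" x]
      vec_poly_coeff[OF degree_lin_mult[OF p, of b a]] by simp
  also have "\<dots> = (y * (b + x / y * a)) * (y ^ n * poly p (x / y))"
    by (simp add: algebra_simps)
  also have "y * (b + x / y * a) = a * x + b * y" using False by (simp add: field_simps)
  also have "y ^ n * poly p (x / y) = form n (coeff p) x y"
    using form_poly[OF False, of n "coeff p" x] vec_poly_coeff[OF p] by simp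
  finally show ?thesis .
qed

lemma degree_lin_power: "degree ([:b, a:] ^ k :: complex poly) \<le> k"
proof (induction k)
  case (Suc k) then show ?case unfolding power_Suc by (rule degree_lin_mult)
qed simp

lemma degree_lin_powers: "degree ([:\<beta>, \<alpha>:] ^ j * [:\<delta>, \<gamma>:] ^ m :: complex poly) \<le> j + m"
  using degree_mult_le[of "[:\<beta>, \<alpha>:] ^ j" "[:\<delta>, \<gamma>:] ^ m"] degree_lin_power[of \<beta> \<alpha> j] degree_lin_power[of \<delta> \<gamma> m]
  by linarith

lemma form_lin_powers:
  "form (j + m) (coeff ([:\<beta>, \<alpha>:] ^ j * [:\<delta>, \<gamma>:] ^ m)) x y = (\<alpha> * x + \<beta> * y) ^ j * (\<gamma> * x + \<delta> * y) ^ m"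
proof (induction j)
  case 0
  have "form m (coeff ([:\<delta>, \<gamma>:] ^ m)) x y = (\<gamma> * x + \<delta> * y) ^ m"
  proof (induction m)
    case 0 show ?case by (simp add: form_def)
  next
    case (Suc m)
    then show ?case
      using form_lin_mult[OF degree_lin_power, of m \<delta> \<gamma> \<delta> \<gamma> x y] by (simp only: power_Suc)
  qed
  then show ?case by simp
next
  case (Suc j)
  have "form (Suc (j + m)) (coeff ([:\<beta>, \<alpha>:] * ([:\<beta>, \<alpha>:] ^ j * [:\<delta>, \<gamma>:] ^ m))) x y
      = (\<alpha> * x + \<beta> * y) * ((\<alpha> * x + \<beta> * y) ^ j * (\<gamma> * x + \<delta> * y) ^ m)"
    using form_lin_mult[OF degree_lin_powers, of j m \<beta> \<alpha> \<beta> \<alpha> \<delta> \<gamma> x y] Suc by simp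
  then show ?case by (simp only: power_Suc mult.assoc add_Suc)
qed

lemma form_sum_poly: "form d (coeff (\<Sum>k\<in>K. smult (a k) (p k))) x y = (\<Sum>k\<in>K. a k * form d (coeff (p k)) x y)"
  unfolding form_def coeff_sum coeff_smult sum_distrib_left sum_distrib_right
  by (subst sum.swap) (simp add: mult_ac)

lemma form_subst: "form d (subst_form d \<alpha> \<beta> \<gamma> \<delta> a) x y = form d a (\<alpha> * x + \<beta> * y) (\<gamma> * x + \<delta> * y)"
proof -
  have "form d (subst_form d \<alpha> \<beta> \<gamma> \<delta> a) x y =
      (\<Sum>k\<le>d. a k * form d (coeff ([:\<beta>, \<alpha>:] ^ k * [:\<delta>, \<gamma>:] ^ (d - k))) x y)"
    unfolding subst_form_def by (rule form_sum_poly)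
  also have "\<dots> = (\<Sum>k\<le>d. a k * (\<alpha> * x + \<beta> * y) ^ k * (\<gamma> * x + \<delta> * y) ^ (d - k))"
  proof (rule sum.cong[OF refl])
    fix k assume "k \<in> {..d}"
    then show "a k * form d (coeff ([:\<beta>, \<alpha>:] ^ k * [:\<delta>, \<gamma>:] ^ (d - k))) x y =
       a k * (\<alpha> * x + \<beta> * y) ^ k * (\<gamma> * x + \<delta> * y) ^ (d - k)"
      using form_lin_powers[of k "d - k" \<beta> \<alpha> \<delta> \<gamma> x y] by simp
  qed
  finally show ?thesis by (simp only: form_def)
qed

lemma subst_form_cvec: "subst_form d \<alpha> \<beta> \<gamma> \<delta> a \<in> cvec (Suc d)"
  unfolding cvec_def
proof (intro CollectI allI impI)
  fix i assume i: "Suc d \<le> i"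
  have "coeff ([:\<beta>, \<alpha>:] ^ k * [:\<delta>, \<gamma>:] ^ (d - k)) i = 0" if "k \<le> d" for k
    using degree_lin_powers[of \<beta> \<alpha> k \<delta> \<gamma> "d - k"] that i by (intro coeff_eq_0) linarith
  then show "subst_form d \<alpha> \<beta> \<gamma> \<delta> a i = 0"
    by (simp add: subst_form_def coeff_sum)
qed

lemma tendsto_coeff_mult:
  fixes p q :: "'b \<Rightarrow> complex poly"
  assumes "\<And>i. ((\<lambda>n. coeff (p n) i) \<longlongrightarrow> coeff p' i) F" "\<And>i. ((\<lambda>n. coeff (q n) i) \<longlongrightarrow> coeff q' i) F"
  shows "((\<lambda>n. coeff (p n * q n) i) \<longlongrightarrow> coeff (p' * q') i) F"
  unfolding coeff_mult by (intro tendsto_intros assms)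

lemma tendsto_coeff_lin_power:
  fixes a b :: "'b \<Rightarrow> complex"
  assumes "(a \<longlongrightarrow> a') F" "(b \<longlongrightarrow> b') F"
  shows "((\<lambda>n. coeff ([:b n, a n:] ^ k) i) \<longlongrightarrow> coeff ([:b', a':] ^ k) i) F"
proof (induction k arbitrary: i)
  case (Suc k)
  have "((\<lambda>n. coeff [:b n, a n:] i) \<longlongrightarrow> coeff [:b', a':] i) F" for i
    using assms by (cases i) (auto simp: coeff_pCons split: nat.splits)
  from tendsto_coeff_mult[OF this Suc] show ?case by simp
qed simp

lemma tendsto_subst_form:
  assumes "(\<alpha> \<longlongrightarrow> \<alpha>') F" "(\<beta> \<longlongrightarrow> \<beta>') F" "(\<gamma> \<longlongrightarrow> \<gamma>') F" "(\<delta> \<longlongrightarrow> \<delta>') F"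
    "\<And>k. ((\<lambda>n. a n k) \<longlongrightarrow> a' k) F"
  shows "((\<lambda>n. subst_form d (\<alpha> n) (\<beta> n) (\<gamma> n) (\<delta> n) (a n) i) \<longlongrightarrow> subst_form d \<alpha>' \<beta>' \<gamma>' \<delta>' a' i) F"
  unfolding subst_form_def coeff_sum coeff_smult
  by (intro tendsto_sum tendsto_mult assms tendsto_coeff_mult tendsto_coeff_lin_power)

text \<open>Conjugation by the matrix with rows \<open>(\<alpha>, \<beta>)\<close> and \<open>(\<gamma>, \<delta>)\<close>: the inverse matrix, for determinant
  1, is substituted into the two forms, and the matrix is applied to the resulting pair.\<close>

definition act :: "nat \<Rightarrow> complex \<Rightarrow> complex \<Rightarrow> complex \<Rightarrow> complex \<Rightarrow> (nat \<Rightarrow> complex) \<Rightarrow> nat \<Rightarrow> complex" where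
  "act d \<alpha> \<beta> \<gamma> \<delta> c =
    (let p = subst_form d \<delta> (- \<beta>) (- \<gamma>) \<alpha> (numer d c); q = subst_form d \<delta> (- \<beta>) (- \<gamma>) \<alpha> (denom d c)
     in join_coeffs d (\<lambda>k. \<alpha> * p k + \<beta> * q k) (\<lambda>k. \<gamma> * p k + \<delta> * q k))"

lemma cvec_lincomb: "p \<in> cvec n \<Longrightarrow> q \<in> cvec n \<Longrightarrow> (\<lambda>k. \<alpha> * p k + \<beta> * q k) \<in> cvec n"
  by (auto simp: cvec_def)

lemma numer_act: "form d (numer d (act d \<alpha> \<beta> \<gamma> \<delta> c)) x y =
    \<alpha> * form d (numer d c) (\<delta> * x - \<beta> * y) (\<alpha> * y - \<gamma> * x) +
    \<beta> * form d (denom d c) (\<delta> * x - \<beta> * y) (\<alpha> * y - \<gamma> * x)"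
  and denom_act: "form d (denom d (act d \<alpha> \<beta> \<gamma> \<delta> c)) x y =
    \<gamma> * form d (numer d c) (\<delta> * x - \<beta> * y) (\<alpha> * y - \<gamma> * x) +
    \<delta> * form d (denom d c) (\<delta> * x - \<beta> * y) (\<alpha> * y - \<gamma> * x)"
proof -
  have e: "\<delta> * x + - \<beta> * y = \<delta> * x - \<beta> * y" "- \<gamma> * x + \<alpha> * y = \<alpha> * y - \<gamma> * x" by simp_all
  show "form d (numer d (act d \<alpha> \<beta> \<gamma> \<delta> c)) x y =
    \<alpha> * form d (numer d c) (\<delta> * x - \<beta> * y) (\<alpha> * y - \<gamma> * x) +
    \<beta> * form d (denom d c) (\<delta> * x - \<beta> * y) (\<alpha> * y - \<gamma> * x)"
    unfolding act_def Let_def numer_join[OF cvec_lincomb[OF subst_form_cvec subst_form_cvec]]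
      form_add form_cmult form_subst e ..
  show "form d (denom d (act d \<alpha> \<beta> \<gamma> \<delta> c)) x y =
    \<gamma> * form d (numer d c) (\<delta> * x - \<beta> * y) (\<alpha> * y - \<gamma> * x) +
    \<delta> * form d (denom d c) (\<delta> * x - \<beta> * y) (\<alpha> * y - \<gamma> * x)"
    unfolding act_def Let_def denom_join[OF cvec_lincomb[OF subst_form_cvec subst_form_cvec]]
      form_add form_cmult form_subst e ..
qed

lemma act_cvec: "act d \<alpha> \<beta> \<gamma> \<delta> c \<in> cvec (2 * d + 2)"
  unfolding act_def Let_def by (rule join_cvec)

lemma act_mult: "act d \<alpha> \<beta> \<gamma> \<delta> (\<lambda>i. s * c i) = (\<lambda>i. s * act d \<alpha> \<beta> \<gamma> \<delta> c i)"
  by (rule cvec_ext[OF act_cvec cvec_mult[OF act_cvec]])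
     (simp_all add: numer_mult denom_mult form_cmult numer_act denom_act algebra_simps)

lemma act_cong: "\<alpha> = \<alpha>' \<Longrightarrow> \<beta> = \<beta>' \<Longrightarrow> \<gamma> = \<gamma>' \<Longrightarrow> \<delta> = \<delta>' \<Longrightarrow> act d \<alpha> \<beta> \<gamma> \<delta> c = act d \<alpha>' \<beta>' \<gamma>' \<delta>' c"
  by simp

lemma act_act: "act d \<alpha> \<beta> \<gamma> \<delta> (act d a b g e c) =
   act d (\<alpha> * a + \<beta> * g) (\<alpha> * b + \<beta> * e) (\<gamma> * a + \<delta> * g) (\<gamma> * b + \<delta> * e) c"
proof (rule cvec_ext[OF act_cvec act_cvec])
  fix x y
  have e: "e * (\<delta> * x - \<beta> * y) - b * (\<alpha> * y - \<gamma> * x) = (\<gamma> * b + \<delta> * e) * x - (\<alpha> * b + \<beta> * e) * y"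
    "a * (\<alpha> * y - \<gamma> * x) - g * (\<delta> * x - \<beta> * y) = (\<alpha> * a + \<beta> * g) * y - (\<gamma> * a + \<delta> * g) * x"
    by (simp_all add: algebra_simps)
  show "form d (numer d (act d \<alpha> \<beta> \<gamma> \<delta> (act d a b g e c))) x y =
    form d (numer d (act d (\<alpha> * a + \<beta> * g) (\<alpha> * b + \<beta> * e) (\<gamma> * a + \<delta> * g) (\<gamma> * b + \<delta> * e) c)) x y"
    unfolding numer_act denom_act e by (simp add: algebra_simps)
  show "form d (denom d (act d \<alpha> \<beta> \<gamma> \<delta> (act d a b g e c))) x y =
    form d (denom d (act d (\<alpha> * a + \<beta> * g) (\<alpha> * b + \<beta> * e) (\<gamma> * a + \<delta> * g) (\<gamma> * b + \<delta> * e) c)) x y"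
    unfolding numer_act denom_act e by (simp add: algebra_simps)
qed

lemma act_id: "c \<in> cvec (2 * d + 2) \<Longrightarrow> act d 1 0 0 1 c = c"
  by (rule cvec_ext[OF act_cvec]) (simp_all add: numer_act denom_act)

lemma act_inverse:
  assumes "\<alpha> * \<delta> - \<beta> * \<gamma> = 1" "c \<in> cvec (2 * d + 2)"
  shows "act d \<delta> (- \<beta>) (- \<gamma>) \<alpha> (act d \<alpha> \<beta> \<gamma> \<delta> c) = c"
proof -
  have "\<delta> * \<alpha> + - \<beta> * \<gamma> = 1" "\<delta> * \<beta> + - \<beta> * \<delta> = 0" "- \<gamma> * \<alpha> + \<alpha> * \<gamma> = 0" "- \<gamma> * \<beta> + \<alpha> * \<delta> = 1"
    using assms(1) by (simp_all add: algebra_simps)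
  then show ?thesis unfolding act_act by (simp only: act_id[OF assms(2)])
qed

lemma nondeg_act:
  assumes det: "\<alpha> * \<delta> - \<beta> * \<gamma> = 1" and c: "nondeg d c"
  shows "nondeg d (act d \<alpha> \<beta> \<gamma> \<delta> c)"
proof (rule nondegI)
  fix x y :: complex
  assume xy: "(x, y) \<noteq> (0, 0)" and 0: "form d (numer d (act d \<alpha> \<beta> \<gamma> \<delta> c)) x y = 0"
    "form d (denom d (act d \<alpha> \<beta> \<gamma> \<delta> c)) x y = 0"
  have "\<delta> * \<alpha> - (- \<beta>) * (- \<gamma>) \<noteq> 0" using det by (simp add: mult.commute)
  from lin_nonzero[OF this xy]
  have uv: "(\<delta> * x - \<beta> * y, \<alpha> * y - \<gamma> * x) \<noteq> (0, 0)" by simp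
  have "\<alpha> * \<delta> - \<beta> * \<gamma> \<noteq> 0" using det by simp
  from lin_nonzero[OF this nondegD[OF c uv]] show False
    using 0 unfolding numer_act denom_act by simp
qed

lemma nondeg_vecs_act: "\<alpha> * \<delta> - \<beta> * \<gamma> = 1 \<Longrightarrow> c \<in> nondeg_vecs d \<Longrightarrow> act d \<alpha> \<beta> \<gamma> \<delta> c \<in> nondeg_vecs d"
  unfolding nondeg_vecs_def using nondeg_act act_cvec by blast

lemma rat_eval_act:
  assumes det: "\<alpha> * \<delta> - \<beta> * \<gamma> = 1" and c: "nondeg d c"
  shows "rat_eval d (act d \<alpha> \<beta> \<gamma> \<delta> c) =
     moebius \<alpha> \<beta> \<gamma> \<delta> \<circ> rat_eval d c \<circ> moebius \<delta> (- \<beta>) (- \<gamma>) \<alpha>"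
proof (rule sphere_fun_eqI)
  fix x y :: complex assume xy: "(x, y) \<noteq> (0, 0)"
  have det': "\<delta> * \<alpha> - (- \<beta>) * (- \<gamma>) \<noteq> 0" using det by (simp add: mult.commute)
  from lin_nonzero[OF this xy]
  have uv: "(\<delta> * x - \<beta> * y, \<alpha> * y - \<gamma> * x) \<noteq> (0, 0)" by simp
  have m: "moebius \<delta> (- \<beta>) (- \<gamma>) \<alpha> (pt x y) = pt (\<delta> * x - \<beta> * y) (\<alpha> * y - \<gamma> * x)"
    using moebius_pt[OF det' xy] by simp
  have det0: "\<alpha> * \<delta> - \<beta> * \<gamma> \<noteq> 0" using det by simp
  show "rat_eval d (act d \<alpha> \<beta> \<gamma> \<delta> c) (pt x y) =
     (moebius \<alpha> \<beta> \<gamma> \<delta> \<circ> rat_eval d c \<circ> moebius \<delta> (- \<beta>) (- \<gamma>) \<alpha>) (pt x y)"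
    unfolding comp_apply m rat_eval_pt[OF uv] rat_eval_pt[OF xy] moebius_pt[OF det0 nondegD[OF c uv]]
      numer_act denom_act ..
qed

lemma moebius_inv:
  assumes det: "\<alpha> * \<delta> - \<beta> * \<gamma> = 1"
  shows "inv_into UNIV (moebius \<alpha> \<beta> \<gamma> \<delta>) = moebius \<delta> (- \<beta>) (- \<gamma>) \<alpha>"
proof (rule inv_equality)
  have d1: "\<alpha> * \<delta> - \<beta> * \<gamma> \<noteq> 0" and d2: "\<delta> * \<alpha> - (- \<beta>) * (- \<gamma>) \<noteq> 0"
    using det by (simp_all add: mult.commute)
  have s: "(\<alpha> * \<delta> - \<beta> * \<gamma>) * z = z" for z using det by simp
  fix w
  obtain x y where w: "(x, y) \<noteq> (0, 0)" "w = pt x y" by (rule pt_surj)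
  have "\<delta> * (\<alpha> * x + \<beta> * y) + (- \<beta>) * (\<gamma> * x + \<delta> * y) = (\<alpha> * \<delta> - \<beta> * \<gamma>) * x"
    "- \<gamma> * (\<alpha> * x + \<beta> * y) + \<alpha> * (\<gamma> * x + \<delta> * y) = (\<alpha> * \<delta> - \<beta> * \<gamma>) * y"
    by (simp_all add: algebra_simps)
  then show "moebius \<delta> (- \<beta>) (- \<gamma>) \<alpha> (moebius \<alpha> \<beta> \<gamma> \<delta> w) = w"
    unfolding w(2) moebius_pt[OF d1 w(1)] moebius_pt[OF d2 lin_nonzero[OF d1 w(1)]] by (simp only: s)
  have "\<alpha> * (\<delta> * x + - \<beta> * y) + \<beta> * (- \<gamma> * x + \<alpha> * y) = (\<alpha> * \<delta> - \<beta> * \<gamma>) * x"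
    "\<gamma> * (\<delta> * x + - \<beta> * y) + \<delta> * (- \<gamma> * x + \<alpha> * y) = (\<alpha> * \<delta> - \<beta> * \<gamma>) * y"
    by (simp_all add: algebra_simps)
  then show "moebius \<alpha> \<beta> \<gamma> \<delta> (moebius \<delta> (- \<beta>) (- \<gamma>) \<alpha> w) = w"
    unfolding w(2) moebius_pt[OF d2 w(1)] moebius_pt[OF d1 lin_nonzero[OF d2 w(1)]] by (simp only: s)
qed

text \<open>This trades the composition of sphere maps for matrices acting on coefficient vectors, on which
  continuity and compactness arguments are possible.\<close>

lemma conj_class_eq:
  assumes d: "d \<ge> 1" and c: "c \<in> nondeg_vecs d"
  shows "conj_class d (proj_class c) =
    {proj_class (act d \<alpha> \<beta> \<gamma> \<delta> c) |\<alpha> \<beta> \<gamma> \<delta>. \<alpha> * \<delta> - \<beta> * \<gamma> = 1}" (is "?L = ?R")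
proof (rule Set.set_eqI, rule iffI)
  have nd: "nondeg d c" using c by (simp add: nondeg_vecs_def)
  fix \<psi>
  {
    assume "\<psi> \<in> ?L"
    then obtain \<mu> c' where c': "c' \<in> nondeg_vecs d" "\<psi> = proj_class c'" and \<mu>: "\<mu> \<in> PSL2"
      and e: "rat_map d \<psi> = \<mu> \<circ> rat_map d (proj_class c) \<circ> inv_into UNIV \<mu>"
      unfolding conj_class_def Rat_eq[OF d] by blast
    from \<mu> obtain \<alpha> \<beta> \<gamma> \<delta> where m: "\<mu> = moebius \<alpha> \<beta> \<gamma> \<delta>" and det: "\<alpha> * \<delta> - \<beta> * \<gamma> = 1"
      unfolding PSL2_def by blast
    have "rat_eval d c' = rat_eval d (act d \<alpha> \<beta> \<gamma> \<delta> c)"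
      using e unfolding c'(2) rat_map_proj m moebius_inv[OF det] rat_eval_act[OF det nd] .
    then have "\<psi> = proj_class (act d \<alpha> \<beta> \<gamma> \<delta> c)"
      unfolding c'(2) by (intro rat_eval_inject[OF d c'(1)] nondeg_vecs_act[OF det c])
    then show "\<psi> \<in> ?R" using det by blast
  next
    assume "\<psi> \<in> ?R"
    then obtain \<alpha> \<beta> \<gamma> \<delta> where p: "\<psi> = proj_class (act d \<alpha> \<beta> \<gamma> \<delta> c)" and det: "\<alpha> * \<delta> - \<beta> * \<gamma> = 1" by blast
    have "moebius \<alpha> \<beta> \<gamma> \<delta> \<in> PSL2" unfolding PSL2_def using det by blast
    moreover have "rat_map d \<psi> = moebius \<alpha> \<beta> \<gamma> \<delta> \<circ> rat_map d (proj_class c) \<circ> inv_into UNIV (moebius \<alpha> \<beta> \<gamma> \<delta>)"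
      unfolding p rat_map_proj moebius_inv[OF det] rat_eval_act[OF det nd] ..
    moreover have "\<psi> \<in> Rat d" unfolding Rat_eq[OF d] p using nondeg_vecs_act[OF det c] by blast
    ultimately show "\<psi> \<in> ?L" unfolding conj_class_def by blast
  }
qed

definition mclass :: "nat \<Rightarrow> (nat \<Rightarrow> complex) \<Rightarrow> (nat \<Rightarrow> complex) set set" where
  "mclass d c = conj_class d (proj_class c)"

lemma det_mult:
  fixes \<alpha> :: complex
  assumes "\<alpha> * \<delta> - \<beta> * \<gamma> = 1" "a * e - b * g = 1"
  shows "(\<alpha> * a + \<beta> * g) * (\<gamma> * b + \<delta> * e) - (\<alpha> * b + \<beta> * e) * (\<gamma> * a + \<delta> * g) = 1"
proof -
  have "(\<alpha> * a + \<beta> * g) * (\<gamma> * b + \<delta> * e) - (\<alpha> * b + \<beta> * e) * (\<gamma> * a + \<delta> * g) =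
    (\<alpha> * \<delta> - \<beta> * \<gamma>) * (a * e - b * g)" by (simp add: algebra_simps)
  then show ?thesis by (simp only: assms mult_1)
qed

lemma mclass_act:
  assumes d: "d \<ge> 1" and c: "c \<in> nondeg_vecs d" and det: "\<alpha> * \<delta> - \<beta> * \<gamma> = 1"
  shows "mclass d (act d \<alpha> \<beta> \<gamma> \<delta> c) = mclass d c"
proof -
  have cv: "c \<in> cvec (2 * d + 2)" using c by (simp add: nondeg_vecs_def)
  have sub: "mclass d (act d \<alpha> \<beta> \<gamma> \<delta> c) \<subseteq> mclass d c"
    if det: "\<alpha> * \<delta> - \<beta> * \<gamma> = 1" and c: "c \<in> nondeg_vecs d" for \<alpha> \<beta> \<gamma> \<delta> c
    unfolding mclass_def conj_class_eq[OF d c] conj_class_eq[OF d nondeg_vecs_act[OF det c]] act_act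
    using det_mult[OF _ det] by blast
  have "mclass d c = mclass d (act d \<delta> (- \<beta>) (- \<gamma>) \<alpha> (act d \<alpha> \<beta> \<gamma> \<delta> c))"
    unfolding act_inverse[OF det cv] ..
  also have "\<dots> \<subseteq> mclass d (act d \<alpha> \<beta> \<gamma> \<delta> c)"
    using det by (intro sub nondeg_vecs_act[OF det c]) (simp add: mult.commute)
  finally show ?thesis using sub[OF det c] by blast
qed

lemma mclass_mult: "s \<noteq> 0 \<Longrightarrow> mclass d (\<lambda>i. s * c i) = mclass d c"
  by (simp add: mclass_def proj_class_mult)

lemma mclass_eqD:
  assumes d: "d \<ge> 1" and c: "c \<in> nondeg_vecs d" "c' \<in> nondeg_vecs d" "mclass d c = mclass d c'"
  obtains \<alpha> \<beta> \<gamma> \<delta> s where "\<alpha> * \<delta> - \<beta> * \<gamma> = 1" "s \<noteq> 0" "act d \<alpha> \<beta> \<gamma> \<delta> c = (\<lambda>i. s * c' i)"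
proof -
  have "c' \<in> cvec (2 * d + 2)" using c by (simp add: nondeg_vecs_def)
  then have "proj_class c' = proj_class (act d 1 0 0 1 c')" by (simp only: act_id)
  moreover have "(1::complex) * 1 - 0 * 0 = 1" by simp
  ultimately have "proj_class c' \<in> mclass d c'" unfolding mclass_def conj_class_eq[OF d c(2)] by blast
  then have "proj_class c' \<in> mclass d c" unfolding c(3) .
  then obtain \<alpha> \<beta> \<gamma> \<delta> where det: "\<alpha> * \<delta> - \<beta> * \<gamma> = 1" and p: "proj_class c' = proj_class (act d \<alpha> \<beta> \<gamma> \<delta> c)"
    unfolding mclass_def conj_class_eq[OF d c(1)] by blast
  obtain s where "s \<noteq> 0" "act d \<alpha> \<beta> \<gamma> \<delta> c = (\<lambda>i. s * c' i)" using p proj_class_eq_iff by blast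
  then show thesis using that det by blast
qed

lemma tendsto_act:
  assumes "(\<alpha> \<longlongrightarrow> \<alpha>') F" "(\<beta> \<longlongrightarrow> \<beta>') F" "(\<gamma> \<longlongrightarrow> \<gamma>') F" "(\<delta> \<longlongrightarrow> \<delta>') F"
    "\<And>k. ((\<lambda>n. c n k) \<longlongrightarrow> c' k) F"
  shows "((\<lambda>n. act d (\<alpha> n) (\<beta> n) (\<gamma> n) (\<delta> n) (c n) i) \<longlongrightarrow> act d \<alpha>' \<beta>' \<gamma>' \<delta>' c' i) F"
proof -
  have "((\<lambda>n. numer d (c n) k) \<longlongrightarrow> numer d c' k) F" "((\<lambda>n. denom d (c n) k) \<longlongrightarrow> denom d c' k) F" for k
    using assms(5) by (auto simp: numer_def denom_def)
  note s = tendsto_subst_form[OF assms(4) tendsto_minus[OF assms(2)] tendsto_minus[OF assms(3)] assms(1)]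
  note s1 = s[of "\<lambda>n. numer d (c n)" "numer d c'", OF \<open>\<And>k. ((\<lambda>n. numer d (c n) k) \<longlongrightarrow> numer d c' k) F\<close>]
  note s2 = s[of "\<lambda>n. denom d (c n)" "denom d c'", OF \<open>\<And>k. ((\<lambda>n. denom d (c n) k) \<longlongrightarrow> denom d c' k) F\<close>]
  show ?thesis
    unfolding act_def Let_def join_coeffs_def
    by (cases "i \<le> d"; cases "i \<le> 2 * d + 1") (auto intro!: tendsto_intros assms s1 s2)
qed

section \<open>The Cartan decomposition of a conjugation\<close>

definition unit2 :: "complex \<Rightarrow> complex \<Rightarrow> bool" where
  "unit2 \<alpha> \<beta> \<longleftrightarrow> \<alpha> * cnj \<alpha> + \<beta> * cnj \<beta> = 1"

text \<open>If \<open>(\<alpha>, \<beta>)\<close> is a unit vector, then this matrix is unitary of determinant 1, and every element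
  of \<open>SU(2)\<close> has this form.\<close>

definition su :: "nat \<Rightarrow> complex \<Rightarrow> complex \<Rightarrow> (nat \<Rightarrow> complex) \<Rightarrow> nat \<Rightarrow> complex" where
  "su d \<alpha> \<beta> = act d \<alpha> \<beta> (- cnj \<beta>) (cnj \<alpha>)"

lemma unit2_det: "unit2 \<alpha> \<beta> \<Longrightarrow> \<alpha> * cnj \<alpha> - \<beta> * (- cnj \<beta>) = 1"
  by (simp add: unit2_def)

text \<open>Elements of \<open>SU(2)\<close> commute with the antipodal map, so conjugating by them preserves antipodal
  pairs, even as vectors and not only up to a phase.\<close>

lemma su_anti_join:
  assumes d: "odd d" and a: "a \<in> cvec (Suc d)"
  shows "su d \<alpha> \<beta> (anti_join d a) = anti_join d (numer d (su d \<alpha> \<beta> (anti_join d a)))"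
proof (rule cvec_ext)
  let ?c = "su d \<alpha> \<beta> (anti_join d a)"
  show "?c \<in> cvec (2 * d + 2)" unfolding su_def by (rule act_cvec)
  show "anti_join d (numer d ?c) \<in> cvec (2 * d + 2)" by (rule anti_cvec)
  fix x y
  show "form d (numer d ?c) x y = form d (numer d (anti_join d (numer d ?c))) x y"
    by (simp only: numer_anti[OF numer_cvec])
  define X Y where XY: "X = cnj \<alpha> * x - \<beta> * y" "Y = \<alpha> * y + cnj \<beta> * x"
  define F where "F = form d a"
  have neg: "F (- X) (- Y) = - F X Y"
    using form_scale[of d a "-1" X Y] d by (simp add: F_def)
  have A: "form d (denom d ?c) x y = - cnj \<beta> * F X Y - cnj \<alpha> * cnj (F (- cnj Y) (cnj X))"
    unfolding su_def denom_act numer_anti[OF a] denom_anti form_antipodal[OF d] F_def[symmetric] XY by simp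
  have B: "form d (denom d (anti_join d (numer d ?c))) x y =
     - cnj (\<alpha> * F (- cnj Y) (cnj X) + \<beta> * (- cnj (F (- X) (- Y))))"
  proof -
    have e: "cnj \<alpha> * (- cnj y) - \<beta> * cnj x = - cnj Y" "\<alpha> * cnj x - - cnj \<beta> * - cnj y = cnj X"
      "- cnj (cnj X) = - X" "cnj (- cnj Y) = - Y"
      by (simp_all add: XY algebra_simps)
    show ?thesis
      unfolding denom_anti form_antipodal[OF d] su_def numer_act numer_anti[OF a] F_def[symmetric] e ..
  qed
  show "form d (denom d ?c) x y = form d (denom d (anti_join d (numer d ?c))) x y"
    unfolding A B neg by simp
qed

text \<open>Supplies the singular vector of the decomposition below.\<close>

lemma quadratic_zero:
  fixes A B C :: complex
  obtains p q where "(p, q) \<noteq> (0, 0)" "A * p ^ 2 + B * p * q + C * q ^ 2 = 0"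
proof -
  define a :: "nat \<Rightarrow> complex" where "a = (\<lambda>k. if k = 0 then C else if k = 1 then B else A)"
  obtain p q where "(p, q) \<noteq> (0, 0)" "form 2 a p q = 0" using form_zero_exists[of 2 a] by auto
  moreover have "form 2 a p q = A * p ^ 2 + B * p * q + C * q ^ 2"
    by (simp add: form_def a_def numeral_2_eq_2)
  ultimately show thesis using that by simp
qed

lemma unit2_normalize:
  assumes "(p, q) \<noteq> (0, 0)"
  obtains r where "r > 0" "p * cnj p + q * cnj q = complex_of_real (r ^ 2)"
    "unit2 (p / complex_of_real r) (q / complex_of_real r)"
proof -
  define r where "r = sqrt (cmod p ^ 2 + cmod q ^ 2)"
  have pos: "cmod p ^ 2 + cmod q ^ 2 > 0"
    using assms by (auto simp: add_pos_nonneg add_nonneg_pos)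
  then have r: "r > 0" "r ^ 2 = cmod p ^ 2 + cmod q ^ 2" by (auto simp: r_def)
  have e: "p * cnj p + q * cnj q = complex_of_real (r ^ 2)"
    unfolding r(2) of_real_add complex_norm_square ..
  have "unit2 (p / complex_of_real r) (q / complex_of_real r)"
  proof -
    have "(p / complex_of_real r) * cnj (p / complex_of_real r) + (q / complex_of_real r) * cnj (q / complex_of_real r)
       = (p * cnj p + q * cnj q) / complex_of_real (r ^ 2)"
      by (simp add: power2_eq_square add_divide_distrib)
    then show ?thesis unfolding unit2_def e using r(1) by simp
  qed
  then show thesis using that r(1) e by blast
qed

text \<open>Every matrix of determinant 1 is a product of a unitary, a positive diagonal and a unitary
  matrix. The first unitary factor comes from a unit vector \<open>(p, q)\<close> such that the images of \<open>(p, q)\<close>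
  and of the vector \<open>(- cnj q, cnj p)\<close> orthogonal to it are again orthogonal. In the ratio of \<open>p\<close>
  and \<open>q\<close> this is a quadratic equation over the complex numbers, without conjugates.\<close>

lemma KAK:
  fixes \<alpha> \<beta> \<gamma> \<delta> :: complex
  assumes det: "\<alpha> * \<delta> - \<beta> * \<gamma> = 1"
  obtains p q u v t where "unit2 p q" "unit2 u v" "t > (0::real)"
    "\<And>c. act d \<alpha> \<beta> \<gamma> \<delta> c = su d u v (act d (complex_of_real t) 0 0 (complex_of_real (1 / t)) (su d p q c))"
proof -
  obtain p0 q0 where pq0: "(p0, q0) \<noteq> (0, 0)" and z0:
    "(\<alpha> * cnj \<beta> + \<gamma> * cnj \<delta>) * p0 ^ 2 + (\<beta> * cnj \<beta> - \<alpha> * cnj \<alpha> + \<delta> * cnj \<delta> - \<gamma> * cnj \<gamma>) * p0 * q0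
      + (- (cnj \<alpha> * \<beta> + cnj \<gamma> * \<delta>)) * q0 ^ 2 = 0"
    by (rule quadratic_zero)
  obtain r where r: "r > 0" "unit2 (p0 / complex_of_real r) (q0 / complex_of_real r)"
    by (rule unit2_normalize[OF pq0])
  define p q where pq: "p = p0 / complex_of_real r" "q = q0 / complex_of_real r"
  have u: "p * cnj p + q * cnj q = 1" using r(2) by (simp add: unit2_def pq)
  \<comment> \<open>The images of the orthonormal basis \<open>(p, q)\<close>, \<open>(- cnj q, cnj p)\<close>.\<close>
  define x1 x2 y1 y2 where xy: "x1 = \<alpha> * p + \<beta> * q" "x2 = \<gamma> * p + \<delta> * q"
    "y1 = \<beta> * cnj p - \<alpha> * cnj q" "y2 = \<delta> * cnj p - \<gamma> * cnj q"
  have orth: "x1 * cnj y1 + x2 * cnj y2 = 0"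
  proof -
    have "x1 * cnj y1 + x2 * cnj y2 = (\<alpha> * cnj \<beta> + \<gamma> * cnj \<delta>) * p ^ 2 +
       (\<beta> * cnj \<beta> - \<alpha> * cnj \<alpha> + \<delta> * cnj \<delta> - \<gamma> * cnj \<gamma>) * p * q + (- (cnj \<alpha> * \<beta> + cnj \<gamma> * \<delta>)) * q ^ 2"
      by (simp add: xy power2_eq_square algebra_simps)
    also have "\<dots> = ((\<alpha> * cnj \<beta> + \<gamma> * cnj \<delta>) * p0 ^ 2 + (\<beta> * cnj \<beta> - \<alpha> * cnj \<alpha> + \<delta> * cnj \<delta> - \<gamma> * cnj \<gamma>) * p0 * q0
      + (- (cnj \<alpha> * \<beta> + cnj \<gamma> * \<delta>)) * q0 ^ 2) / (complex_of_real r) ^ 2"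
      by (simp add: pq power2_eq_square add_divide_distrib diff_divide_distrib)
    finally show ?thesis using z0 by simp
  qed
  have det2: "x1 * y2 - x2 * y1 = 1"
  proof -
    have "x1 * y2 - x2 * y1 = (\<alpha> * \<delta> - \<beta> * \<gamma>) * (p * cnj p + q * cnj q)"
      by (simp add: xy algebra_simps)
    then show ?thesis using det u by simp
  qed
  then have x0: "(x1, x2) \<noteq> (0, 0)" by auto
  obtain t where t: "t > 0" "x1 * cnj x1 + x2 * cnj x2 = complex_of_real (t ^ 2)"
    "unit2 (x1 / complex_of_real t) (x2 / complex_of_real t)"
    by (rule unit2_normalize[OF x0])
  define T where "T = complex_of_real t"
  have T0: "T \<noteq> 0" "cnj T = T" using t(1) by (auto simp: T_def)
  have TT: "x1 * cnj x1 + x2 * cnj x2 = T * T" using t(2) by (simp add: T_def power2_eq_square)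
  have orth': "cnj x1 * y1 + cnj x2 * y2 = 0"
    using arg_cong[OF orth, of cnj] by simp
  have y: "T * T * y2 = cnj x1" "T * T * y1 = - cnj x2"
  proof -
    have "T * T * y2 = cnj x1 * (x1 * y2 - x2 * y1) + x2 * (cnj x1 * y1 + cnj x2 * y2)"
      unfolding TT[symmetric] by (simp add: algebra_simps)
    then show "T * T * y2 = cnj x1" unfolding det2 orth' by simp
    have "T * T * y1 = - cnj x2 * (x1 * y2 - x2 * y1) + x1 * (cnj x1 * y1 + cnj x2 * y2)"
      unfolding TT[symmetric] by (simp add: algebra_simps)
    then show "T * T * y1 = - cnj x2" unfolding det2 orth' by simp
  qed
  define u v where uv: "u = x1 / T" "v = - cnj x2 / T"
  have uv1: "unit2 u v" using t(3) T0 by (simp add: unit2_def uv T_def[symmetric] mult.commute)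
  have ix: "x1 = T * u" "x2 = - (T * cnj v)" using T0 by (simp_all add: uv)
  have iy: "y1 = v / T" "y2 = cnj u / T"
  proof -
    have "y1 = (T * T * y1) / (T * T)" "y2 = (T * T * y2) / (T * T)" using T0 by simp_all
    then show "y1 = v / T" "y2 = cnj u / T" unfolding y uv using T0 by simp_all
  qed
  have M: "\<alpha> = x1 * cnj p - y1 * q" "\<beta> = x1 * cnj q + y1 * p" "\<gamma> = x2 * cnj p - y2 * q" "\<delta> = x2 * cnj q + y2 * p"
  proof -
    have s: "z = z * (p * cnj p + q * cnj q)" for z using u by simp
    show "\<alpha> = x1 * cnj p - y1 * q" by (subst s[of \<alpha>]) (simp add: xy algebra_simps)
    show "\<beta> = x1 * cnj q + y1 * p" by (subst s[of \<beta>]) (simp add: xy algebra_simps)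
    show "\<gamma> = x2 * cnj p - y2 * q" by (subst s[of \<gamma>]) (simp add: xy algebra_simps)
    show "\<delta> = x2 * cnj q + y2 * p" by (subst s[of \<delta>]) (simp add: xy algebra_simps)
  qed
  show thesis
  proof (rule that[of "cnj p" "cnj q" u v t])
    show "unit2 (cnj p) (cnj q)" using u by (simp add: unit2_def mult.commute)
    show "unit2 u v" "t > 0" by fact+
    fix c
    show "act d \<alpha> \<beta> \<gamma> \<delta> c = su d u v (act d (complex_of_real t) 0 0 (complex_of_real (1 / t)) (su d (cnj p) (cnj q) c))"
      unfolding su_def act_act of_real_divide T_def[symmetric] M ix iy
      by (rule act_cong) (simp_all add: algebra_simps)
  qed
qed

section \<open>Diagonal conjugations between antipodal maps\<close>

lemma diag_coeffs:
  assumes t: "t > (0::real)" and k: "k \<le> d"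
    and e_def: "e = act d (complex_of_real t) 0 0 (complex_of_real (1 / t)) c"
  shows "complex_of_real (t ^ (2 * k)) * numer d e k = complex_of_real (t ^ (d + 1)) * numer d c k"
    and "complex_of_real (t ^ (2 * k + 1)) * denom d e k = complex_of_real (t ^ d) * denom d c k"
proof -
  define T where "T = complex_of_real t"
  have T0: "T \<noteq> 0" using t by (simp add: T_def)
  have fe: "form d a (1 / T * x) (T * y) = form d (\<lambda>k. T ^ (d - k) / T ^ k * a k) x y" for a x y
    unfolding form_def by (rule sum.cong) (auto simp: power_mult_distrib power_divide)
  have n: "numer d e k = T * (T ^ (d - k) / T ^ k * numer d c k)"
  proof (rule form_inject[OF _ k])
    fix x y
    show "form d (numer d e) x y = form d (\<lambda>k. T * (T ^ (d - k) / T ^ k * numer d c k)) x y"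
      unfolding e_def numer_act form_cmult of_real_divide T_def[symmetric] fe[symmetric] by simp
  qed
  have m: "denom d e k = 1 / T * (T ^ (d - k) / T ^ k * denom d c k)"
  proof (rule form_inject[OF _ k])
    fix x y
    show "form d (denom d e) x y = form d (\<lambda>k. 1 / T * (T ^ (d - k) / T ^ k * denom d c k)) x y"
      unfolding e_def denom_act form_cmult of_real_divide T_def[symmetric] fe[symmetric] by simp
  qed
  have ct: "complex_of_real (t ^ m) = T ^ m" for m by (simp add: T_def)
  have p: "T ^ d = T ^ k * T ^ (d - k)" using k by (simp flip: power_add)
  have p2: "T ^ (2 * k) = T ^ k * T ^ k" by (simp add: mult_2 power_add)
  show "complex_of_real (t ^ (2 * k)) * numer d e k = complex_of_real (t ^ (d + 1)) * numer d c k"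
    unfolding n ct unfolding power_add p p2 using T0 by simp
  show "complex_of_real (t ^ (2 * k + 1)) * denom d e k = complex_of_real (t ^ d) * denom d c k"
    unfolding m ct unfolding power_add p p2 using T0 by simp
qed

lemma anti_norms:
  assumes "k \<le> d" "a \<in> cvec (Suc d)"
  shows "cmod (denom d (anti_join d a) (d - k)) = cmod (numer d (anti_join d a) k)"
proof -
  have "denom d (anti_join d a) (d - k) = (- 1) ^ (d - k) * cnj (a k)"
    using assms(1) by (simp add: denom_anti antipodal_coeffs_def)
  then show ?thesis using assms by (simp add: norm_mult norm_power numer_anti)
qed

text \<open>Conjugation by the diagonal matrix of \<open>t\<close> and \<open>1 / t\<close> multiplies the \<open>k\<close>-th coefficient of the
  numerator by \<open>t\<close> to the power \<open>d + 1 - 2k\<close> and the \<open>(d - k)\<close>-th of the denominator by \<open>t\<close> to the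
  power \<open>2k - d - 1\<close>. In an antipodal pair these two coefficients have the same modulus. Only
  \<open>2k = d + 1\<close> fails to constrain \<open>t\<close>.\<close>

lemma diag_norms:
  assumes t: "t > (0::real)" and b: "b \<in> cvec (Suc d)" and k: "k \<le> d"
    and e: "act d (complex_of_real t) 0 0 (complex_of_real (1 / t)) c = (\<lambda>i. s * anti_join d b i)"
  shows "t ^ (2 * d + 2) * cmod (numer d c k) = t ^ (4 * k) * cmod (denom d c (d - k))"
proof -
  let ?e = "act d (complex_of_real t) 0 0 (complex_of_real (1 / t)) c"
  have 0: "cmod (denom d ?e (d - k)) = cmod (numer d ?e k)"
    unfolding e numer_mult denom_mult norm_mult anti_norms[OF k b] ..
  have 1: "t ^ (2 * k) * cmod (numer d ?e k) = t ^ (d + 1) * cmod (numer d c k)"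
    using arg_cong[OF diag_coeffs(1)[OF t k refl, of c], of cmod] t by (simp add: norm_mult norm_power)
  have 2: "t ^ (2 * (d - k) + 1) * cmod (denom d ?e (d - k)) = t ^ d * cmod (denom d c (d - k))"
    using arg_cong[OF diag_coeffs(2)[OF t _ refl, of "d - k" d c], of cmod] t by (simp add: norm_mult norm_power)
  have "t ^ (2 * d + 2) * cmod (numer d c k) * t ^ d = t ^ (2 * d + 1) * (t ^ (d + 1) * cmod (numer d c k))"
    by (simp add: power_add[symmetric] mult.assoc[symmetric] power_Suc[symmetric] del: power_Suc)
  also have "\<dots> = t ^ (2 * d + 1) * (t ^ (2 * k) * cmod (denom d ?e (d - k)))"
    unfolding 1[symmetric] 0 ..
  also have "\<dots> = t ^ (4 * k) * (t ^ (2 * (d - k) + 1) * cmod (denom d ?e (d - k)))"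
  proof -
    have "t ^ (2 * d + 1) * t ^ (2 * k) = t ^ (4 * k) * t ^ (2 * (d - k) + 1)"
    proof -
      have "2 * d + 1 + 2 * k = 4 * k + (2 * (d - k) + 1)" using k by simp
      then show ?thesis by (simp only: power_add[symmetric])
    qed
    then show ?thesis by (simp only: mult.assoc[symmetric])
  qed
  also have "\<dots> = t ^ (4 * k) * cmod (denom d c (d - k)) * t ^ d"
    unfolding 2 by simp
  finally show ?thesis using t by simp
qed

text \<open>If the middle coefficient were the only one in the numerator, then numerator and denominator
  would both vanish at 0. For \<open>d = 1\<close> this fails: conjugation by diagonal matrices fixes \<open>z \<mapsto> c z\<close>.\<close>

lemma nonmiddle_coefficient:
  assumes d: "d \<ge> 3" "odd d" and c: "nondeg d c"
    and eq: "\<And>k. k \<le> d \<Longrightarrow> cmod (denom d c (d - k)) = cmod (numer d c k)"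
  obtains k where "k \<le> d" "2 * k \<noteq> d + 1" "numer d c k \<noteq> 0"
proof -
  have "\<exists>k\<le>d. 2 * k \<noteq> d + 1 \<and> numer d c k \<noteq> 0"
  proof (rule ccontr)
    assume "\<not> ?thesis"
    then have z: "numer d c k = 0" if "k \<le> d" "2 * k \<noteq> d + 1" for k using that by blast
    have "numer d c 0 = 0" using z[of 0] by simp
    moreover have "2 * d \<noteq> d + 1" using d by simp
    then have "numer d c d = 0" using z[of d] by simp
    then have "denom d c 0 = 0" using eq[of d] by simp
    ultimately show False using nondegD[OF c, of 0 1] by (simp add: form_0_1)
  qed
  then show thesis using that by blast
qed

lemma power_tendsto_1:
  fixes t :: "nat \<Rightarrow> real"
  assumes "\<And>n. t n > 0" "(\<lambda>n. t n ^ m) \<longlonglongrightarrow> 1" "m > 0"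
  shows "t \<longlonglongrightarrow> 1"
proof -
  have "(\<lambda>n. root m (t n ^ m)) \<longlonglongrightarrow> root m 1" by (intro tendsto_real_root assms)
  moreover have "root m (t n ^ m) = t n" for n
    using assms(1)[of n] assms(3) by (simp add: real_root_power_cancel)
  ultimately show ?thesis using assms(3) by simp
qed

text \<open>The properness of the action near antipodal pairs: if vectors \<open>cs n\<close> converge to a nondegenerate
  vector that satisfies the antipodal modulus condition, and diagonal conjugations turn them into
  antipodal pairs, then these conjugations converge to the identity. Comparing the moduli of one
  coefficient other than the middle one gives a nonzero power of \<open>t n\<close> that tends to 1.\<close>

lemma diag_tendsto_1:
  assumes d: "d \<ge> 3" "odd d" and c: "nondeg d c"
    and eq: "\<And>k. k \<le> d \<Longrightarrow> cmod (denom d c (d - k)) = cmod (numer d c k)"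
    and lim: "\<And>k. (\<lambda>n. cs n k) \<longlonglongrightarrow> c k"
    and t: "\<And>n. t n > (0::real)" and b: "\<And>n. bs n \<in> cvec (Suc d)"
    and e: "\<And>n. act d (complex_of_real (t n)) 0 0 (complex_of_real (1 / t n)) (cs n) = (\<lambda>i. ss n * anti_join d (bs n) i)"
  shows "t \<longlonglongrightarrow> 1"
proof -
  obtain k where k: "k \<le> d" "2 * k \<noteq> d + 1" "numer d c k \<noteq> 0"
    by (rule nonmiddle_coefficient[OF d c eq])
  define x y where xy: "x n = cmod (numer d (cs n) k)" "y n = cmod (denom d (cs n) (d - k))" for n
  define z where "z = cmod (numer d c k)"
  have z: "z \<noteq> 0" using k by (simp add: z_def)
  have "(\<lambda>n. numer d (cs n) k) \<longlonglongrightarrow> numer d c k" "(\<lambda>n. denom d (cs n) (d - k)) \<longlonglongrightarrow> denom d c (d - k)"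
    using lim by (auto simp: numer_def denom_def)
  then have xl: "x \<longlonglongrightarrow> z" and "y \<longlonglongrightarrow> cmod (denom d c (d - k))"
    unfolding xy z_def by (auto intro: tendsto_norm)
  then have yl: "y \<longlonglongrightarrow> z" unfolding eq[OF k(1)] z_def by blast
  have rel: "t n ^ (2 * d + 2) * x n = t n ^ (4 * k) * y n" for n
    using diag_norms[OF t b k(1) e] unfolding xy .
  consider "4 * k < 2 * d + 2" | "4 * k > 2 * d + 2" using k(2) by linarith
  then show ?thesis
  proof cases
    case 1
    then obtain m where m: "2 * d + 2 = 4 * k + m" "m > 0" using less_imp_add_positive by metis
    have "t n ^ m * x n = y n" for n
      using rel[of n, unfolded m(1) power_add] t[of n] by simp
    then have "eventually (\<lambda>n. y n / x n = t n ^ m) sequentially"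
      using tendsto_imp_eventually_ne[OF xl z] by (auto elim!: eventually_mono simp: field_simps)
    moreover have "(\<lambda>n. y n / x n) \<longlonglongrightarrow> z / z" by (intro tendsto_divide xl yl z)
    ultimately have "(\<lambda>n. t n ^ m) \<longlonglongrightarrow> z / z" by (rule Lim_transform_eventually[rotated])
    then have "(\<lambda>n. t n ^ m) \<longlonglongrightarrow> 1" using z by simp
    then show ?thesis using power_tendsto_1 t m(2) by blast
  next
    case 2
    then obtain m where m: "4 * k = 2 * d + 2 + m" "m > 0" using less_imp_add_positive by metis
    have "t n ^ m * y n = x n" for n
      using rel[of n, unfolded m(1) power_add] t[of n] by simp
    then have "eventually (\<lambda>n. x n / y n = t n ^ m) sequentially"
      using tendsto_imp_eventually_ne[OF yl z] by (auto elim!: eventually_mono simp: field_simps)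
    moreover have "(\<lambda>n. x n / y n) \<longlonglongrightarrow> z / z" by (intro tendsto_divide xl yl z)
    ultimately have "(\<lambda>n. t n ^ m) \<longlonglongrightarrow> z / z" by (rule Lim_transform_eventually[rotated])
    then have "(\<lambda>n. t n ^ m) \<longlonglongrightarrow> 1" using z by simp
    then show ?thesis using power_tendsto_1 t m(2) by blast
  qed
qed

section \<open>Quotient maps from coefficient vectors\<close>

lemma tendsto_fun_iff:
  fixes f :: "'a \<Rightarrow> 'i \<Rightarrow> 'b::topological_space"
  shows "(f \<longlongrightarrow> l) F \<longleftrightarrow> (\<forall>i. ((\<lambda>n. f n i) \<longlongrightarrow> l i) F)"
  using limitin_componentwise[of "\<lambda>_. euclidean :: 'b topology" UNIV f l F]
  by (simp add: euclidean_product_topology)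

lemma continuous_on_coord: "continuous_on S (\<lambda>c::'i \<Rightarrow> 'b::topological_space. c i)"
  using continuous_on_product_coordinates[of i] continuous_on_subset by blast

lemma coord_space_eq: "coord_space n = top_of_set (cvec n)"
  by (simp add: coord_space_def cvec_def euclidean_product_topology)

text \<open>If continuous self-maps that preserve the fibres move any point of a fibre to any other one, then
  the saturation of an open set is a union of preimages of that set under such maps, hence open.
  This applies to the orbits of scalars and of conjugations.\<close>

lemma quotient_map_imp_open_map:
  assumes q: "quotient_map X Y q"
    and tr: "\<And>x y. \<lbrakk>x \<in> topspace X; y \<in> topspace X; q x = q y\<rbrakk> \<Longrightarrow>
        \<exists>f. continuous_map X X f \<and> f x = y \<and> (\<forall>z\<in>topspace X. q (f z) = q z)"
  shows "open_map X Y q"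
  unfolding open_map_def
proof (intro allI impI)
  fix U assume U: "openin X U"
  then have sub: "U \<subseteq> topspace X" by (rule openin_subset)
  have "openin X {x \<in> topspace X. q x \<in> q ` U}"
  proof (subst openin_subopen, intro ballI)
    fix x assume "x \<in> {x \<in> topspace X. q x \<in> q ` U}"
    then obtain u where u: "x \<in> topspace X" "u \<in> U" "q x = q u" by blast
    then obtain f where f: "continuous_map X X f" "f x = u" "\<forall>z\<in>topspace X. q (f z) = q z"
      using tr[of x u] sub by blast
    have "{z \<in> topspace X. f z \<in> U} \<subseteq> {x \<in> topspace X. q x \<in> q ` U}"
      using f(3) by (auto simp: image_iff) metis
    moreover have "openin X {z \<in> topspace X. f z \<in> U}"
      using openin_continuous_map_preimage[OF f(1) U] .
    ultimately show "\<exists>T. openin X T \<and> x \<in> T \<and> T \<subseteq> {x \<in> topspace X. q x \<in> q ` U}"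
      using u f(2) by blast
  qed
  moreover have "q ` U \<subseteq> topspace Y"
    using sub quotient_imp_surjective_map[OF q] by blast
  ultimately show "openin Y (q ` U)"
    using q unfolding quotient_map_def by blast
qed

lemma continuous_on_formal_resultant:
  assumes "\<And>k. continuous_on S (\<lambda>c. a c k)" "\<And>k. continuous_on S (\<lambda>c. b c k)"
  shows "continuous_on (S :: 'a::topological_space set) (\<lambda>c. formal_resultant d (vec_poly d (a c)) (vec_poly d (b c)))"
proof -
  have entry: "continuous_on S (\<lambda>c. sylvester_mat_sub d d (vec_poly d (a c)) (vec_poly d (b c)) $$ (i, j))"
    if "i < d + d" "j < d + d" for i j
  proof -
    have cif: "continuous_on S (\<lambda>c. if P then f c else g c)"
      if "continuous_on S f" "continuous_on S g" for P and f g :: "'a \<Rightarrow> complex"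
      using that by (cases P) auto
    show ?thesis
      unfolding sylvester_mat_sub_index[OF that] coeff_vec_poly
      by (intro cif assms continuous_on_const)
  qed
  have "formal_resultant d (vec_poly d (a c)) (vec_poly d (b c)) =
    (\<Sum>p | p permutes {0..<d + d}. signof p *
       (\<Prod>i = 0..<d + d. sylvester_mat_sub d d (vec_poly d (a c)) (vec_poly d (b c)) $$ (i, p i)))" for c
    unfolding formal_resultant_def Determinant.det_def by simp
  moreover have "continuous_on S (\<lambda>c. \<Sum>p | p permutes {0..<d + d}. signof p *
       (\<Prod>i = 0..<d + d. sylvester_mat_sub d d (vec_poly d (a c)) (vec_poly d (b c)) $$ (i, p i)))"
  proof (intro continuous_on_sum continuous_on_mult continuous_on_const continuous_on_prod)
    fix p i assume "p \<in> {p. p permutes {0..<d + d}}" "i \<in> {0..<d + d}"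
    then have "i < d + d" "p i < d + d" using permutes_in_image[of p "{0..<d+d}" i] by auto
    then show "continuous_on S (\<lambda>c. sylvester_mat_sub d d (vec_poly d (a c)) (vec_poly d (b c)) $$ (i, p i))"
      by (rule entry)
  qed
  ultimately show ?thesis by simp
qed

lemma open_nondeg: assumes "d \<ge> 1" shows "open {c. nondeg d c}"
proof -
  have "continuous_on UNIV (\<lambda>c. formal_resultant d (vec_poly d (numer d c)) (vec_poly d (denom d c)))"
  proof (rule continuous_on_formal_resultant)
    show "continuous_on UNIV (\<lambda>c. numer d c k)" "continuous_on UNIV (\<lambda>c. denom d c k)" for k
      by (cases "k \<le> d"; simp add: numer_def denom_def continuous_on_coord)+
  qed
  then have "open {c. formal_resultant d (vec_poly d (numer d c)) (vec_poly d (denom d c)) \<noteq> 0}"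
    by (intro open_Collect_neq continuous_on_const)
  then show ?thesis by (simp add: nondeg_def formal_resultant_eq_0_iff[OF assms])
qed

lemma tendsto_anti_join:
  assumes "\<And>k. ((\<lambda>n. a n k) \<longlongrightarrow> a' k) F"
  shows "((\<lambda>n. anti_join d (a n) i) \<longlongrightarrow> anti_join d a' i) F"
  unfolding anti_join_def join_coeffs_def antipodal_coeffs_def
  by (cases "i \<le> d"; cases "i \<le> 2 * d + 1"; cases "i - Suc d \<le> d") (auto intro!: tendsto_intros assms)

lemma continuous_on_anti_join: "continuous_on S (anti_join d)"
  unfolding continuous_on_def tendsto_fun_iff
  by (intro ballI allI tendsto_anti_join) (metis continuous_on_coord continuous_on_def)

lemma open_nonZ: assumes "d \<ge> 1" shows "openin (top_of_set (cvec (Suc d))) (nonZ d)"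
proof -
  have "open (anti_join d -` {c. nondeg d c})"
    using continuous_on_open_vimage[of UNIV "anti_join d"] open_nondeg[OF assms] continuous_on_anti_join
    by (metis Int_UNIV_right open_UNIV)
  moreover have "nonZ d = cvec (Suc d) \<inter> (anti_join d -` {c. nondeg d c})"
    using nonZ_iff[OF assms] by auto
  ultimately show ?thesis by (auto simp: openin_open)
qed

definition Nspace :: "nat \<Rightarrow> (nat \<Rightarrow> complex) topology" where
  "Nspace d = top_of_set (nondeg_vecs d)"

lemma topspace_Nspace[simp]: "topspace (Nspace d) = nondeg_vecs d" by (simp add: Nspace_def)

lemma continuous_on_scale: "continuous_on S (\<lambda>c::nat \<Rightarrow> complex. \<lambda>i. s * c i)"
  by (intro continuous_on_coordinatewise_then_product continuous_intros continuous_on_coord)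

lemma proj_open_map:
  "open_map (top_of_set (cvec (Suc n) - {\<lambda>_. 0})) (complex_proj_space n) proj_class"
  "continuous_map (top_of_set (cvec (Suc n) - {\<lambda>_. 0})) (complex_proj_space n) proj_class"
proof -
  have e: "subtopology (coord_space (Suc n)) {c. c \<noteq> (\<lambda>_. 0)} = top_of_set (cvec (Suc n) - {\<lambda>_. 0 :: complex})"
    unfolding coord_space_eq subtopology_subtopology by (rule arg_cong[of _ _ "top_of_set"]) auto
  have q: "quotient_map (top_of_set (cvec (Suc n) - {\<lambda>_. 0})) (complex_proj_space n) proj_class"
    unfolding complex_proj_space_def e by (rule quotient_map_quotient_topology)
  show "open_map (top_of_set (cvec (Suc n) - {\<lambda>_. 0})) (complex_proj_space n) proj_class"
  proof (rule quotient_map_imp_open_map[OF q])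
    fix x y assume "x \<in> topspace (top_of_set (cvec (Suc n) - {\<lambda>_. 0}))" "proj_class x = proj_class y"
    then obtain s where s: "s \<noteq> 0" "y = (\<lambda>i. s * x i)" using proj_class_eq_iff by blast
    have "(\<lambda>z. \<lambda>i. s * z i) \<in> (cvec (Suc n) - {\<lambda>_. 0}) \<rightarrow> (cvec (Suc n) - {\<lambda>_. 0})"
      using s(1) by (auto simp: cvec_def fun_eq_iff)
    then have "continuous_map (top_of_set (cvec (Suc n) - {\<lambda>_. 0})) (top_of_set (cvec (Suc n) - {\<lambda>_. 0})) (\<lambda>z. \<lambda>i. s * z i)"
      by (simp only: continuous_map_subtopology_eu continuous_on_scale simp_thms)
    then show "\<exists>f. continuous_map (top_of_set (cvec (Suc n) - {\<lambda>_. 0})) (top_of_set (cvec (Suc n) - {\<lambda>_. 0})) f \<and> f x = y \<and>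
       (\<forall>z\<in>topspace (top_of_set (cvec (Suc n) - {\<lambda>_. 0})). proj_class (f z) = proj_class z)"
      using s proj_class_mult by blast
  qed
  show "continuous_map (top_of_set (cvec (Suc n) - {\<lambda>_. 0})) (complex_proj_space n) proj_class"
    by (rule quotient_imp_continuous_map[OF q])
qed

lemma proj_nondeg: assumes "d \<ge> 1" "x \<in> cvec (2 * d + 2)" "proj_class x \<in> Rat d"
  shows "x \<in> nondeg_vecs d"
proof -
  obtain c where c: "c \<in> nondeg_vecs d" "proj_class c = proj_class x" using assms(3) unfolding Rat_eq[OF assms(1)] by auto
  then obtain s where "s \<noteq> 0" "x = (\<lambda>i. s * c i)" using proj_class_eq_iff by blast
  then show ?thesis using c(1) assms(2) by (simp add: nondeg_vecs_def nondeg_mult)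
qed

lemma proj_quotient:
  assumes d: "d \<ge> 1"
  shows "open_map (Nspace d) (Rat_space d) proj_class" "quotient_map (Nspace d) (Rat_space d) proj_class"
proof -
  let ?P = "cvec (2 * d + 2) - {\<lambda>_. 0 :: complex}"
  have S: "Suc (2 * d + 1) = 2 * d + 2" by simp
  have U: "{x \<in> topspace (top_of_set ?P). proj_class x \<in> Rat d} = nondeg_vecs d"
    using proj_nondeg[OF d] nondeg_nonzero unfolding Rat_eq[OF d] nondeg_vecs_def by auto
  have e: "subtopology (top_of_set ?P) (nondeg_vecs d) = Nspace d"
    unfolding Nspace_def subtopology_subtopology using U by (auto intro!: arg_cong[of _ _ "top_of_set"])
  show o: "open_map (Nspace d) (Rat_space d) proj_class"
    using open_map_restriction[OF proj_open_map(1)[of "2 * d + 1", unfolded S] U] unfolding e Rat_space_def .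
  have c: "continuous_map (Nspace d) (Rat_space d) proj_class"
    unfolding Rat_space_def continuous_map_in_subtopology
    using continuous_map_from_subtopology[OF proj_open_map(2)[of "2 * d + 1", unfolded S], of "nondeg_vecs d"]
    unfolding e by (auto simp: Rat_eq[OF d])
  have "Rat d \<subseteq> topspace (complex_proj_space (2 * d + 1))" unfolding Rat_def by auto
  then have "proj_class ` topspace (Nspace d) = topspace (Rat_space d)"
    unfolding Rat_space_def by (auto simp: Rat_eq[OF d])
  then show "quotient_map (Nspace d) (Rat_space d) proj_class"
    by (rule continuous_open_imp_quotient_map[OF c o])
qed

lemma continuous_on_act: "continuous_on S (act d \<alpha> \<beta> \<gamma> \<delta>)"
  unfolding continuous_on_def tendsto_fun_iff
  by (intro ballI allI tendsto_act tendsto_const) (metis continuous_on_coord continuous_on_def)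

lemma mclass_quotient:
  assumes d: "d \<ge> 1"
  shows "open_map (Nspace d) (moduli_space d) (mclass d)" "quotient_map (Nspace d) (moduli_space d) (mclass d)"
proof -
  have "quotient_map (Rat_space d) (moduli_space d) (conj_class d)"
    unfolding moduli_space_def by (rule quotient_map_quotient_topology)
  from quotient_map_compose[OF proj_quotient(2)[OF d] this]
  show q: "quotient_map (Nspace d) (moduli_space d) (mclass d)"
    by (simp add: mclass_def[abs_def] comp_def)
  show "open_map (Nspace d) (moduli_space d) (mclass d)"
  proof (rule quotient_map_imp_open_map[OF q])
    fix x y assume xy: "x \<in> topspace (Nspace d)" "y \<in> topspace (Nspace d)" "mclass d x = mclass d y"
    then have xy': "x \<in> nondeg_vecs d" "y \<in> nondeg_vecs d" by simp_all
    obtain \<alpha> \<beta> \<gamma> \<delta> s where det: "\<alpha> * \<delta> - \<beta> * \<gamma> = 1" and s: "s \<noteq> 0" and e: "act d \<alpha> \<beta> \<gamma> \<delta> x = (\<lambda>i. s * y i)"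
      by (rule mclass_eqD[OF d xy' xy(3)])
    define f where "f = (\<lambda>z. \<lambda>i. 1 / s * act d \<alpha> \<beta> \<gamma> \<delta> z i)"
    have fN: "f z \<in> nondeg_vecs d" if "z \<in> nondeg_vecs d" for z
    proof -
      have "nondeg d (act d \<alpha> \<beta> \<gamma> \<delta> z)" using nondeg_vecs_act[OF det that] by (simp add: nondeg_vecs_def)
      moreover have "1 / s \<noteq> 0" using s by simp
      ultimately show ?thesis unfolding f_def nondeg_vecs_def
        using cvec_mult[OF act_cvec] nondeg_mult by blast
    qed
    have "continuous_on (nondeg_vecs d) f"
      unfolding f_def using continuous_on_compose2[OF continuous_on_scale continuous_on_act] by blast
    then have "continuous_map (Nspace d) (Nspace d) f"
      unfolding Nspace_def continuous_map_subtopology_eu using fN by auto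
    moreover have "f x = y" using s by (simp add: f_def e)
    moreover have "mclass d (f z) = mclass d z" if "z \<in> nondeg_vecs d" for z
      unfolding f_def using mclass_mult[of "1 / s"] s mclass_act[OF d that det] by simp
    ultimately show "\<exists>f. continuous_map (Nspace d) (Nspace d) f \<and> f x = y \<and>
       (\<forall>z\<in>topspace (Nspace d). mclass d (f z) = mclass d z)" by auto
  qed
qed

section \<open>Lifting convergent sequences\<close>

text \<open>The parametrizations of the antipodal loci are restrictions of open maps to subsets that are
  not saturated, so their openness does not come for free. If the map were not open at \<open>a\<close>, there
  would be points near \<open>C a\<close> whose images lie in \<open>B\<close> but outside the image of a neighbourhood of \<open>a\<close>;
  lifting a sequence of such points contradicts this. Passing to a subsequence is permitted, since
  one lifted point suffices.\<close>

lemma open_map_by_sequences: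
  fixes C :: "(nat \<Rightarrow> complex) \<Rightarrow> nat \<Rightarrow> complex"
  assumes \<pi>: "open_map (top_of_set N) Y \<pi>" "\<pi> ` N \<subseteq> topspace Y"
    and C: "C ` S \<subseteq> N" "\<pi> ` C ` S \<subseteq> B"
    and lift: "\<And>a c. \<lbrakk>a \<in> S; c \<longlonglongrightarrow> C a; \<And>n. c n \<in> N; \<And>n. \<pi> (c n) \<in> B\<rbrakk> \<Longrightarrow>
       \<exists>r b. (\<forall>n. b n \<in> S) \<and> b \<longlonglongrightarrow> a \<and> (\<forall>n. \<pi> (C (b n)) = \<pi> (c (r n)))"
  shows "open_map (top_of_set S) (subtopology Y B) (\<lambda>a. \<pi> (C a))"
  unfolding open_map_def
proof (intro allI impI)
  fix U assume "openin (top_of_set S) U"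
  then obtain T where T: "open T" "U = S \<inter> T" by (auto simp: openin_open)
  show "openin (subtopology Y B) ((\<lambda>a. \<pi> (C a)) ` U)"
  proof (subst openin_subopen, intro ballI)
    fix y assume "y \<in> (\<lambda>a. \<pi> (C a)) ` U"
    then obtain a where a: "a \<in> U" "y = \<pi> (C a)" by blast
    define W where "W n = \<pi> ` (N \<inter> ball (C a) (1 / real (Suc n)))" for n
    have W: "openin Y (W n)" for n
      using \<pi>(1) unfolding open_map_def W_def by (metis open_ball openin_open_Int)
    have "\<exists>n. W n \<inter> B \<subseteq> (\<lambda>a. \<pi> (C a)) ` U"
    proof (rule ccontr)
      assume "\<not> ?thesis"
      then have "\<forall>n. \<exists>c. c \<in> N \<and> dist (C a) c < 1 / real (Suc n) \<and> \<pi> c \<in> B \<and> \<pi> c \<notin> (\<lambda>a. \<pi> (C a)) ` U"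
        unfolding W_def by fastforce
      then obtain c where c: "\<And>n. c n \<in> N" "\<And>n. dist (C a) (c n) < 1 / real (Suc n)"
        "\<And>n. \<pi> (c n) \<in> B" "\<And>n. \<pi> (c n) \<notin> (\<lambda>a. \<pi> (C a)) ` U" by metis
      have "(\<lambda>n. dist (c n) (C a)) \<longlonglongrightarrow> 0"
      proof (rule Lim_null_comparison)
        show "\<forall>\<^sub>F n in sequentially. norm (dist (c n) (C a)) \<le> 1 / real (Suc n)"
          using c(2) by (intro always_eventually allI) (simp add: dist_commute less_imp_le)
        show "(\<lambda>n. 1 / real (Suc n)) \<longlonglongrightarrow> 0" using LIMSEQ_inverse_real_of_nat by (simp add: inverse_eq_divide)
      qed
      then have "c \<longlonglongrightarrow> C a" by (rule tendsto_dist_iff[THEN iffD2])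
      moreover have aS: "a \<in> S" using a T by simp
      ultimately obtain r b where rb: "\<forall>n. b n \<in> S" "b \<longlonglongrightarrow> a" "\<forall>n. \<pi> (C (b n)) = \<pi> (c (r n))"
        using lift[of a c] c(1,3) by blast
      have "\<forall>\<^sub>F n in sequentially. b n \<in> T"
        using rb(2) T a by (auto intro: topological_tendstoD)
      then obtain n where "b n \<in> T" using eventually_happens by force
      then have "b n \<in> U" using rb(1) T by simp
      then have "\<pi> (C (b n)) \<in> (\<lambda>a. \<pi> (C a)) ` U" by blast
      then show False using rb(3) c(4) by metis
    qed
    then obtain n where n: "W n \<inter> B \<subseteq> (\<lambda>a. \<pi> (C a)) ` U" by blast
    have "C a \<in> N" "\<pi> (C a) \<in> B" using a T C by auto
    then have "y \<in> W n \<inter> B" unfolding W_def a(2) by auto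
    then show "\<exists>T. openin (subtopology Y B) T \<and> y \<in> T \<and> T \<subseteq> (\<lambda>a. \<pi> (C a)) ` U"
      using n W[of n] by (intro exI[of _ "W n \<inter> B"]) (auto simp: openin_subtopology)
  qed
qed

lemma unit_convergent_subsequence:
  fixes e :: "nat \<Rightarrow> complex"
  assumes "\<And>n. cmod (e n) = 1"
  obtains r l where "strict_mono r" "(\<lambda>n. e (r n)) \<longlonglongrightarrow> l" "cmod l = 1"
proof -
  have "bounded (range e)" using assms by (auto simp: bounded_iff intro!: exI[of _ 1])
  then obtain l r where lr: "strict_mono (r :: nat \<Rightarrow> nat)" "(e \<circ> r) \<longlonglongrightarrow> l"
    using bounded_imp_convergent_subsequence by blast
  then have "(\<lambda>n. cmod (e (r n))) \<longlonglongrightarrow> cmod l" by (intro tendsto_norm) (simp add: comp_def)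
  then have "cmod l = 1" using assms by (simp add: LIMSEQ_const_iff)
  with that lr show thesis by (simp add: comp_def)
qed

text \<open>The vectors \<open>c n\<close> are complex multiples of antipodal pairs and converge to an antipodal pair. Their
  phases accumulate at some \<open>l\<close> of modulus 1 by compactness, and \<open>l\<close> must be real because the limit
  and its quotient by \<open>l\<close> are both antipodal. So real scalars already make the parameters converge.\<close>

lemma phase_limit:
  assumes d: "d \<ge> 1" and a: "a \<in> cvec (Suc d)" "\<exists>k\<le>d. a k \<noteq> 0"
    and lim: "\<And>i. (\<lambda>n. c n i) \<longlonglongrightarrow> anti_join d a i"
    and b: "\<And>n. b n \<in> cvec (Suc d)" and c: "\<And>n. c n = (\<lambda>i. s n * anti_join d (b n) i)" "\<And>n. s n \<noteq> 0"
  obtains r \<rho> where "strict_mono r" "\<And>n. \<rho> n \<noteq> (0::real)"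
    "\<And>i. (\<lambda>n. complex_of_real (\<rho> n) * b (r n) i) \<longlonglongrightarrow> a i"
proof -
  define e where "e n = s n / complex_of_real (cmod (s n))" for n
  have e1: "cmod (e n) = 1" for n using c(2)[of n] by (simp add: e_def norm_divide)
  obtain r l where rl: "strict_mono r" "(\<lambda>n. e (r n)) \<longlonglongrightarrow> l" "cmod l = 1"
    using unit_convergent_subsequence[of e] e1 by blast
  have l0: "l \<noteq> 0" using rl(3) by auto
  have e0: "e n \<noteq> 0" for n using e1[of n] by auto
  have lim': "(\<lambda>n. c (r n) i) \<longlonglongrightarrow> anti_join d a i" for i
    using LIMSEQ_subseq_LIMSEQ[OF lim rl(1)] by (simp add: comp_def)
  have ce: "anti_join d (\<lambda>k. complex_of_real (cmod (s n)) * b n k) i = c n i / e n" for n i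
    unfolding anti_mult c(1) e_def using c(2)[of n] by simp
  have L: "(\<lambda>n. anti_join d (\<lambda>k. complex_of_real (cmod (s (r n))) * b (r n) k) i) \<longlonglongrightarrow> anti_join d a i / l" for i
    unfolding ce by (intro tendsto_divide lim' rl(2) l0)
  have Lb: "(\<lambda>n. complex_of_real (cmod (s (r n))) * b (r n) k) \<longlonglongrightarrow> a k / l" for k
  proof (cases "k \<le> d")
    case True then show ?thesis using L[of k] by (simp add: anti_join_def join_coeffs_def)
  next
    case False then show ?thesis using a(1) b by (simp add: cvec_def)
  qed
  have "(\<lambda>n. anti_join d (\<lambda>k. complex_of_real (cmod (s (r n))) * b (r n) k) i) \<longlonglongrightarrow> anti_join d (\<lambda>k. a k / l) i" for i
    by (intro tendsto_anti_join Lb)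
  then have "anti_join d (\<lambda>k. a k / l) i = anti_join d a i / l" for i
    using L[of i] LIMSEQ_unique by blast
  then have eq: "anti_join d (\<lambda>k. a k / l) = (\<lambda>i. 1 / l * anti_join d a i)" by (simp add: fun_eq_iff)
  have "(\<lambda>k. a k / l) \<in> cvec (Suc d)" using a(1) by (simp add: cvec_def)
  then obtain \<rho> where \<rho>: "1 / l = complex_of_real \<rho>"
    using anti_inject[OF d a(1) _ a(2) eq] by blast
  have "l = complex_of_real (1 / \<rho>)" using \<rho> l0 by (metis inverse_eq_divide inverse_inverse_eq of_real_inverse)
  moreover have \<rho>0: "1 / \<rho> \<noteq> 0" using \<rho> l0 by auto
  moreover have "(\<lambda>n. l * (complex_of_real (cmod (s (r n))) * b (r n) k)) \<longlonglongrightarrow> l * (a k / l)" for k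
    by (intro tendsto_mult tendsto_const Lb)
  ultimately have "(\<lambda>n. complex_of_real (1 / \<rho> * cmod (s (r n))) * b (r n) k) \<longlonglongrightarrow> a k" for k
    using l0 by (simp add: mult.assoc)
  moreover have "1 / \<rho> * cmod (s (r n)) \<noteq> 0" for n using \<rho>0 c(2) by simp
  ultimately show thesis using that[OF rl(1), of "\<lambda>n. 1 / \<rho> * cmod (s (r n))"] by blast
qed

section \<open>Rotations of the parameters\<close>

lemma unit2_mult:
  assumes "unit2 \<alpha> \<beta>" "unit2 p q" shows "unit2 (\<alpha> * p - \<beta> * cnj q) (\<alpha> * q + \<beta> * cnj p)"
proof -
  have "(\<alpha> * p - \<beta> * cnj q) * cnj (\<alpha> * p - \<beta> * cnj q) + (\<alpha> * q + \<beta> * cnj p) * cnj (\<alpha> * q + \<beta> * cnj p)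
     = (\<alpha> * cnj \<alpha> + \<beta> * cnj \<beta>) * (p * cnj p + q * cnj q)"
    by (simp add: algebra_simps)
  then show ?thesis using assms unfolding unit2_def by simp
qed

lemma unit2_inv: "unit2 \<alpha> \<beta> \<Longrightarrow> unit2 (cnj \<alpha>) (- \<beta>)"
  by (simp add: unit2_def mult.commute)

lemma su_su: "su d \<alpha> \<beta> (su d p q c) = su d (\<alpha> * p - \<beta> * cnj q) (\<alpha> * q + \<beta> * cnj p) c"
  unfolding su_def act_act by (rule act_cong) simp_all

lemma su_id: "c \<in> cvec (2 * d + 2) \<Longrightarrow> su d 1 0 c = c"
  using act_id by (simp add: su_def)

lemma su_inv: assumes "unit2 \<alpha> \<beta>" "c \<in> cvec (2 * d + 2)" shows "su d (cnj \<alpha>) (- \<beta>) (su d \<alpha> \<beta> c) = c"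
proof -
  have "cnj \<alpha> * \<alpha> - - \<beta> * cnj \<beta> = 1" using assms(1) by (simp add: unit2_def mult.commute)
  then show ?thesis unfolding su_su using su_id[OF assms(2)] by simp
qed

text \<open>The action of \<open>SU(2)\<close> on the parameters. As antipodal pairs are preserved, the numerator of the
  rotated pair carries all the information.\<close>

definition rotc :: "nat \<Rightarrow> complex \<Rightarrow> complex \<Rightarrow> (nat \<Rightarrow> complex) \<Rightarrow> nat \<Rightarrow> complex" where
  "rotc d \<alpha> \<beta> a = numer d (su d \<alpha> \<beta> (anti_join d a))"

lemma anti_rotc: "odd d \<Longrightarrow> a \<in> cvec (Suc d) \<Longrightarrow> anti_join d (rotc d \<alpha> \<beta> a) = su d \<alpha> \<beta> (anti_join d a)"
  unfolding rotc_def using su_anti_join by metis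

lemma rotc_cvec: "rotc d \<alpha> \<beta> a \<in> cvec (Suc d)" unfolding rotc_def by (rule numer_cvec)

lemma odd_ge_1: "odd d \<Longrightarrow> d \<ge> (1::nat)" by (cases d) auto

lemma su_nondeg_vecs: "unit2 \<alpha> \<beta> \<Longrightarrow> c \<in> nondeg_vecs d \<Longrightarrow> su d \<alpha> \<beta> c \<in> nondeg_vecs d"
  unfolding su_def by (rule nondeg_vecs_act[OF unit2_det])

lemma mclass_su: "d \<ge> 1 \<Longrightarrow> unit2 \<alpha> \<beta> \<Longrightarrow> c \<in> nondeg_vecs d \<Longrightarrow> mclass d (su d \<alpha> \<beta> c) = mclass d c"
  unfolding su_def by (rule mclass_act[OF _ _ unit2_det])

lemma rotc_nonZ:
  assumes "odd d" "unit2 \<alpha> \<beta>" "a \<in> nonZ d" shows "rotc d \<alpha> \<beta> a \<in> nonZ d"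
proof -
  note d1 = odd_ge_1[OF assms(1)]
  have "anti_join d (rotc d \<alpha> \<beta> a) \<in> nondeg_vecs d"
    unfolding anti_rotc[OF assms(1) nonZ_cvec[OF assms(3)]]
    by (rule su_nondeg_vecs[OF assms(2) nonZ_anti[OF d1 assms(3)]])
  then show ?thesis unfolding nonZ_iff[OF d1] nondeg_vecs_def using rotc_cvec by blast
qed

lemma mclass_rotc:
  assumes "odd d" "unit2 \<alpha> \<beta>" "a \<in> nonZ d"
  shows "mclass d (anti_join d (rotc d \<alpha> \<beta> a)) = mclass d (anti_join d a)"
  unfolding anti_rotc[OF assms(1) nonZ_cvec[OF assms(3)]]
  by (rule mclass_su[OF odd_ge_1[OF assms(1)] assms(2) nonZ_anti[OF odd_ge_1[OF assms(1)] assms(3)]])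

lemma nonZ_scale: assumes "d \<ge> 1" "\<rho> \<noteq> (0::real)" "a \<in> nonZ d" shows "(\<lambda>k. complex_of_real \<rho> * a k) \<in> nonZ d"
  using assms unfolding nonZ_iff[OF assms(1)] anti_mult by (simp add: nondeg_mult cvec_mult)

lemma mclass_scale: "\<rho> \<noteq> (0::real) \<Longrightarrow> mclass d (anti_join d (\<lambda>k. complex_of_real \<rho> * a k)) = mclass d (anti_join d a)"
  unfolding anti_mult by (rule mclass_mult) simp

lemma tendsto_rotc:
  assumes "(\<alpha> \<longlongrightarrow> \<alpha>') F" "(\<beta> \<longlongrightarrow> \<beta>') F" "\<And>k. ((\<lambda>n. a n k) \<longlongrightarrow> a' k) F"
  shows "((\<lambda>n. rotc d (\<alpha> n) (\<beta> n) (a n) i) \<longlongrightarrow> rotc d \<alpha>' \<beta>' a' i) F"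
proof -
  have *: "((\<lambda>n. su d (\<alpha> n) (\<beta> n) (anti_join d (a n)) i) \<longlongrightarrow> su d \<alpha>' \<beta>' (anti_join d a') i) F"
    unfolding su_def by (intro tendsto_act tendsto_minus tendsto_cnj assms tendsto_anti_join)
  show ?thesis unfolding rotc_def numer_def using * by (cases "i \<le> d") simp_all
qed

lemma rotc_id: "a \<in> cvec (Suc d) \<Longrightarrow> rotc d 1 0 a = a"
  by (simp only: rotc_def su_id[OF anti_cvec] numer_anti)

text \<open>Moving the outer unitary factor of the Cartan decomposition to the antipodal side leaves a single
  diagonal conjugation between the two maps, which is the situation of the properness lemma.\<close>

lemma mclass_nonZ_eqD:
  assumes d: "odd d" and c: "c \<in> nondeg_vecs d" and b: "b \<in> nonZ d"
    and eq: "mclass d c = mclass d (anti_join d b)"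
  shows "\<exists>p q u v t s. unit2 p q \<and> unit2 u v \<and> t > (0::real) \<and> s \<noteq> 0 \<and>
     act d (complex_of_real t) 0 0 (complex_of_real (1 / t)) (su d p q c) = (\<lambda>i. s * anti_join d (rotc d u v b) i)"
proof -
  note d1 = odd_ge_1[OF d]
  obtain \<alpha> \<beta> \<gamma> \<delta> s where det: "\<alpha> * \<delta> - \<beta> * \<gamma> = 1" and s: "s \<noteq> 0"
    and e: "act d \<alpha> \<beta> \<gamma> \<delta> c = (\<lambda>i. s * anti_join d b i)"
    by (rule mclass_eqD[OF d1 c nonZ_anti[OF d1 b] eq])
  obtain p q u v t where k: "unit2 p q" "unit2 u v" "t > (0::real)" and
    K: "\<And>c. act d \<alpha> \<beta> \<gamma> \<delta> c = su d u v (act d (complex_of_real t) 0 0 (complex_of_real (1 / t)) (su d p q c))"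
    using KAK[OF det, where d = d] by metis
  have "act d (complex_of_real t) 0 0 (complex_of_real (1 / t)) (su d p q c) =
     su d (cnj u) (- v) (\<lambda>i. s * anti_join d b i)"
    unfolding e[symmetric] K by (rule su_inv[OF k(2) act_cvec, symmetric])
  also have "\<dots> = (\<lambda>i. s * anti_join d (rotc d (cnj u) (- v) b) i)"
    unfolding su_def act_mult unfolding su_def[symmetric] anti_rotc[OF d nonZ_cvec[OF b]] ..
  finally show ?thesis using k s unit2_inv[OF k(2)] by blast
qed

lemma unit2_convergent_subsequence:
  assumes "\<And>n. unit2 (p n) (q n)"
  obtains r P Q where "strict_mono (r :: nat \<Rightarrow> nat)" "(\<lambda>n. p (r n)) \<longlonglongrightarrow> P" "(\<lambda>n. q (r n)) \<longlonglongrightarrow> Q" "unit2 P Q"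
proof -
  have "norm (p n, q n) = 1" for n
  proof -
    have "complex_of_real (cmod (p n) ^ 2 + cmod (q n) ^ 2) = 1"
      using assms[of n] unfolding unit2_def of_real_add complex_norm_square .
    then have "cmod (p n) ^ 2 + cmod (q n) ^ 2 = 1" using of_real_eq_1_iff by blast
    then show ?thesis by (simp add: norm_Pair)
  qed
  then have "bounded (range (\<lambda>n. (p n, q n)))" by (auto simp: bounded_iff intro!: exI[of _ 1])
  then obtain l r where lr: "strict_mono (r :: nat \<Rightarrow> nat)" "((\<lambda>n. (p n, q n)) \<circ> r) \<longlonglongrightarrow> l"
    using bounded_imp_convergent_subsequence by blast
  have P: "(\<lambda>n. p (r n)) \<longlonglongrightarrow> fst l" and Q: "(\<lambda>n. q (r n)) \<longlonglongrightarrow> snd l"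
    using tendsto_fst[OF lr(2)] tendsto_snd[OF lr(2)] by (simp_all add: comp_def)
  have "(\<lambda>n. p (r n) * cnj (p (r n)) + q (r n) * cnj (q (r n))) \<longlonglongrightarrow> fst l * cnj (fst l) + snd l * cnj (snd l)"
    by (intro tendsto_intros P Q)
  then have "unit2 (fst l) (snd l)" using assms by (simp add: unit2_def LIMSEQ_const_iff)
  then show thesis using that lr(1) P Q by blast
qed

text \<open>Conjugations that turn maps close to an antipodal one into antipodal maps can be taken close to
  the identity. By compactness of \<open>SU(2)\<close> the inner unitary factors converge along a subsequence, by
  properness the diagonal factors tend to 1, and undoing the inner unitary factor on the antipodal
  side gives parameters that converge up to phases.\<close>

lemma su2_normal_sequence:
  assumes d: "d \<ge> 3" "odd d" and a: "a \<in> nonZ d"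
    and c: "\<And>n. c n \<in> nondeg_vecs d" "\<And>i. (\<lambda>n. c n i) \<longlonglongrightarrow> anti_join d a i"
    and \<beta>: "\<And>n. \<beta> n \<in> nonZ d" "\<And>n. mclass d (c n) = mclass d (anti_join d (\<beta> n))"
  obtains r b where "\<And>n. b n \<in> nonZ d" "\<And>i. (\<lambda>n. b n i) \<longlonglongrightarrow> a i"
    "\<And>n. mclass d (anti_join d (b n)) = mclass d (c (r n))"
proof -
  note d1 = odd_ge_1[OF d(2)]
  let ?D = "\<lambda>t. act d (complex_of_real t) 0 0 (complex_of_real (1 / t))"
  have "\<forall>n. \<exists>p q u v t s. unit2 p q \<and> unit2 u v \<and> t > (0::real) \<and> s \<noteq> 0 \<and>
     ?D t (su d p q (c n)) = (\<lambda>i. s * anti_join d (rotc d u v (\<beta> n)) i)"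
    using mclass_nonZ_eqD[OF d(2) c(1) \<beta>(1) \<beta>(2)] by blast
  then obtain p q u v t s where *: "\<And>n. unit2 (p n) (q n)" "\<And>n. unit2 (u n) (v n)" "\<And>n. t n > (0::real)"
    "\<And>n. s n \<noteq> 0" "\<And>n. ?D (t n) (su d (p n) (q n) (c n)) = (\<lambda>i. s n * anti_join d (rotc d (u n) (v n) (\<beta> n)) i)"
    by metis
  define b' where "b' n = rotc d (u n) (v n) (\<beta> n)" for n
  have b': "b' n \<in> nonZ d" for n unfolding b'_def by (rule rotc_nonZ[OF d(2) *(2) \<beta>(1)])
  obtain r P Q where r: "strict_mono (r :: nat \<Rightarrow> nat)" and PQ: "(\<lambda>n. p (r n)) \<longlonglongrightarrow> P" "(\<lambda>n. q (r n)) \<longlonglongrightarrow> Q" "unit2 P Q"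
    by (rule unit2_convergent_subsequence[of p q]) (use *(1) in blast)+
  have cr: "(\<lambda>n. c (r n) i) \<longlonglongrightarrow> anti_join d a i" for i
    using LIMSEQ_subseq_LIMSEQ[OF c(2) r] by (simp add: comp_def)
  define c' where "c' n = su d (p (r n)) (q (r n)) (c (r n))" for n
  have aP: "rotc d P Q a \<in> nonZ d" by (rule rotc_nonZ[OF d(2) PQ(3) a])
  have c'l: "(\<lambda>n. c' n i) \<longlonglongrightarrow> anti_join d (rotc d P Q a) i" for i
    unfolding anti_rotc[OF d(2) nonZ_cvec[OF a]] c'_def su_def
    by (intro tendsto_act tendsto_minus tendsto_cnj PQ cr)
  have tl: "(\<lambda>n. t (r n)) \<longlonglongrightarrow> 1"
  proof (rule diag_tendsto_1[OF d, of "anti_join d (rotc d P Q a)" c' _ "\<lambda>n. b' (r n)" "\<lambda>n. s (r n)"])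
    show "nondeg d (anti_join d (rotc d P Q a))" using aP nonZ_iff[OF d1] by blast
    show "cmod (denom d (anti_join d (rotc d P Q a)) (d - k)) = cmod (numer d (anti_join d (rotc d P Q a)) k)"
      if "k \<le> d" for k by (rule anti_norms[OF that rotc_cvec])
    show "b' (r n) \<in> cvec (Suc d)" for n by (rule nonZ_cvec[OF b'])
    show "?D (t (r n)) (c' n) = (\<lambda>i. s (r n) * anti_join d (b' (r n)) i)" for n
      unfolding c'_def b'_def by (rule *(5))
  qed (use c'l *(3) in blast)+
  \<comment> \<open>Rotating back by the inverse of the inner unitary factor returns the limit to \<open>anti_join d a\<close>.\<close>
  define e where "e n = su d (cnj (p (r n))) (- q (r n)) (?D (t (r n)) (c' n))" for n
  define b2 where "b2 n = rotc d (cnj (p (r n))) (- q (r n)) (b' (r n))" for n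
  have b2: "b2 n \<in> nonZ d" for n unfolding b2_def by (rule rotc_nonZ[OF d(2) unit2_inv[OF *(1)] b'])
  have e: "e n = (\<lambda>i. s (r n) * anti_join d (b2 n) i)" for n
    unfolding e_def c'_def *(5) unfolding su_def act_mult
    unfolding su_def[symmetric] b'_def[symmetric] b2_def anti_rotc[OF d(2) nonZ_cvec[OF b']] ..
  have el: "(\<lambda>n. e n i) \<longlonglongrightarrow> anti_join d a i" for i
  proof -
    have tc: "(\<lambda>n. complex_of_real (t (r n))) \<longlonglongrightarrow> complex_of_real 1"
      "(\<lambda>n. complex_of_real (1 / t (r n))) \<longlonglongrightarrow> complex_of_real (1 / 1)"
      by (intro tendsto_of_real tendsto_divide tendsto_const tl; simp)+
    have "(\<lambda>n. e n i) \<longlonglongrightarrow> su d (cnj P) (- Q) (?D 1 (anti_join d (rotc d P Q a))) i"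
      unfolding e_def su_def
      by (intro tendsto_act tendsto_minus tendsto_cnj tendsto_const PQ tc c'l)
    moreover have "?D 1 (anti_join d (rotc d P Q a)) = su d P Q (anti_join d a)"
      using act_id[OF anti_cvec, of d "rotc d P Q a"] anti_rotc[OF d(2) nonZ_cvec[OF a]] by simp
    ultimately show ?thesis using su_inv[OF PQ(3) anti_cvec] by simp
  qed
  obtain r2 \<rho> where r2: "strict_mono (r2 :: nat \<Rightarrow> nat)" "\<And>n. \<rho> n \<noteq> (0::real)"
    "\<And>i. (\<lambda>n. complex_of_real (\<rho> n) * b2 (r2 n) i) \<longlonglongrightarrow> a i"
    using phase_limit[OF d1 nonZ_cvec[OF a] nonZ_nonzero[OF d1 a], of e b2 "\<lambda>n. s (r n)"] el e *(4)
      nonZ_cvec[OF b2] by metis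
  have m: "mclass d (anti_join d (b2 n)) = mclass d (c (r n))" for n
  proof -
    have 1: "su d (p (r n)) (q (r n)) (c (r n)) \<in> nondeg_vecs d" by (rule su_nondeg_vecs[OF *(1) c(1)])
    have det: "complex_of_real (t (r n)) * complex_of_real (1 / t (r n)) - 0 * 0 = 1" using *(3)[of "r n"] by simp
    have "mclass d (anti_join d (b2 n)) = mclass d (e n)" unfolding e mclass_mult[OF *(4)] ..
    also have "\<dots> = mclass d (?D (t (r n)) (su d (p (r n)) (q (r n)) (c (r n))))"
      unfolding e_def c'_def by (rule mclass_su[OF d1 unit2_inv[OF *(1)] nondeg_vecs_act[OF det 1]])
    also have "\<dots> = mclass d (c (r n))"
      unfolding mclass_act[OF d1 1 det] by (rule mclass_su[OF d1 *(1) c(1)])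
    finally show ?thesis .
  qed
  show thesis
  proof (rule that[of "\<lambda>n. (\<lambda>k. complex_of_real (\<rho> n) * b2 (r2 n) k)" "\<lambda>n. r (r2 n)"])
    show "(\<lambda>k. complex_of_real (\<rho> n) * b2 (r2 n) k) \<in> nonZ d" for n by (rule nonZ_scale[OF d1 r2(2) b2])
    show "mclass d (anti_join d (\<lambda>k. complex_of_real (\<rho> n) * b2 (r2 n) k)) = mclass d (c (r (r2 n)))" for n
      unfolding mclass_scale[OF r2(2)] by (rule m)
  qed (rule r2(3))
qed

section \<open>Fixed points\<close>

text \<open>Its roots are the fixed points in the plane of the map with numerator \<open>b\<close> and the antipodal
  denominator.\<close>

definition fixp :: "nat \<Rightarrow> (nat \<Rightarrow> complex) \<Rightarrow> complex poly" where
  "fixp d b = pCons 0 (vec_poly d (antipodal_coeffs d b)) - vec_poly d b"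

lemma poly_fixp: "poly (fixp d b) z = z * form d (antipodal_coeffs d b) z 1 - form d b z 1"
  by (simp add: fixp_def form_1)

lemma degree_fixp: "degree (fixp d b) \<le> Suc d"
  unfolding fixp_def
  by (intro degree_diff_le order_trans[OF degree_pCons_le] order_trans[OF degree_vec_poly])
     (simp_all add: degree_vec_poly)

text \<open>A map \<open>p / q\<close> with \<open>p = z q\<close> is the identity, whose degree is less than 2.\<close>

lemma fixp_nonzero: assumes d: "d \<ge> 2" and b: "b \<in> nonZ d" shows "fixp d b \<noteq> 0"
proof
  assume 0: "fixp d b = 0"
  let ?q = "vec_poly d (antipodal_coeffs d b)"
  have p: "vec_poly d b = pCons 0 ?q" using 0 by (simp add: fixp_def)
  have ncz: "\<not> common_zero d b (antipodal_coeffs d b)"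
    using b d nonZ_cvec[OF b] by (simp add: nonZ_iff nondeg_def numer_anti denom_anti)
  have nr: "poly ?q z \<noteq> 0" for z using not_common_zeroD(1)[OF ncz, of z] p by auto
  then have "constant (poly ?q)" using fundamental_theorem_of_algebra by blast
  then have dq: "degree ?q = 0" by (simp add: constant_degree)
  then have "degree (vec_poly d b) \<le> 1" unfolding p using degree_pCons_le[of 0 ?q] by simp
  then have "b d = 0" "antipodal_coeffs d b d = 0"
    using coeff_eq_0[of "vec_poly d b" d] coeff_eq_0[of ?q d] dq d by (auto simp: coeff_vec_poly)
  then show False using not_common_zeroD(2)[OF ncz] by simp
qed

text \<open>Each linear factor \<open>z - w\<close> with \<open>cmod w \<ge> r\<close> is at most \<open>cmod w (1 + cmod z / r)\<close> in modulus. This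
  gives the continuity of roots below without contour integrals: a polynomial that is tiny at 0
  but not at some other point has a root near 0.\<close>

lemma poly_bound_no_small_roots:
  fixes p :: "complex poly"
  assumes "r > 0" "\<And>w. poly p w = 0 \<Longrightarrow> r \<le> cmod w"
  shows "cmod (poly p z) \<le> cmod (poly p 0) * (1 + cmod z / r) ^ degree p"
  using assms(2)
proof (induction "degree p" arbitrary: p)
  case 0
  then obtain c where "p = [:c:]" by (metis degree_eq_zeroE)
  then show ?case by simp
next
  case (Suc n)
  then obtain w where w: "poly p w = 0"
    using fundamental_theorem_of_algebra[of p] by (auto simp: constant_degree)
  then obtain p' where p': "p = [:-w, 1:] * p'" by (meson dvdE poly_eq_0_iff_dvd)
  have "p' \<noteq> 0" using Suc.hyps(2) p' by auto
  then have deg: "degree p = Suc (degree p')"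
    unfolding p' by (subst degree_mult_eq) auto
  have rw: "r \<le> cmod w" using Suc.prems w by blast
  have IH: "cmod (poly p' z) \<le> cmod (poly p' 0) * (1 + cmod z / r) ^ degree p'"
    using Suc.hyps(1)[of p'] Suc.hyps(2) deg Suc.prems by (simp add: p')
  have "cmod (z - w) \<le> cmod w + cmod z" by (metis norm_minus_commute norm_triangle_ineq4)
  also have "\<dots> \<le> cmod w * (1 + cmod z / r)"
  proof -
    have "cmod z = r * (cmod z / r)" using assms(1) by simp
    also have "\<dots> \<le> cmod w * (cmod z / r)" using rw assms(1) by (intro mult_right_mono) auto
    finally show ?thesis by (simp add: distrib_left)
  qed
  finally have "cmod (z - w) * cmod (poly p' z) \<le> (cmod w * (1 + cmod z / r)) * (cmod (poly p' 0) * (1 + cmod z / r) ^ degree p')"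
    using IH assms(1) by (intro mult_mono) auto
  moreover have "cmod (poly p z) = cmod (z - w) * cmod (poly p' z)" by (simp add: p' norm_mult algebra_simps norm_minus_commute flip: norm_mult)
  moreover have "cmod (poly p 0) = cmod w * cmod (poly p' 0)" by (simp add: p' norm_mult)
  ultimately show ?case unfolding deg by (simp add: mult_ac)
qed

text \<open>A root in each ball for all large \<open>n\<close> does not yet give one sequence; choosing nearly smallest
  elements does.\<close>

lemma choose_tendsto_0:
  fixes P :: "nat \<Rightarrow> complex \<Rightarrow> bool"
  assumes "\<And>\<epsilon>. \<epsilon> > 0 \<Longrightarrow> \<forall>\<^sub>F n in sequentially. \<exists>z. cmod z < \<epsilon> \<and> P n z"
  obtains z where "z \<longlonglongrightarrow> 0" "\<forall>\<^sub>F n in sequentially. P n (z n)"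
proof -
  have "\<exists>z. P n z \<and> (\<forall>w. P n w \<longrightarrow> cmod z < cmod w + 1 / real (Suc n))" if "\<exists>z. P n z" for n
  proof -
    let ?S = "cmod ` {z. P n z}"
    have ne: "?S \<noteq> {}" and bdd: "bdd_below ?S" using that by (auto intro: bdd_belowI[of _ 0])
    have "Inf ?S < Inf ?S + 1 / real (Suc n)" by simp
    then obtain z where z: "P n z" "cmod z < Inf ?S + 1 / real (Suc n)"
      using cInf_lessD[OF ne] by blast
    have "Inf ?S \<le> cmod w" if "P n w" for w using that by (intro cInf_lower bdd) auto
    then show ?thesis using z by (meson add_right_mono less_le_trans)
  qed
  then obtain z where z: "\<And>n. \<exists>z. P n z \<Longrightarrow> P n (z n) \<and> (\<forall>w. P n w \<longrightarrow> cmod (z n) < cmod w + 1 / real (Suc n))"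
    by metis
  show thesis
  proof (rule that)
    show "\<forall>\<^sub>F n in sequentially. P n (z n)"
      using assms[of 1] z by (auto elim!: eventually_mono)
    show "z \<longlonglongrightarrow> 0"
    proof (rule tendstoI)
      fix \<epsilon> :: real assume \<epsilon>: "\<epsilon> > 0"
      have "(\<lambda>n. 1 / real (Suc n)) \<longlonglongrightarrow> 0" using LIMSEQ_inverse_real_of_nat by (simp add: inverse_eq_divide)
      then have "\<forall>\<^sub>F n in sequentially. 1 / real (Suc n) < \<epsilon> / 2" using \<epsilon> by (intro order_tendstoD) auto
      moreover have "\<forall>\<^sub>F n in sequentially. \<exists>w. cmod w < \<epsilon> / 2 \<and> P n w" using assms[of "\<epsilon> / 2"] \<epsilon> by simp
      ultimately show "\<forall>\<^sub>F n in sequentially. dist (z n) 0 < \<epsilon>"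
      proof eventually_elim
        case (elim n)
        then obtain w where w: "cmod w < \<epsilon> / 2" "P n w" by blast
        then have "cmod (z n) < cmod w + 1 / real (Suc n)" using z by blast
        then show ?case using w(1) elim(1) by simp
      qed
    qed
  qed
qed

lemma tendsto_form:
  assumes "\<And>k. ((\<lambda>n. b n k) \<longlongrightarrow> a k) F"
  shows "((\<lambda>n. form d (b n) x y) \<longlongrightarrow> form d a x y) F"
  unfolding form_def by (intro tendsto_intros assms)

lemma tendsto_antipodal:
  assumes "\<And>k. ((\<lambda>n. b n k) \<longlongrightarrow> a k) F"
  shows "((\<lambda>n. antipodal_coeffs d (b n) k) \<longlongrightarrow> antipodal_coeffs d a k) F"
  unfolding antipodal_coeffs_def by (cases "k \<le> d") (auto intro!: tendsto_intros assms)

text \<open>In the limit 0 is a fixed point. As the fixed point polynomial of the limit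
  does not vanish identically, the bound above forces nearby maps to have a fixed point near 0.\<close>

lemma fixed_point_near_0:
  assumes d: "d \<ge> 2" and a: "a \<in> nonZ d" "a 0 = 0" and b: "\<And>k. (\<lambda>n. b n k) \<longlonglongrightarrow> a k"
  obtains z where "z \<longlonglongrightarrow> 0" "\<forall>\<^sub>F n in sequentially. poly (fixp d (b n)) (z n) = 0"
proof (rule choose_tendsto_0[of "\<lambda>n z. poly (fixp d (b n)) z = 0"])
  fix \<epsilon> :: real assume \<epsilon>: "\<epsilon> > 0"
  obtain z where z: "poly (fixp d a) z \<noteq> 0" using fixp_nonzero[OF d a(1)] poly_all_0_iff_0 by blast
  define K where "K = (1 + cmod z / \<epsilon>) ^ Suc d"
  have lim: "(\<lambda>n. poly (fixp d (b n)) w) \<longlonglongrightarrow> poly (fixp d a) w" for w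
    unfolding poly_fixp by (intro tendsto_intros tendsto_form tendsto_antipodal b)
  have "poly (fixp d a) 0 = 0"
  proof -
    have "poly (vec_poly d a) 0 = coeff (vec_poly d a) 0" by (rule poly_0_coeff_0)
    then show ?thesis using a(2) by (simp add: fixp_def coeff_vec_poly)
  qed
  then have "(\<lambda>n. cmod (poly (fixp d (b n)) 0) * K - cmod (poly (fixp d (b n)) z)) \<longlonglongrightarrow> cmod 0 * K - cmod (poly (fixp d a) z)"
    using lim[of 0] by (intro tendsto_intros lim) simp
  then have "\<forall>\<^sub>F n in sequentially. cmod (poly (fixp d (b n)) 0) * K - cmod (poly (fixp d (b n)) z) < 0"
    using z by (intro order_tendstoD(2)) auto
  then show "\<forall>\<^sub>F n in sequentially. \<exists>z. cmod z < \<epsilon> \<and> poly (fixp d (b n)) z = 0"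
  proof eventually_elim
    case (elim n)
    show ?case
    proof (rule ccontr)
      assume "\<not> ?thesis"
      then have "\<And>w. poly (fixp d (b n)) w = 0 \<Longrightarrow> \<epsilon> \<le> cmod w" by force
      from poly_bound_no_small_roots[where z = z and p = "fixp d (b n)", OF \<epsilon> this]
      have "cmod (poly (fixp d (b n)) z) \<le> cmod (poly (fixp d (b n)) 0) * (1 + cmod z / \<epsilon>) ^ degree (fixp d (b n))" .
      also have "\<dots> \<le> cmod (poly (fixp d (b n)) 0) * K"
        unfolding K_def using degree_fixp[of d "b n"] \<epsilon> by (intro mult_left_mono power_increasing) auto
      finally show False using elim by simp
    qed
  qed
qed (use that in blast)

lemma rotc_0: assumes "a \<in> cvec (Suc d)"
  shows "rotc d \<alpha> \<beta> a 0 = \<alpha> * form d a (- \<beta>) \<alpha> + \<beta> * form d (antipodal_coeffs d a) (- \<beta>) \<alpha>"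
proof -
  have "rotc d \<alpha> \<beta> a 0 = form d (rotc d \<alpha> \<beta> a) 0 1" by (simp only: form_0_1)
  also have "\<dots> = \<alpha> * form d a (- \<beta>) \<alpha> + \<beta> * form d (antipodal_coeffs d a) (- \<beta>) \<alpha>"
    unfolding rotc_def su_def numer_act numer_anti[OF assms] denom_anti by simp
  finally show ?thesis .
qed

text \<open>The stabilizer of the fixed point 0 in \<open>SU(2)\<close> is the diagonal circle, which acts on the \<open>k\<close>-th
  coefficient with weight \<open>d + 1 - 2k\<close>.\<close>

lemma rotc_diag:
  assumes d: "odd d" and a: "a \<in> cvec (Suc d)" and k: "k \<le> d"
  shows "rotc d (cis \<theta>) 0 a k = cis ((real d + 1 - 2 * real k) * \<theta>) * a k"
proof -
  have "rotc d (cis \<theta>) 0 a k = cis \<theta> * (cnj (cis \<theta>) ^ k * cis \<theta> ^ (d - k) * a k)"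
  proof (rule form_inject[OF _ k])
    fix x y
    have fe: "form d a (cnj (cis \<theta>) * x) (cis \<theta> * y) = form d (\<lambda>k. cnj (cis \<theta>) ^ k * cis \<theta> ^ (d - k) * a k) x y"
      unfolding form_def by (rule sum.cong) (auto simp: power_mult_distrib)
    show "form d (rotc d (cis \<theta>) 0 a) x y = form d (\<lambda>k. cis \<theta> * (cnj (cis \<theta>) ^ k * cis \<theta> ^ (d - k) * a k)) x y"
      unfolding form_cmult fe[symmetric] rotc_def su_def numer_act numer_anti[OF a] by simp
  qed
  also have "\<dots> = cis (\<theta> + real k * (- \<theta>) + real (d - k) * \<theta>) * a k"
    by (simp only: cis_cnj Complex.DeMoivre cis_mult mult.assoc[symmetric] add.assoc)
  also have "\<theta> + real k * (- \<theta>) + real (d - k) * \<theta> = (real d + 1 - 2 * real k) * \<theta>"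
    using k by (simp add: of_nat_diff algebra_simps)
  finally show ?thesis .
qed

section \<open>Slices for the conjugation action\<close>

text \<open>Normal forms of antipodal maps modulo conjugation: a fixed point is moved to 0, which leaves a
  circle of rotations and the real scalars, and these are used to normalize one coefficient. The
  two complex conditions reduce the real dimension from \<open>2d + 2\<close> to \<open>2d - 2\<close>.\<close>

definition slice :: "nat \<Rightarrow> nat \<Rightarrow> (nat \<Rightarrow> complex) set" where
  "slice d k = {a \<in> nonZ d. a 0 = 0 \<and> a k = 1}"

text \<open>The weight of the diagonal circle on the \<open>k\<close>-th coefficient; it is nonzero away from the middle
  coefficient, so that there a rotation can remove the argument.\<close>

definition wt :: "nat \<Rightarrow> nat \<Rightarrow> real" where "wt d k = real d + 1 - 2 * real k"

definition to_slice :: "nat \<Rightarrow> nat \<Rightarrow> (nat \<Rightarrow> complex) \<Rightarrow> nat \<Rightarrow> complex" where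
  "to_slice d k b = (\<lambda>j. complex_of_real (1 / cmod (b k)) * rotc d (cis (- Arg (b k) / wt d k)) 0 b j)"

lemma wt_nonzero: "2 * k \<noteq> d + 1 \<Longrightarrow> wt d k \<noteq> 0"
  unfolding wt_def by (metis add.commute eq_iff_diff_eq_0 of_nat_1 of_nat_add of_nat_eq_iff of_nat_mult of_nat_numeral)

lemma unit2_cis: "unit2 (cis \<theta>) 0"
  by (simp add: unit2_def cis_cnj cis_mult)

lemma to_slice_in_slice:
  assumes d: "odd d" and k: "k \<le> d" "2 * k \<noteq> d + 1" and b: "b \<in> nonZ d" "b 0 = 0" "b k \<noteq> 0"
  shows "to_slice d k b \<in> slice d k" "mclass d (anti_join d (to_slice d k b)) = mclass d (anti_join d b)"
proof -
  note d1 = odd_ge_1[OF d]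
  have s: "1 / cmod (b k) \<noteq> 0" using b(3) by simp
  have r: "rotc d (cis (- Arg (b k) / wt d k)) 0 b \<in> nonZ d" by (rule rotc_nonZ[OF d unit2_cis b(1)])
  have bc: "b \<in> cvec (Suc d)" by (rule nonZ_cvec[OF b(1)])
  have "to_slice d k b k = complex_of_real (1 / cmod (b k)) * (cis (- Arg (b k)) * b k)"
    unfolding to_slice_def rotc_diag[OF d bc k(1)] wt_def[symmetric] using wt_nonzero[OF k(2)] by simp
  also have "cis (- Arg (b k)) * b k = cis (- Arg (b k)) * (complex_of_real (cmod (b k)) * cis (Arg (b k)))"
    using rcis_cmod_Arg[of "b k"] by (simp only: rcis_def)
  also have "\<dots> = complex_of_real (cmod (b k))" by (simp add: cis_mult)
  finally have "to_slice d k b k = 1" using b(3) by (simp flip: of_real_mult)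
  moreover have "to_slice d k b 0 = 0"
    unfolding to_slice_def rotc_diag[OF d bc le0] using b(2) by simp
  ultimately show "to_slice d k b \<in> slice d k"
    using nonZ_scale[OF d1 s r] unfolding slice_def to_slice_def by blast
  show "mclass d (anti_join d (to_slice d k b)) = mclass d (anti_join d b)"
    unfolding to_slice_def mclass_scale[OF s] by (rule mclass_rotc[OF d unit2_cis b(1)])
qed

lemma tendsto_to_slice:
  assumes d: "odd d" and a: "a \<in> slice d k" and b: "\<And>j. (\<lambda>n. b n j) \<longlonglongrightarrow> a j" 
  shows "(\<lambda>n. to_slice d k (b n) j) \<longlonglongrightarrow> a j"
proof -
  have ak: "a k = 1" and ac: "a \<in> cvec (Suc d)" using a nonZ_cvec by (auto simp: slice_def)
  have "isCont Arg 1" by (rule continuous_at_Arg) simp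
  then have A: "(\<lambda>n. Arg (b n k)) \<longlonglongrightarrow> Arg 1" using isCont_tendsto_compose[of 1 Arg] b[of k] ak by metis
  have t: "(\<lambda>n. - Arg (b n k) / wt d k) \<longlonglongrightarrow> - Arg 1 / wt d k"
    unfolding divide_inverse by (intro tendsto_intros A)
  have "(\<lambda>n. cis (- Arg (b n k) / wt d k)) \<longlonglongrightarrow> cis (- Arg 1 / wt d k)"
    unfolding cis_conv_exp by (intro tendsto_exp tendsto_mult tendsto_of_real tendsto_const t)
  then have c: "(\<lambda>n. cis (- Arg (b n k) / wt d k)) \<longlonglongrightarrow> 1" by simp
  have "(\<lambda>n. 1 / cmod (b n k)) \<longlonglongrightarrow> 1 / cmod (a k)"
    by (intro tendsto_divide tendsto_norm tendsto_const b) (simp add: ak)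
  then have "(\<lambda>n. to_slice d k (b n) j) \<longlonglongrightarrow> complex_of_real (1 / cmod (a k)) * rotc d 1 0 a j"
    unfolding to_slice_def by (intro tendsto_mult tendsto_of_real tendsto_rotc c tendsto_const b)
  then show ?thesis unfolding rotc_id[OF ac] ak by simp
qed

text \<open>The rotation that takes \<open>z\<close> to 0, with a positive diagonal entry so that it tends to the identity
  as \<open>z\<close> tends to 0.\<close>

definition rot_root :: "nat \<Rightarrow> complex \<Rightarrow> (nat \<Rightarrow> complex) \<Rightarrow> nat \<Rightarrow> complex" where
  "rot_root d z b = (let \<alpha> = complex_of_real (1 / sqrt (1 + cmod z ^ 2)) in rotc d \<alpha> (- (\<alpha> * z)) b)"

lemma unit2_root: "unit2 (complex_of_real (1 / sqrt (1 + cmod z ^ 2))) (- (complex_of_real (1 / sqrt (1 + cmod z ^ 2)) * z))"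
proof -
  define w where "w = 1 / sqrt (1 + cmod z ^ 2)"
  have p: "1 + cmod z ^ 2 > 0" by (simp add: add_pos_nonneg)
  then have w: "w * w * (1 + cmod z ^ 2) = 1" by (simp add: w_def flip: power2_eq_square) (simp add: power_divide)
  have "complex_of_real w * cnj (complex_of_real w) + (- (complex_of_real w * z)) * cnj (- (complex_of_real w * z))
    = complex_of_real w * complex_of_real w * (1 + z * cnj z)" by (simp add: algebra_simps)
  also have "\<dots> = complex_of_real (w * w * (1 + cmod z ^ 2))"
    by (simp only: of_real_mult of_real_add of_real_1 complex_norm_square)
  also have "\<dots> = 1" unfolding w by simp
  finally show ?thesis unfolding unit2_def w_def .
qed

lemma rot_root:
  assumes d: "odd d" and b: "b \<in> nonZ d"
  shows "rot_root d z b \<in> nonZ d" "mclass d (anti_join d (rot_root d z b)) = mclass d (anti_join d b)"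
    "poly (fixp d b) z = 0 \<Longrightarrow> rot_root d z b 0 = 0"
proof -
  define \<alpha> where "\<alpha> = complex_of_real (1 / sqrt (1 + cmod z ^ 2))"
  have rr: "rot_root d z b = rotc d \<alpha> (- (\<alpha> * z)) b" by (simp add: rot_root_def \<alpha>_def Let_def)
  have u: "unit2 \<alpha> (- (\<alpha> * z))" unfolding \<alpha>_def by (rule unit2_root)
  show "rot_root d z b \<in> nonZ d" unfolding rr by (rule rotc_nonZ[OF d u b])
  show "mclass d (anti_join d (rot_root d z b)) = mclass d (anti_join d b)" unfolding rr by (rule mclass_rotc[OF d u b])
  assume z: "poly (fixp d b) z = 0"
  have "form d a (- (- (\<alpha> * z))) \<alpha> = \<alpha> ^ d * form d a z 1" for a
    using form_scale[of d a \<alpha> z 1] by simp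
  then have "rot_root d z b 0 = \<alpha> * (\<alpha> ^ d * form d b z 1) + - (\<alpha> * z) * (\<alpha> ^ d * form d (antipodal_coeffs d b) z 1)"
    unfolding rr rotc_0[OF nonZ_cvec[OF b]] by simp
  also have "\<dots> = - (\<alpha> * \<alpha> ^ d * poly (fixp d b) z)" unfolding poly_fixp by (simp add: algebra_simps)
  finally show "rot_root d z b 0 = 0" unfolding z by simp
qed

lemma tendsto_rot_root:
  assumes z: "z \<longlonglongrightarrow> 0" and b: "\<And>j. (\<lambda>n. b n j) \<longlonglongrightarrow> a j" and a: "a \<in> cvec (Suc d)"
  shows "(\<lambda>n. rot_root d (z n) (b n) j) \<longlonglongrightarrow> a j"
proof -
  have "(\<lambda>n. complex_of_real (1 / sqrt (1 + cmod (z n) ^ 2))) \<longlonglongrightarrow> complex_of_real (1 / sqrt (1 + cmod 0 ^ 2))"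
    by (intro tendsto_intros z) simp
  then have al: "(\<lambda>n. complex_of_real (1 / sqrt (1 + cmod (z n) ^ 2))) \<longlonglongrightarrow> 1" by simp
  then have "(\<lambda>n. - (complex_of_real (1 / sqrt (1 + cmod (z n) ^ 2)) * z n)) \<longlonglongrightarrow> - (1 * 0)"
    by (intro tendsto_minus tendsto_mult z)
  then have "(\<lambda>n. rot_root d (z n) (b n) j) \<longlonglongrightarrow> rotc d 1 0 a j"
    unfolding rot_root_def Let_def using al by (intro tendsto_rotc b) simp_all
  then show ?thesis by (simp only: rotc_id[OF a])
qed

lemma moduli_B1_eq: "odd d \<Longrightarrow> moduli_B1 d = (\<lambda>a. mclass d (anti_join d a)) ` nonZ d"
  unfolding moduli_B1_def B1_eq by (simp add: image_image mclass_def)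

text \<open>Nearby antipodal classes lift to nearby parameters up to \<open>SU(2)\<close>. Such a parameter has a fixed
  point near 0; rotating it to 0 and normalizing the \<open>k\<close>-th coefficient, which is close to 1, are
  both small changes, so the lift ends up in the slice near \<open>a\<close>.\<close>

lemma slice_open_map:
  assumes d: "d \<ge> 3" "odd d" and k: "k \<le> d" "2 * k \<noteq> d + 1"
  shows "open_map (top_of_set (slice d k)) (subtopology (moduli_space d) (moduli_B1 d))
     (\<lambda>a. mclass d (anti_join d a))"
proof (rule open_map_by_sequences[where N = "nondeg_vecs d" and \<pi> = "mclass d"])
  note d1 = odd_ge_1[OF d(2)]
  show "open_map (top_of_set (nondeg_vecs d)) (moduli_space d) (mclass d)"
    using mclass_quotient(1)[OF d1] by (simp add: Nspace_def)
  show "mclass d ` nondeg_vecs d \<subseteq> topspace (moduli_space d)"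
    using quotient_imp_surjective_map[OF mclass_quotient(2)[OF d1]] by simp
  show "anti_join d ` slice d k \<subseteq> nondeg_vecs d" using nonZ_anti[OF d1] by (auto simp: slice_def)
  show "mclass d ` anti_join d ` slice d k \<subseteq> moduli_B1 d" unfolding moduli_B1_eq[OF d(2)] by (auto simp: slice_def)
  fix a c
  assume a: "a \<in> slice d k" and cl: "c \<longlonglongrightarrow> anti_join d a" and c: "\<And>n. c n \<in> nondeg_vecs d" "\<And>n. mclass d (c n) \<in> moduli_B1 d"
  have a': "a \<in> nonZ d" "a 0 = 0" "a k = 1" "a \<in> cvec (Suc d)" using a nonZ_cvec by (auto simp: slice_def)
  have cl': "(\<lambda>n. c n i) \<longlonglongrightarrow> anti_join d a i" for i using cl by (simp add: tendsto_fun_iff)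
  have "\<forall>n. \<exists>\<beta>. \<beta> \<in> nonZ d \<and> mclass d (c n) = mclass d (anti_join d \<beta>)"
    using c(2) unfolding moduli_B1_eq[OF d(2)] by blast
  then obtain \<beta> where \<beta>: "\<And>n. \<beta> n \<in> nonZ d" "\<And>n. mclass d (c n) = mclass d (anti_join d (\<beta> n))" by metis
  obtain r b where b: "\<And>n. b n \<in> nonZ d" "\<And>i. (\<lambda>n. b n i) \<longlonglongrightarrow> a i"
    "\<And>n. mclass d (anti_join d (b n)) = mclass d (c (r n))"
    using su2_normal_sequence[OF d a'(1), of c \<beta>] c(1) cl' \<beta> by metis
  have d2: "d \<ge> 2" using d by simp
  obtain z where z: "z \<longlonglongrightarrow> 0" "\<forall>\<^sub>F n in sequentially. poly (fixp d (b n)) (z n) = 0"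
    by (rule fixed_point_near_0[OF d2 a'(1,2) b(2)])
  define b1 where "b1 n = rot_root d (z n) (b n)" for n
  have b1: "b1 n \<in> nonZ d" "mclass d (anti_join d (b1 n)) = mclass d (anti_join d (b n))" for n
    unfolding b1_def using rot_root[OF d(2) b(1)] by blast+
  have b1l: "(\<lambda>n. b1 n j) \<longlonglongrightarrow> a j" for j unfolding b1_def by (rule tendsto_rot_root[OF z(1) b(2) a'(4)])
  have b10: "\<forall>\<^sub>F n in sequentially. b1 n 0 = 0"
    using z(2) by (rule eventually_mono) (simp add: b1_def rot_root(3)[OF d(2) b(1)])
  have "\<forall>\<^sub>F n in sequentially. b1 n k \<noteq> 0"
    by (rule tendsto_imp_eventually_ne[OF b1l]) (simp add: a'(3))
  with b10 have "\<forall>\<^sub>F n in sequentially. b1 n 0 = 0 \<and> b1 n k \<noteq> 0" by (rule eventually_conj)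
  then obtain m where m: "\<And>n. n \<ge> m \<Longrightarrow> b1 n 0 = 0 \<and> b1 n k \<noteq> 0" unfolding eventually_sequentially by blast
  define b2 where "b2 n = to_slice d k (b1 (n + m))" for n
  have "b2 n \<in> slice d k" "mclass d (anti_join d (b2 n)) = mclass d (c (r (n + m)))" for n
    unfolding b2_def using to_slice_in_slice[OF d(2) k b1(1)[of "n + m"]] m[of "n + m"] b1(2) b(3) by auto
  moreover have "b2 \<longlonglongrightarrow> a"
    unfolding tendsto_fun_iff b2_def
    by (intro allI tendsto_to_slice[OF d(2) a] LIMSEQ_ignore_initial_segment b1l)
  ultimately show "\<exists>r b. (\<forall>n. b n \<in> slice d k) \<and> b \<longlonglongrightarrow> a \<and> (\<forall>n. mclass d (anti_join d (b n)) = mclass d (c (r n)))"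
    by (intro exI[of _ "\<lambda>n. r (n + m)"] exI[of _ b2]) blast
qed

lemma moduli_B1_continuous:
  assumes d: "odd d"
  shows "continuous_map (top_of_set (nonZ d)) (subtopology (moduli_space d) (moduli_B1 d)) (\<lambda>a. mclass d (anti_join d a))"
proof -
  note d1 = odd_ge_1[OF d]
  have "continuous_map (top_of_set (nonZ d)) (Nspace d) (anti_join d)"
    unfolding Nspace_def continuous_map_subtopology_eu using continuous_on_anti_join nonZ_anti[OF d1] by auto
  from continuous_map_compose[OF this quotient_imp_continuous_map[OF mclass_quotient(2)[OF d1]]]
  show ?thesis unfolding continuous_map_in_subtopology moduli_B1_eq[OF d] by (simp add: comp_def)
qed

text \<open>A map without a fixed point in the plane would fix infinity, and then also 0, the antipode of
  infinity. So there is a fixed point in the plane, which is rotated to 0, and by nondegeneracy some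
  coefficient other than the middle one is left to be normalized.\<close>

lemma slice_cover:
  assumes d: "d \<ge> 3" "odd d" and \<phi>: "\<phi> \<in> moduli_B1 d"
  obtains k a where "k \<le> d" "k \<noteq> 0" "2 * k \<noteq> d + 1" "a \<in> slice d k" "\<phi> = mclass d (anti_join d a)"
proof -
  note d1 = odd_ge_1[OF d(2)]
  obtain b where b: "b \<in> nonZ d" "\<phi> = mclass d (anti_join d b)" using \<phi> unfolding moduli_B1_eq[OF d(2)] by blast
  have "\<exists>b1. b1 \<in> nonZ d \<and> \<phi> = mclass d (anti_join d b1) \<and> b1 0 = 0"
  proof (cases "\<exists>z. poly (fixp d b) z = 0")
    case True
    then show ?thesis using rot_root[OF d(2) b(1)] b(2) by metis
  next
    case False
    then have "degree (fixp d b) = 0" using fundamental_theorem_of_algebra constant_degree by blast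
    then have "coeff (fixp d b) (Suc d) = 0" by (simp add: coeff_eq_0)
    then have "antipodal_coeffs d b d = 0" by (simp add: fixp_def coeff_vec_poly)
    then have "b 0 = 0" by (simp add: antipodal_coeffs_def)
    then show ?thesis using b by blast
  qed
  then obtain b1 where b1: "b1 \<in> nonZ d" "\<phi> = mclass d (anti_join d b1)" "b1 0 = 0" by blast
  have nd: "nondeg d (anti_join d b1)" using b1(1) nonZ_iff[OF d1] by blast
  note cv = nonZ_cvec[OF b1(1)]
  obtain k where k: "k \<le> d" "2 * k \<noteq> d + 1" "numer d (anti_join d b1) k \<noteq> 0"
    using nonmiddle_coefficient[OF d nd] anti_norms[OF _ cv] by metis
  then have bk: "b1 k \<noteq> 0" unfolding numer_anti[OF cv] by simp
  then have "k \<noteq> 0" using b1(3) by metis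
  then show thesis using that[OF k(1) _ k(2)] to_slice_in_slice[OF d(2) k(1,2) b1(1,3) bk] b1(2) by metis
qed

section \<open>Fibres of the slices\<close>

text \<open>The properness lemma for constant sequences forces the diagonal factor of a conjugation between
  antipodal maps to be trivial. Conjugate antipodal maps are thus conjugate under \<open>SU(2)\<close>.\<close>

lemma mclass_eq_rotc:
  assumes d: "d \<ge> 3" "odd d" and ab: "a \<in> nonZ d" "b \<in> nonZ d" and eq: "mclass d (anti_join d a) = mclass d (anti_join d b)"
  obtains \<alpha> \<beta> \<rho> where "unit2 \<alpha> \<beta>" "\<rho> \<noteq> (0::real)" "b = (\<lambda>k. complex_of_real \<rho> * rotc d \<alpha> \<beta> a k)"
proof -
  note d1 = odd_ge_1[OF d(2)]
  note ca = nonZ_cvec[OF ab(1)] and cb = nonZ_cvec[OF ab(2)]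
  let ?D = "\<lambda>t. act d (complex_of_real t) 0 0 (complex_of_real (1 / t))"
  obtain p q u v t s where *: "unit2 p q" "unit2 u v" "t > (0::real)" "s \<noteq> 0"
    "?D t (su d p q (anti_join d a)) = (\<lambda>i. s * anti_join d (rotc d u v b) i)"
    using mclass_nonZ_eqD[OF d(2) nonZ_anti[OF d1 ab(1)] ab(2) eq] by blast
  have pa: "rotc d p q a \<in> nonZ d" by (rule rotc_nonZ[OF d(2) *(1) ab(1)])
  have "(\<lambda>n::nat. t) \<longlonglongrightarrow> 1"
  proof (rule diag_tendsto_1[OF d, of "anti_join d (rotc d p q a)" "\<lambda>_. anti_join d (rotc d p q a)" _ "\<lambda>_. rotc d u v b" "\<lambda>_. s"])
    show "nondeg d (anti_join d (rotc d p q a))" using pa nonZ_iff[OF d1] by blast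
    show "cmod (denom d (anti_join d (rotc d p q a)) (d - k)) = cmod (numer d (anti_join d (rotc d p q a)) k)"
      if "k \<le> d" for k by (rule anti_norms[OF that rotc_cvec])
    show "?D t (anti_join d (rotc d p q a)) = (\<lambda>i. s * anti_join d (rotc d u v b) i)"
      unfolding anti_rotc[OF d(2) ca] by (rule *(5))
  qed (use *(3) rotc_cvec in auto)
  then have t: "t = 1" by (simp add: LIMSEQ_const_iff)
  have e: "su d p q (anti_join d a) = (\<lambda>i. s * su d u v (anti_join d b) i)"
    using *(5) act_id[OF anti_cvec, of d "rotc d p q a"] unfolding t anti_rotc[OF d(2) ca] anti_rotc[OF d(2) cb] by simp
  define \<alpha> \<beta> where \<alpha>\<beta>: "\<alpha> = cnj u * p - (- v) * cnj q" "\<beta> = cnj u * q + (- v) * cnj p"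
  have u: "unit2 \<alpha> \<beta>" unfolding \<alpha>\<beta> by (rule unit2_mult[OF unit2_inv[OF *(2)] *(1)])
  have "anti_join d (rotc d \<alpha> \<beta> a) = su d (cnj u) (- v) (su d p q (anti_join d a))"
    unfolding anti_rotc[OF d(2) ca] \<alpha>\<beta> su_su ..
  also have "\<dots> = (\<lambda>i. s * su d (cnj u) (- v) (su d u v (anti_join d b)) i)"
    unfolding e unfolding su_def act_mult ..
  also have "\<dots> = (\<lambda>i. s * anti_join d b i)" unfolding su_inv[OF *(2) anti_cvec] ..
  finally obtain \<rho> where \<rho>: "s = complex_of_real \<rho>" "rotc d \<alpha> \<beta> a = (\<lambda>k. complex_of_real \<rho> * b k)"
    using anti_inject[OF d1 cb rotc_cvec nonZ_nonzero[OF d1 ab(2)]] by metis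
  have "\<rho> \<noteq> 0" using \<rho>(1) *(4) by auto
  then have "b = (\<lambda>k. complex_of_real (1 / \<rho>) * rotc d \<alpha> \<beta> a k)" "1 / \<rho> \<noteq> 0" unfolding \<rho>(2) by auto
  then show thesis using that u by blast
qed

text \<open>Two rotations that take the same point to 0 differ by an element of the diagonal circle.\<close>

lemma same_line_rotation:
  assumes u: "unit2 \<alpha> \<beta>" "unit2 \<alpha>' \<beta>'" and eq: "pt (- \<beta>) \<alpha> = pt (- \<beta>') \<alpha>'"
  obtains \<omega> where "cmod \<omega> = 1" "\<alpha>' = \<omega> * \<alpha>" "\<beta>' = \<omega> * \<beta>"
proof -
  have nz: "(- \<beta>, \<alpha>) \<noteq> (0, 0)" "(- \<beta>', \<alpha>') \<noteq> (0, 0)" using u by (auto simp: unit2_def)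
  have e: "\<beta> * \<alpha>' = \<beta>' * \<alpha>" using eq pt_eq_iff[OF nz] by simp
  define \<omega> where "\<omega> = \<alpha>' * cnj \<alpha> + \<beta>' * cnj \<beta>"
  have "\<omega> * \<alpha> = \<alpha>' * (\<alpha> * cnj \<alpha>) + (\<beta>' * \<alpha>) * cnj \<beta>" by (simp add: \<omega>_def algebra_simps)
  also have "\<dots> = \<alpha>' * (\<alpha> * cnj \<alpha> + \<beta> * cnj \<beta>)" unfolding e[symmetric] by (simp add: algebra_simps)
  finally have 1: "\<alpha>' = \<omega> * \<alpha>" using u(1) by (simp add: unit2_def)
  have "\<omega> * \<beta> = (\<beta> * \<alpha>') * cnj \<alpha> + \<beta>' * (\<beta> * cnj \<beta>)" by (simp add: \<omega>_def algebra_simps)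
  also have "\<dots> = \<beta>' * (\<alpha> * cnj \<alpha> + \<beta> * cnj \<beta>)" unfolding e by (simp add: algebra_simps)
  finally have 2: "\<beta>' = \<omega> * \<beta>" using u(1) by (simp add: unit2_def)
  have "\<omega> * cnj \<omega> * (\<alpha> * cnj \<alpha> + \<beta> * cnj \<beta>) = 1"
    using u(2) unfolding 1 2 unit2_def by (simp add: algebra_simps)
  then have "\<omega> * cnj \<omega> = 1" using u(1) by (simp add: unit2_def)
  then have "complex_of_real ((cmod \<omega>) ^ 2) = 1" by (simp only: complex_norm_square)
  then have "cmod \<omega> ^ 2 = 1" using of_real_eq_1_iff by blast
  then have "cmod \<omega> = 1" using norm_ge_zero[of \<omega>] by (auto simp: power2_eq_1_iff simp del: norm_ge_zero)
  then show thesis using that 1 2 by blast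
qed

text \<open>A rotation between two elements of the slice is determined up to the diagonal circle by the point
  it takes to 0, which is infinity or one of at most \<open>d + 1\<close> fixed points of \<open>a\<close> in the plane. Rotations by \<open>\<omega>\<close> in the circle
  that preserve the normalization of the \<open>k\<close>-th coefficient up to a sign satisfy \<open>\<omega> ^ (2 m) = 1\<close>,
  where \<open>m \<le> d + 1\<close> is the absolute value of the weight. A real scalar that keeps the modulus of this
  coefficient is 1 or \<open>- 1\<close>.\<close>

lemma slice_fibre:
  assumes d: "d \<ge> 3" "odd d" and k: "k \<le> d" "2 * k \<noteq> d + 1" and a: "a \<in> slice d k"
  defines "Fib \<equiv> {b \<in> slice d k. mclass d (anti_join d b) = mclass d (anti_join d a)}"
  shows "finite Fib \<and> card Fib \<le> (d + 2) * ((2 * d + 2) * 2)"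
proof -
  note d1 = odd_ge_1[OF d(2)]
  have aZ: "a \<in> nonZ d" and ac: "a \<in> cvec (Suc d)" using a nonZ_cvec by (auto simp: slice_def)
  have d2: "d \<ge> 2" using d by simp
  define R where "R = insert Infty (Fin ` {z. poly (fixp d a) z = 0})"
  have finR0: "finite {z. poly (fixp d a) z = 0}" by (rule poly_roots_finite[OF fixp_nonzero[OF d2 aZ]])
  have "card {z. poly (fixp d a) z = 0} \<le> d + 1"
    using card_poly_roots_bound[OF fixp_nonzero[OF d2 aZ]] degree_fixp[of d a] by simp
  then have R: "finite R" "card R \<le> d + 2"
    using finR0 card_image_le[OF finR0, of Fin] by (auto simp: R_def card_insert_if)
  define m where "m = nat \<bar>int d + 1 - 2 * int k\<bar>"
  have m: "m > 0" "m \<le> d + 1" using k by (auto simp: m_def)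
  have mw: "real m = \<bar>wt d k\<bar>" by (simp add: m_def wt_def)
  define \<Omega> where "\<Omega> = {z::complex. z ^ (2 * m) = 1}"
  have \<Omega>: "finite \<Omega>" "card \<Omega> \<le> 2 * d + 2"
    using card_roots_unity_eq[of "2 * m"] finite_roots_unity[of "2 * m"] m by (auto simp: \<Omega>_def)
  have "\<forall>b\<in>Fib. \<exists>\<alpha> \<beta> \<rho>. unit2 \<alpha> \<beta> \<and> \<rho> \<noteq> (0::real) \<and> b = (\<lambda>k. complex_of_real \<rho> * rotc d \<alpha> \<beta> a k)"
  proof
    fix b assume "b \<in> Fib"
    then have b: "b \<in> nonZ d" "mclass d (anti_join d a) = mclass d (anti_join d b)" by (auto simp: Fib_def slice_def)
    show "\<exists>\<alpha> \<beta> \<rho>. unit2 \<alpha> \<beta> \<and> \<rho> \<noteq> (0::real) \<and> b = (\<lambda>k. complex_of_real \<rho> * rotc d \<alpha> \<beta> a k)"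
      by (rule mclass_eq_rotc[OF d aZ b]) blast
  qed
  then obtain A B \<rho> where AB: "\<And>b. b \<in> Fib \<Longrightarrow> unit2 (A b) (B b)" "\<And>b. b \<in> Fib \<Longrightarrow> \<rho> b \<noteq> (0::real)"
    "\<And>b. b \<in> Fib \<Longrightarrow> b = (\<lambda>k. complex_of_real (\<rho> b) * rotc d (A b) (B b) a k)" by metis
  define root where "root b = pt (- B b) (A b)" for b
  have rootR: "root b \<in> R" if b: "b \<in> Fib" for b
  proof (cases "A b = 0")
    case True then show ?thesis by (simp add: root_def pt_def R_def)
  next
    case False
    define z where "z = - B b / A b"
    have zB: "A b * z = - B b" using False by (simp add: z_def)
    have "b 0 = 0" using b by (simp add: Fib_def slice_def)
    then have "rotc d (A b) (B b) a 0 = 0" using fun_cong[OF AB(3)[OF b], of 0] AB(2)[OF b] by simp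
    then have 0: "A b * form d a (- B b) (A b) + B b * form d (antipodal_coeffs d a) (- B b) (A b) = 0"
      unfolding rotc_0[OF ac] .
    have f: "form d c (- B b) (A b) = A b ^ d * form d c z 1" for c
      using form_scale[of d c "A b" z 1] zB by simp
    have "B b = - (A b * z)" using zB by simp
    then have "A b * (A b ^ d * form d a z 1) + - (A b * z) * (A b ^ d * form d (antipodal_coeffs d a) z 1) = 0"
      using 0 unfolding f by metis
    moreover have "A b * A b ^ d * poly (fixp d a) z =
       - (A b * (A b ^ d * form d a z 1) + - (A b * z) * (A b ^ d * form d (antipodal_coeffs d a) z 1))"
      unfolding poly_fixp by (simp add: algebra_simps)
    ultimately have "A b * A b ^ d * poly (fixp d a) z = 0" by (simp only: minus_zero)
    then have "poly (fixp d a) z = 0" using False by simp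
    then show ?thesis using False by (simp add: root_def pt_def R_def z_def)
  qed
  \<comment> \<open>One representative for every fixed point; the rest of the fibre over that fixed point is obtained
    from it by the diagonal circle and signs.\<close>
  define rep where "rep w = (SOME b. b \<in> Fib \<and> root b = w)" for w
  define \<Phi> where "\<Phi> = (\<lambda>(w, \<omega>, \<sigma>). (\<lambda>j. if j \<le> d then complex_of_real \<sigma> * (cis (wt d j * Arg \<omega>) * rep w j) else 0))"
  have sub: "Fib \<subseteq> \<Phi> ` (R \<times> \<Omega> \<times> {1, - 1})"
  proof
    fix b assume b: "b \<in> Fib"
    define b0 where "b0 = rep (root b)"
    have b0: "b0 \<in> Fib" "root b0 = root b"
      unfolding b0_def rep_def using someI[of "\<lambda>c. c \<in> Fib \<and> root c = root b" b] b by auto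
    obtain \<omega> where \<omega>: "cmod \<omega> = 1" "A b = \<omega> * A b0" "B b = \<omega> * B b0"
      by (rule same_line_rotation[OF AB(1)[OF b0(1)] AB(1)[OF b] b0(2)[unfolded root_def]])
    define \<theta> where "\<theta> = Arg \<omega>"
    have \<omega>c: "\<omega> = cis \<theta>" using rcis_cmod_Arg[of \<omega>] \<omega>(1) by (simp add: rcis_def \<theta>_def)
    have rot: "rotc d (A b) (B b) a = rotc d (cis \<theta>) 0 (rotc d (A b0) (B b0) a)"
    proof -
      have "su d (cis \<theta>) 0 (su d (A b0) (B b0) (anti_join d a)) = su d (A b) (B b) (anti_join d a)"
        unfolding su_su \<omega>(2,3) \<omega>c by simp
      then show ?thesis unfolding rotc_def[of d "cis \<theta>"] anti_rotc[OF d(2) ac] by (simp add: rotc_def)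
    qed
    define \<sigma> where "\<sigma> = \<rho> b / \<rho> b0"
    have bj: "b j = complex_of_real \<sigma> * (cis (wt d j * \<theta>) * b0 j)" if "j \<le> d" for j
    proof -
      have "b j = complex_of_real (\<rho> b) * rotc d (A b) (B b) a j" by (rule fun_cong[OF AB(3)[OF b]])
      also have "\<dots> = complex_of_real (\<rho> b) * (cis (wt d j * \<theta>) * rotc d (A b0) (B b0) a j)"
        unfolding rot rotc_diag[OF d(2) rotc_cvec that] wt_def ..
      also have "rotc d (A b0) (B b0) a j = b0 j / complex_of_real (\<rho> b0)"
      proof -
        have "b0 j = complex_of_real (\<rho> b0) * rotc d (A b0) (B b0) a j" by (rule fun_cong[OF AB(3)[OF b0(1)]])
        moreover have "complex_of_real (\<rho> b0) \<noteq> 0" using AB(2)[OF b0(1)] by simp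
        ultimately show ?thesis by (metis nonzero_mult_div_cancel_left)
      qed
      finally show ?thesis by (simp add: \<sigma>_def)
    qed
    have kk: "b k = 1" "b0 k = 1" using b b0(1) by (auto simp: Fib_def slice_def)
    have 1: "1 = complex_of_real \<sigma> * cis (wt d k * \<theta>)" using bj[OF k(1)] kk by simp
    have "1 = \<bar>\<sigma>\<bar>" using arg_cong[OF 1, of cmod] by (simp add: norm_mult)
    then have \<sigma>: "\<sigma> = 1 \<or> \<sigma> = - 1" by linarith
    then have ss: "complex_of_real \<sigma> * complex_of_real \<sigma> = 1" by auto
    have "cis (wt d k * \<theta>) * cis (wt d k * \<theta>) = 1"
    proof -
      have "1 = (complex_of_real \<sigma> * cis (wt d k * \<theta>)) * (complex_of_real \<sigma> * cis (wt d k * \<theta>))"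
        unfolding 1[symmetric] by simp
      also have "\<dots> = (complex_of_real \<sigma> * complex_of_real \<sigma>) * (cis (wt d k * \<theta>) * cis (wt d k * \<theta>))" by (simp add: mult_ac)
      finally show ?thesis unfolding ss by simp
    qed
    then have c2: "cis (2 * (wt d k * \<theta>)) = 1" by (simp only: cis_mult mult_2)
    have "\<omega> ^ (2 * m) = cis (2 * (\<bar>wt d k\<bar> * \<theta>))" unfolding \<omega>c Complex.DeMoivre using mw by (simp add: mult.assoc)
    also have "\<dots> = 1"
    proof (cases "wt d k \<ge> 0")
      case True then show ?thesis using c2 by simp
    next
      case False
      then have "cis (2 * (\<bar>wt d k\<bar> * \<theta>)) = cnj (cis (2 * (wt d k * \<theta>)))" by (simp add: cis_cnj)
      then show ?thesis unfolding c2 by simp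
    qed
    finally have "\<omega> \<in> \<Omega>" by (simp add: \<Omega>_def)
    moreover have "b = \<Phi> (root b, \<omega>, \<sigma>)"
    proof
      fix j
      have "b \<in> cvec (Suc d)" using b nonZ_cvec by (auto simp: Fib_def slice_def)
      then have "b j = (if j \<le> d then complex_of_real \<sigma> * (cis (wt d j * \<theta>) * b0 j) else 0)"
        using bj[of j] by (simp add: cvec_def)
      then show "b j = \<Phi> (root b, \<omega>, \<sigma>) j"
        unfolding \<Phi>_def prod.case b0_def \<theta>_def .
    qed
    ultimately show "b \<in> \<Phi> ` (R \<times> \<Omega> \<times> {1, - 1})"
      using rootR[OF b] \<sigma> by (intro image_eqI[of _ _ "(root b, \<omega>, \<sigma>)"]) auto
  qed
  have fin: "finite (R \<times> \<Omega> \<times> {1, - 1 :: real})" using R \<Omega> by simp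
  have "card (R \<times> \<Omega> \<times> {1, - 1 :: real}) \<le> (d + 2) * ((2 * d + 2) * 2)"
    unfolding card_cartesian_product using R \<Omega> by (intro mult_mono) auto
  then show ?thesis
    using surj_card_le[OF fin sub] finite_subset[OF sub finite_imageI[OF fin]] by simp
qed

section \<open>Dimension through open maps with bounded fibres\<close>

lemma disjoint_open_neighbourhoods:
  assumes X: "Hausdorff_space X" and F: "finite F" "F \<subseteq> topspace X"
  shows "\<exists>W. (\<forall>y\<in>F. openin X (W y) \<and> y \<in> W y) \<and> (\<forall>y\<in>F. \<forall>z\<in>F. y \<noteq> z \<longrightarrow> W y \<inter> W z = {})"
proof -
  have "\<forall>y z. \<exists>U V. y \<in> F \<longrightarrow> z \<in> F \<longrightarrow> y \<noteq> z \<longrightarrow>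
      openin X U \<and> openin X V \<and> y \<in> U \<and> z \<in> V \<and> disjnt U V"
    using X F(2) unfolding Hausdorff_space_def by (meson subsetD)
  then obtain U V where UV: "\<And>y z. y \<in> F \<Longrightarrow> z \<in> F \<Longrightarrow> y \<noteq> z \<Longrightarrow>
      openin X (U y z) \<and> openin X (V y z) \<and> y \<in> U y z \<and> z \<in> V y z \<and> disjnt (U y z) (V y z)"
    by metis
  define W where "W y = topspace X \<inter> (\<Inter>z\<in>F - {y}. U y z \<inter> V z y)" for y
  have "openin X (W y)" if y: "y \<in> F" for y
  proof (cases "F - {y} = {}")
    case True
    show ?thesis unfolding W_def True by simp
  next
    case False
    then have "openin X (\<Inter>z\<in>F - {y}. U y z \<inter> V z y)"
      using UV y F(1) by (intro openin_INT2) (auto intro!: openin_Int)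
    then show ?thesis unfolding W_def by (intro openin_Int openin_topspace)
  qed
  moreover have "y \<in> W y" if "y \<in> F" for y using UV that F(2) by (auto simp: W_def)
  moreover have "W y \<inter> W z = {}" if "y \<in> F" "z \<in> F" "y \<noteq> z" for y z
  proof -
    have "W y \<subseteq> U y z" "W z \<subseteq> V y z" using that by (auto simp: W_def)
    then show ?thesis using UV[OF that] by (auto simp: disjnt_def)
  qed
  ultimately show ?thesis by blast
qed

text \<open>At a point \<open>x0\<close> with a largest possible fibre take disjoint neighbourhoods of the points of that
  fibre. Every nearby fibre meets all of them, as the map is open, so it meets each exactly once. The
  slices of the moduli space are not local sections at every point, because of maps with
  automorphisms; this lemma avoids any analysis of the latter.\<close>

lemma open_map_injective_part:
  assumes q: "open_map X Y q" "continuous_map X Y q" and X: "Hausdorff_space X" and ne: "topspace X \<noteq> {}"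
    and fib: "\<And>x. x \<in> topspace X \<Longrightarrow> finite {y \<in> topspace X. q y = q x} \<and> card {y \<in> topspace X. q y = q x} \<le> N"
  obtains W where "openin X W" "W \<noteq> {}" "inj_on q W"
proof -
  define c where "c x = card {y \<in> topspace X. q y = q x}" for x
  obtain x where "x \<in> topspace X" using ne by blast
  then have "c x \<in> c ` topspace X" by (rule imageI)
  moreover have "\<forall>m. m \<in> c ` topspace X \<longrightarrow> m \<le> N" using fib by (auto simp: c_def)
  ultimately have "\<exists>k. k \<in> c ` topspace X \<and> (\<forall>m. m \<in> c ` topspace X \<longrightarrow> m \<le> k)"
    by (rule Nat.ex_has_greatest_nat[of "\<lambda>m. m \<in> c ` topspace X"])
  then obtain x0 where x0: "x0 \<in> topspace X" "\<And>y. y \<in> topspace X \<Longrightarrow> c y \<le> c x0"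
    by blast
  define F where "F = {y \<in> topspace X. q y = q x0}"
  have F: "finite F" "F \<subseteq> topspace X" "x0 \<in> F" using fib[OF x0(1)] x0(1) by (auto simp: F_def)
  obtain W where W: "\<And>y. y \<in> F \<Longrightarrow> openin X (W y)" "\<And>y. y \<in> F \<Longrightarrow> y \<in> W y"
    "\<And>y z. y \<in> F \<Longrightarrow> z \<in> F \<Longrightarrow> y \<noteq> z \<Longrightarrow> W y \<inter> W z = {}"
    using disjoint_open_neighbourhoods[OF X F(1,2)] by metis
  define O' where "O' = (\<Inter>y\<in>F. q ` W y)"
  have O: "openin Y O'" unfolding O'_def
    using F W(1) q(1) by (intro openin_INT2) (auto simp: open_map_def)
  define W0 where "W0 = W x0 \<inter> {x \<in> topspace X. q x \<in> O'}"
  have W0: "openin X W0" unfolding W0_def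
    using W(1)[OF F(3)] openin_continuous_map_preimage[OF q(2) O] by (rule openin_Int)
  have "q x0 \<in> q ` W y" if "y \<in> F" for y
    using W(2)[OF that] that unfolding F_def by (intro image_eqI[of _ _ y]) auto
  then have "q x0 \<in> O'" unfolding O'_def by blast
  then have "x0 \<in> W0" using W(2)[OF F(3)] x0(1) by (simp add: W0_def)
  moreover have "inj_on q W0"
  proof (rule inj_onI, rule ccontr)
    fix u v assume uv: "u \<in> W0" "v \<in> W0" "q u = q v" "u \<noteq> v"
    have ut: "u \<in> topspace X" "v \<in> topspace X" using uv by (auto simp: W0_def)
    have "\<forall>y\<in>F. \<exists>w. w \<in> W y \<and> q w = q u" using uv(1) unfolding W0_def O'_def by force
    then obtain w where w: "\<And>y. y \<in> F \<Longrightarrow> w y \<in> W y \<and> q (w y) = q u" by metis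
    define h where "h y = (if y = x0 then u else w y)" for y
    have h: "h y \<in> W y" "q (h y) = q u" if "y \<in> F" for y
      using w[OF that] uv(1) by (auto simp: h_def W0_def)
    have inj: "inj_on h F"
    proof (rule inj_onI, rule ccontr)
      fix y z assume yz: "y \<in> F" "z \<in> F" "h y = h z" "y \<noteq> z"
      then show False using h(1)[OF yz(1)] h(1)[OF yz(2)] W(3)[OF yz(1,2,4)] by auto
    qed
    have "v \<notin> h ` F"
    proof
      assume "v \<in> h ` F"
      then obtain y where y: "y \<in> F" "v = h y" by blast
      have "v \<in> W x0" using uv(2) by (simp add: W0_def)
      then have "y = x0" using W(3)[OF F(3) y(1)] h(1)[OF y(1)] y(2) by auto
      then show False using y(2) uv(4) by (simp add: h_def)
    qed
    then have "card (insert v (h ` F)) = Suc (card F)" using F(1) card_image[OF inj] by simp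
    moreover have "insert v (h ` F) \<subseteq> {y \<in> topspace X. q y = q u}"
      using h W(1) ut uv(3) openin_subset by fastforce
    then have "card (insert v (h ` F)) \<le> c u"
      unfolding c_def using fib[OF ut(1)] by (intro card_mono) auto
    ultimately have "Suc (c x0) \<le> c u" by (simp add: c_def F_def)
    then show False using x0(2)[OF ut(1)] by simp
  qed
  ultimately show thesis using that W0 by blast
qed

lemma Euclidean_space_eq: "Euclidean_space n = top_of_set {x. \<forall>i\<ge>n. x i = 0}"
  by (simp add: Euclidean_space_def euclidean_product_topology)

lemma Euclidean_cube:
  assumes U: "openin (Euclidean_space n) U" and x: "x \<in> U"
  obtains r where "r > 0" "\<And>y. y \<in> topspace (Euclidean_space n) \<Longrightarrow> (\<forall>i<n. \<bar>y i - x i\<bar> < r) \<Longrightarrow> y \<in> U"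
proof (rule ccontr)
  assume no: "\<not> thesis"
  obtain T where T: "open T" "U = {x. \<forall>i\<ge>n. x i = 0} \<inter> T"
    using U unfolding Euclidean_space_eq by (auto simp: openin_open)
  have "\<forall>m. \<exists>y. y \<in> topspace (Euclidean_space n) \<and> (\<forall>i<n. \<bar>y i - x i\<bar> < 1 / real (Suc m)) \<and> y \<notin> U"
  proof (rule allI, rule ccontr)
    fix m
    assume "\<not> (\<exists>y. y \<in> topspace (Euclidean_space n) \<and> (\<forall>i<n. \<bar>y i - x i\<bar> < 1 / real (Suc m)) \<and> y \<notin> U)"
    then have *: "\<And>y. y \<in> topspace (Euclidean_space n) \<Longrightarrow> (\<forall>i<n. \<bar>y i - x i\<bar> < 1 / real (Suc m)) \<Longrightarrow> y \<in> U"
      by blast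
    have "0 < real (Suc m)" by (rule of_nat_0_less_iff[THEN iffD2, OF zero_less_Suc])
    then have "0 < 1 / real (Suc m)" by simp
    then have thesis using * by (rule that)
    then show False using no by simp
  qed
  then obtain y where y: "\<And>m. y m \<in> topspace (Euclidean_space n)"
    "\<And>m i. i < n \<Longrightarrow> \<bar>y m i - x i\<bar> < 1 / real (Suc m)" "\<And>m. y m \<notin> U" by metis
  have "(\<lambda>m. y m i) \<longlonglongrightarrow> x i" for i
  proof (cases "i < n")
    case True
    have "(\<lambda>m. y m i - x i) \<longlonglongrightarrow> 0"
    proof (rule Lim_null_comparison)
      show "\<forall>\<^sub>F m in sequentially. norm (y m i - x i) \<le> 1 / real (Suc m)"
        using y(2)[OF True] by (intro always_eventually allI) (simp add: less_imp_le)
      show "(\<lambda>m. 1 / real (Suc m)) \<longlonglongrightarrow> 0" using LIMSEQ_inverse_real_of_nat by (simp add: inverse_eq_divide)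
    qed
    then show ?thesis by (rule LIM_zero_cancel)
  next
    case False
    then show ?thesis using y(1) x T(2) by (auto simp: topspace_Euclidean_space)
  qed
  then have "y \<longlonglongrightarrow> x" by (simp add: tendsto_fun_iff)
  then have "\<forall>\<^sub>F m in sequentially. y m \<in> T" using T x by (intro topological_tendstoD) auto
  then obtain m where "y m \<in> T" using eventually_happens by force
  then show False using y(1,3)[of m] T(2) by (auto simp: topspace_Euclidean_space)
qed

lemma Euclidean_continuous_map_iff:
  "continuous_map (subtopology (Euclidean_space m) S) (Euclidean_space n) f \<longleftrightarrow>
    continuous_on (topspace (Euclidean_space m) \<inter> S) f \<and> f \<in> topspace (Euclidean_space m) \<inter> S \<rightarrow> topspace (Euclidean_space n)"
  unfolding cm_Euclidean_space_iff_continuous_on by simp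

text \<open>If \<open>p < m\<close>, then invariance of domain would make the image open in the larger space, while it lies
  in a coordinate subspace.\<close>

lemma Euclidean_dimension_le:
  assumes U: "openin (Euclidean_space m) U" "U \<noteq> {}"
    and f: "continuous_map (subtopology (Euclidean_space m) U) (Euclidean_space p) f" "inj_on f U"
  shows "m \<le> p"
proof (rule ccontr)
  assume "\<not> m \<le> p"
  then have pm: "p < m" by simp
  then have pm': "topspace (Euclidean_space p) \<subseteq> topspace (Euclidean_space m)" by simp
  note f' = f(1)[unfolded Euclidean_continuous_map_iff]
  have fp: "f w \<in> topspace (Euclidean_space p)" if "w \<in> topspace (Euclidean_space m) \<inter> U" for w
    using conjunct2[OF f'] that by (rule Pi_mem)
  have "f \<in> topspace (Euclidean_space m) \<inter> U \<rightarrow> topspace (Euclidean_space m)"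
    by (rule Pi_I) (rule subsetD[OF pm' fp])
  with conjunct1[OF f'] have "continuous_map (subtopology (Euclidean_space m) U) (Euclidean_space m) f"
    unfolding Euclidean_continuous_map_iff by (rule conjI)
  then have o: "openin (Euclidean_space m) (f ` U)"
    by (rule invariance_of_domain_Euclidean_space[OF U(1) _ f(2)])
  obtain u where u: "u \<in> U" using U(2) by blast
  have sub: "f ` U \<subseteq> topspace (Euclidean_space p)"
  proof (rule image_subsetI)
    fix w assume w: "w \<in> U"
    then have "w \<in> topspace (Euclidean_space m) \<inter> U" using openin_subset[OF U(1)] by blast
    then show "f w \<in> topspace (Euclidean_space p)" by (rule fp)
  qed
  obtain r where r: "r > 0" "\<And>y. y \<in> topspace (Euclidean_space m) \<Longrightarrow> (\<forall>i<m. \<bar>y i - f u i\<bar> < r) \<Longrightarrow> y \<in> f ` U"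
    by (rule Euclidean_cube[OF o, of "f u"]) (use u in auto)
  define y where "y = (f u)(p := r / 2)"
  have fu: "f u \<in> topspace (Euclidean_space p)" using sub u by blast
  then have "y \<in> topspace (Euclidean_space m)" "\<forall>i<m. \<bar>y i - f u i\<bar> < r"
    using pm r(1) by (auto simp: y_def topspace_Euclidean_space)
  then have "y \<in> f ` U" by (rule r(2))
  with sub have "y \<in> topspace (Euclidean_space p)" by (rule subsetD)
  then have "y p = 0" by (simp add: topspace_Euclidean_space)
  then show False using r(1) by (simp add: y_def)
qed

text \<open>The homeomorphism \<open>t \<mapsto> t / (1 + \<bar>t\<bar>)\<close> in each coordinate squeezes the whole space into a cube;
  invariance of domain supplies the continuity of the inverse.\<close>

lemma Euclidean_embeds_open:
  assumes U: "openin (Euclidean_space n) U" "U \<noteq> {}"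
  obtains h where "embedding_map (Euclidean_space n) (subtopology (Euclidean_space n) U) h"
proof -
  obtain x where x: "x \<in> U" using U(2) by blast
  obtain r where r: "r > 0" "\<And>y. y \<in> topspace (Euclidean_space n) \<Longrightarrow> (\<forall>i<n. \<bar>y i - x i\<bar> < r) \<Longrightarrow> y \<in> U"
    using Euclidean_cube[OF U(1) x] by metis
  define h where "h y = (\<lambda>i. if i < n then x i + r * (y i / (1 + \<bar>y i\<bar>)) else 0)" for y
  have pos: "1 + \<bar>t\<bar> > 0" for t :: real by simp
  have ht: "h y \<in> topspace (Euclidean_space n)" for y by (auto simp: h_def topspace_Euclidean_space)
  have hU: "h y \<in> U" for y
  proof (rule r(2)[OF ht], intro allI impI)
    fix i assume "i < n"
    have "\<bar>y i / (1 + \<bar>y i\<bar>)\<bar> < 1" by (simp add: abs_divide)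
    then have "r * \<bar>y i / (1 + \<bar>y i\<bar>)\<bar> < r * 1" using r(1) by (intro mult_strict_left_mono)
    then show "\<bar>h y i - x i\<bar> < r" using \<open>i < n\<close> r(1) by (simp add: h_def abs_mult)
  qed
  have "continuous_on S h" for S
  proof (rule continuous_on_coordinatewise_then_product)
    fix i
    have "continuous_on S (\<lambda>y::nat \<Rightarrow> real. x i + r * (y i / (1 + \<bar>y i\<bar>)))"
      using pos by (intro continuous_intros continuous_on_coord) (metis less_irrefl)
    then show "continuous_on S (\<lambda>y. h y i)" unfolding h_def by (cases "i < n") auto
  qed
  then have c: "continuous_map (subtopology (Euclidean_space n) (topspace (Euclidean_space n))) (Euclidean_space n) h"
    unfolding Euclidean_continuous_map_iff using ht by blast
  have inj1: "s = t" if "s / (1 + \<bar>s\<bar>) = t / (1 + \<bar>t\<bar>)" for s t :: real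
  proof -
    have e: "s * (1 + \<bar>t\<bar>) = t * (1 + \<bar>s\<bar>)" using that pos[of s] pos[of t] by (simp add: frac_eq_eq)
    consider "s \<ge> 0" "t \<ge> 0" | "s < 0" "t < 0" | "s \<ge> 0" "t < 0" | "s < 0" "t \<ge> 0" by linarith
    then show ?thesis
    proof cases
      case 1 then show ?thesis using e by (simp add: algebra_simps)
    next
      case 2 then show ?thesis using e by (simp add: algebra_simps)
    next
      case 3
      then have "s * (1 + \<bar>t\<bar>) \<ge> 0" "t * (1 + \<bar>s\<bar>) < 0" by (simp_all add: mult_neg_pos)
      then show ?thesis using e by linarith
    next
      case 4
      then have "s * (1 + \<bar>t\<bar>) < 0" "t * (1 + \<bar>s\<bar>) \<ge> 0" by (simp_all add: mult_neg_pos)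
      then show ?thesis using e by linarith
    qed
  qed
  have "inj_on h (topspace (Euclidean_space n))"
  proof (rule inj_onI, rule ext)
    fix y z i assume yz: "y \<in> topspace (Euclidean_space n)" "z \<in> topspace (Euclidean_space n)" "h y = h z"
    show "y i = z i"
    proof (cases "i < n")
      case True
      then have "x i + r * (y i / (1 + \<bar>y i\<bar>)) = x i + r * (z i / (1 + \<bar>z i\<bar>))"
        using fun_cong[OF yz(3), of i] by (simp only: h_def if_True)
      then have "r = 0 \<or> y i / (1 + \<bar>y i\<bar>) = z i / (1 + \<bar>z i\<bar>)"
        by (simp only: add_left_cancel mult_cancel_left)
      then show ?thesis using r(1) inj1 by blast
    next
      case False then show ?thesis using yz(1,2) by (simp add: topspace_Euclidean_space)
    qed
  qed
  then have "embedding_map (Euclidean_space n) (Euclidean_space n) h"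
    using invariance_of_domain_Euclidean_space_embedding_map[OF openin_topspace c] by simp
  then have "embedding_map (Euclidean_space n) (subtopology (Euclidean_space n) U) h"
    using hU by (simp add: embedding_map_in_subtopology image_subset_iff Pi_iff)
  then show thesis by (rule that)
qed

lemma embedding_imp_continuous_inj:
  assumes "embedding_map X Y f"
  shows "continuous_map X Y f" "inj_on f (topspace X)"
proof -
  have h: "homeomorphic_map X (subtopology Y (f ` topspace X)) f" using assms by (simp add: embedding_map_def)
  show "continuous_map X Y f" using homeomorphic_imp_continuous_map[OF h] by (simp add: continuous_map_in_subtopology)
  show "inj_on f (topspace X)" by (rule homeomorphic_imp_injective_map[OF h])
qed

text \<open>Over the image of an embedded Euclidean space the map \<open>q\<close> is still open with bounded fibres, so
  it has a continuous local inverse over some nonempty open part. Followed by the coordinates \<open>e\<close> this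
  is a continuous injection from an open subset of the \<open>m\<close>-dimensional space.\<close>

lemma real_dim_le_chart:
  assumes q: "open_map X Y q" "continuous_map X Y q"
    and fib: "\<And>x. x \<in> topspace X \<Longrightarrow> finite {y \<in> topspace X. q y = q x} \<and> card {y \<in> topspace X. q y = q x} \<le> N"
    and e: "continuous_map X (Euclidean_space p) e" "inj_on e (topspace X)"
    and f: "embedding_map (Euclidean_space m) Y f" and x: "x \<in> topspace X" "w \<in> topspace (Euclidean_space m)" "f w = q x"
  shows "m \<le> p"
proof -
  have "Hausdorff_space (Euclidean_space p)"
    unfolding Euclidean_space_eq by (simp add: Hausdorff_space_subtopology)
  then have haus: "Hausdorff_space X"
    using Hausdorff_space_injective_preimage e by blast
  let ?E = "topspace (Euclidean_space m)"
  define Y' where "Y' = f ` ?E"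
  define X' where "X' = {x \<in> topspace X. q x \<in> Y'}"
  have o: "open_map (subtopology X X') (subtopology Y Y') q"
    unfolding X'_def by (rule open_map_restriction[OF q(1) refl])
  have tX: "topspace (subtopology X X') = X'" by (auto simp: X'_def)
  have c: "continuous_map (subtopology X X') (subtopology Y Y') q"
    unfolding continuous_map_in_subtopology tX
    using q(2) by (auto simp: X'_def continuous_map_from_subtopology)
  obtain W where W: "openin (subtopology X X') W" "W \<noteq> {}" "inj_on q W"
  proof (rule open_map_injective_part[OF o c, of N])
    show "Hausdorff_space (subtopology X X')" by (rule Hausdorff_space_subtopology[OF haus])
    show "topspace (subtopology X X') \<noteq> {}" 
    proof -
      have "q x \<in> Y'" unfolding Y'_def x(3)[symmetric] using x(2) by (rule imageI)
      then show ?thesis unfolding tX using x(1) by (auto simp: X'_def)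
    qed
    fix y assume y: "y \<in> topspace (subtopology X X')"
    then have yt: "y \<in> topspace X" by simp
    have "{z \<in> topspace (subtopology X X'). q z = q y} \<subseteq> {z \<in> topspace X. q z = q y}" by auto
    then show "finite {z \<in> topspace (subtopology X X'). q z = q y} \<and> card {z \<in> topspace (subtopology X X'). q z = q y} \<le> N"
      using fib[OF yt] by (meson card_mono finite_subset order_trans)
  qed
  have WX: "W \<subseteq> X'" "W \<subseteq> topspace X" using openin_subset[OF W(1)] by auto
  have hf: "homeomorphic_map (Euclidean_space m) (subtopology Y Y') f" using f by (simp add: embedding_map_def Y'_def)
  define V where "V = {w \<in> ?E. f w \<in> q ` W}"
  have "openin (subtopology Y Y') (q ` W)" using o W(1) by (simp add: open_map_def)
  then have V: "openin (Euclidean_space m) V"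
    unfolding V_def using openin_continuous_map_preimage[OF homeomorphic_imp_continuous_map[OF hf]] by blast
  have fV: "f ` V = q ` W"
  proof
    show "q ` W \<subseteq> f ` V"
    proof
      fix y assume y: "y \<in> q ` W"
      then have "y \<in> Y'" using WX by (auto simp: X'_def)
      then show "y \<in> f ` V" using y by (auto simp: V_def Y'_def)
    qed
  qed (auto simp: V_def)
  have Vne: "V \<noteq> {}" using fV W(2) by auto
  \<comment> \<open>On \<open>W\<close> the map \<open>q\<close> is a homeomorphism onto its image; \<open>g\<close> is the inverse.\<close>
  have "open_map (subtopology (subtopology X X') W) (subtopology Y Y') q"
    using o W(1) by (rule open_map_from_subtopology)
  moreover have "continuous_map (subtopology (subtopology X X') W) (subtopology Y Y') q"
    using c by (rule continuous_map_from_subtopology)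
  moreover have tW: "topspace (subtopology (subtopology X X') W) = W" using WX by auto
  ultimately have "embedding_map (subtopology (subtopology X X') W) (subtopology Y Y') q"
    using W(3) by (intro injective_open_imp_embedding_map) simp_all
  then have "homeomorphic_map (subtopology (subtopology X X') W) (subtopology (subtopology Y Y') (q ` W)) q"
    by (simp only: embedding_map_def tW)
  then obtain g where g: "homeomorphic_maps (subtopology (subtopology X X') W) (subtopology (subtopology Y Y') (q ` W)) q g"
    using homeomorphic_map_maps by blast
  have gc: "continuous_map (subtopology (subtopology Y Y') (q ` W)) (subtopology (subtopology X X') W) g"
    and gq: "\<And>x. x \<in> W \<Longrightarrow> g (q x) = x"
    using g tW unfolding homeomorphic_maps_def by auto
  have fc: "continuous_map (subtopology (Euclidean_space m) V) (subtopology (subtopology Y Y') (q ` W)) f"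
    unfolding continuous_map_in_subtopology[of _ _ "q ` W"]
    using continuous_map_from_subtopology[OF homeomorphic_imp_continuous_map[OF hf]] fV by auto
  have "continuous_map (subtopology (subtopology X X') W) (Euclidean_space p) e"
    by (intro continuous_map_from_subtopology e)
  from continuous_map_compose[OF continuous_map_compose[OF fc gc] this]
  have "continuous_map (subtopology (Euclidean_space m) V) (Euclidean_space p) (e \<circ> (g \<circ> f))" .
  moreover have "inj_on (e \<circ> (g \<circ> f)) V"
  proof (rule inj_onI)
    fix a b assume ab: "a \<in> V" "b \<in> V" "(e \<circ> (g \<circ> f)) a = (e \<circ> (g \<circ> f)) b"
    obtain s where s: "s \<in> W" "f a = q s" using ab(1) by (auto simp: V_def)
    obtain t where t: "t \<in> W" "f b = q t" using ab(2) by (auto simp: V_def)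
    have "e s = e t" using ab(3) s t gq by simp
    then have "s = t" using e(2) s(1) t(1) WX(2) by (meson inj_onD subsetD)
    then have "f a = f b" using s t by simp
    then show "a = b" using embedding_imp_continuous_inj(2)[OF f] ab(1,2) by (auto simp: V_def dest: inj_onD)
  qed
  ultimately show "m \<le> p" by (rule Euclidean_dimension_le[OF V Vne])
qed

text \<open>On an open set where \<open>q\<close> is injective it is an embedding, and the coordinates \<open>e\<close> identify this set
  with an open set of Euclidean space, into which the whole space embeds.\<close>

lemma real_dim_ge_chart:
  assumes q: "open_map X Y q" "continuous_map X Y q" and ne: "topspace X \<noteq> {}"
    and fib: "\<And>x. x \<in> topspace X \<Longrightarrow> finite {y \<in> topspace X. q y = q x} \<and> card {y \<in> topspace X. q y = q x} \<le> N"
    and e: "continuous_map X (Euclidean_space p) e" "inj_on e (topspace X)" "open_map X (Euclidean_space p) e"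
  obtains f where "embedding_map (Euclidean_space p) Y f"
proof -
  have "Hausdorff_space (Euclidean_space p)"
    unfolding Euclidean_space_eq by (simp add: Hausdorff_space_subtopology)
  then have haus: "Hausdorff_space X"
    using Hausdorff_space_injective_preimage e by blast
  obtain W where W: "openin X W" "W \<noteq> {}" "inj_on q W"
    by (rule open_map_injective_part[OF q haus ne fib]) blast+
  have WX: "W \<subseteq> topspace X" by (rule openin_subset[OF W(1)])
  have tW: "topspace (subtopology X W) = W" using WX by auto
  have oq: "embedding_map (subtopology X W) Y q"
  proof (rule injective_open_imp_embedding_map)
    show "continuous_map (subtopology X W) Y q" by (rule continuous_map_from_subtopology[OF q(2)])
    show "open_map (subtopology X W) Y q" by (rule open_map_from_subtopology[OF q(1) W(1)])
    show "inj_on q (topspace (subtopology X W))" unfolding tW by (rule W(3))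
  qed
  have oe: "embedding_map (subtopology X W) (Euclidean_space p) e"
  proof (rule injective_open_imp_embedding_map)
    show "continuous_map (subtopology X W) (Euclidean_space p) e" by (rule continuous_map_from_subtopology[OF e(1)])
    show "open_map (subtopology X W) (Euclidean_space p) e" by (rule open_map_from_subtopology[OF e(3) W(1)])
    show "inj_on e (topspace (subtopology X W))" unfolding tW by (rule inj_on_subset[OF e(2) WX])
  qed
  then have "homeomorphic_map (subtopology X W) (subtopology (Euclidean_space p) (e ` W)) e"
    by (simp only: embedding_map_def tW)
  then obtain g where "homeomorphic_maps (subtopology X W) (subtopology (Euclidean_space p) (e ` W)) e g"
    using homeomorphic_map_maps by blast
  then have "homeomorphic_map (subtopology (Euclidean_space p) (e ` W)) (subtopology X W) g"
    by (meson homeomorphic_maps_sym homeomorphic_maps_map)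
  then have h: "homeomorphic_map (subtopology (Euclidean_space p) (e ` W)) (subtopology X W) g" .
  have g: "embedding_map (subtopology (Euclidean_space p) (e ` W)) (subtopology X W) g"
    unfolding embedding_map_def homeomorphic_imp_surjective_map[OF h] subtopology_topspace by (rule h)
  have "openin (Euclidean_space p) (e ` W)" using e(3) W(1) by (simp add: open_map_def)
  then obtain h where h: "embedding_map (Euclidean_space p) (subtopology (Euclidean_space p) (e ` W)) h"
  proof (rule Euclidean_embeds_open)
    show "e ` W \<noteq> {}" using W(2) by simp
  qed
  from embedding_map_compose[OF embedding_map_compose[OF h g] oq] show thesis by (rule that)
qed

lemma real_dim_eqI:
  assumes "\<exists>f. embedding_map (Euclidean_space p) Y f"
    and "\<And>m f. embedding_map (Euclidean_space m) Y f \<Longrightarrow> m \<le> p"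
  shows "real_dim Y = enat p"
  unfolding real_dim_def
proof (rule antisym)
  show "Sup {enat n |n. \<exists>f. embedding_map (Euclidean_space n) Y f} \<le> enat p"
    by (rule Sup_least) (use assms(2) in auto)
  show "enat p \<le> Sup {enat n |n. \<exists>f. embedding_map (Euclidean_space n) Y f}"
    by (rule Sup_upper) (use assms(1) in auto)
qed

section \<open>Real coordinates on slices\<close>

definition cplx :: "(nat \<Rightarrow> real) \<Rightarrow> nat \<Rightarrow> complex" where
  "cplx w k = Complex (w (2 * k)) (w (2 * k + 1))"

lemma realify_cplx: "realify (cplx w) = w"
proof
  fix i show "realify (cplx w) i = w i"
    by (cases "even i") (auto simp: realify_def cplx_def elim!: evenE oddE)
qed

lemma cplx_realify: "cplx (realify z) = z"
  by (rule ext) (simp add: realify_def cplx_def complex_eq_iff)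

lemma realify_scale: "realify (\<lambda>k. complex_of_real r * a k) i = r * realify a i"
  by (simp add: realify_def)

lemma realify_eq_0: "a \<in> cvec n \<Longrightarrow> i \<ge> 2 * n \<Longrightarrow> realify a i = 0"
  by (auto simp: realify_def cvec_def)

lemma cplx_cvec: "(\<And>i. i \<ge> 2 * n \<Longrightarrow> w i = 0) \<Longrightarrow> cplx w \<in> cvec n"
  by (simp add: cvec_def cplx_def complex_eq_iff)

lemma tendsto_realify: "(\<And>k. ((\<lambda>n. a n k) \<longlongrightarrow> a' k) F) \<Longrightarrow> ((\<lambda>n. realify (a n) i) \<longlongrightarrow> realify a' i) F"
  unfolding realify_def by (cases "even i") (simp_all add: tendsto_Re tendsto_Im)

lemma tendsto_cplx: "(\<And>i. ((\<lambda>n. w n i) \<longlongrightarrow> w' i) F) \<Longrightarrow> ((\<lambda>n. cplx (w n) k) \<longlongrightarrow> cplx w' k) F"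
  unfolding cplx_def by (intro tendsto_Complex)

text \<open>The map \<open>\<sigma>\<close> enumerates the \<open>p\<close> real coordinates that remain free; all others are fixed to the
  values \<open>v\<close>. Both kinds of slices are of this shape.\<close>

definition coord_chart :: "nat \<Rightarrow> (nat \<Rightarrow> nat) \<Rightarrow> (nat \<Rightarrow> complex) \<Rightarrow> nat \<Rightarrow> real" where
  "coord_chart p \<sigma> a = (\<lambda>i. if i < p then realify a (\<sigma> i) else 0)"

definition coord_slice :: "nat \<Rightarrow> nat \<Rightarrow> (nat \<Rightarrow> nat) \<Rightarrow> (nat \<Rightarrow> real) \<Rightarrow> (nat \<Rightarrow> complex) set \<Rightarrow> (nat \<Rightarrow> complex) set" where
  "coord_slice n p \<sigma> v S = {a \<in> S. \<forall>i<2 * n. i \<notin> \<sigma> ` {..<p} \<longrightarrow> realify a i = v i}"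

definition coord_fill :: "nat \<Rightarrow> nat \<Rightarrow> (nat \<Rightarrow> nat) \<Rightarrow> (nat \<Rightarrow> real) \<Rightarrow> (nat \<Rightarrow> real) \<Rightarrow> nat \<Rightarrow> complex" where
  "coord_fill n p \<sigma> v w = cplx (\<lambda>i. if i \<ge> 2 * n then 0 else if i \<in> \<sigma> ` {..<p} then w (inv_into {..<p} \<sigma> i) else v i)"

lemma coord_fill_cvec: "coord_fill n p \<sigma> v w \<in> cvec n"
  unfolding coord_fill_def by (rule cplx_cvec) simp

lemma coord_chart_fill:
  assumes "inj_on \<sigma> {..<p}" "\<sigma> ` {..<p} \<subseteq> {..<2 * n}" "w \<in> topspace (Euclidean_space p)"
  shows "coord_chart p \<sigma> (coord_fill n p \<sigma> v w) = w"
proof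
  fix i show "coord_chart p \<sigma> (coord_fill n p \<sigma> v w) i = w i"
  proof (cases "i < p")
    case True
    then have "\<sigma> i < 2 * n" "inv_into {..<p} \<sigma> (\<sigma> i) = i" using assms(1,2) by auto
    then show ?thesis using True by (simp add: coord_chart_def coord_fill_def realify_cplx)
  next
    case False
    then show ?thesis using assms(3) by (simp add: coord_chart_def topspace_Euclidean_space)
  qed
qed

lemma coord_fill_chart:
  assumes "inj_on \<sigma> {..<p}" "a \<in> coord_slice n p \<sigma> v S" "S \<subseteq> cvec n"
  shows "coord_fill n p \<sigma> v (coord_chart p \<sigma> a) = a"
proof -
  have "(\<lambda>i. if i \<ge> 2 * n then 0 else if i \<in> \<sigma> ` {..<p} then coord_chart p \<sigma> a (inv_into {..<p} \<sigma> i) else v i) = realify a"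
  proof
    fix i
    have a: "a \<in> cvec n" using assms(2,3) by (auto simp: coord_slice_def)
    have 1: "coord_chart p \<sigma> a (inv_into {..<p} \<sigma> i) = realify a i" if i: "i \<in> \<sigma> ` {..<p}"
      using inv_into_into[OF i] f_inv_into_f[OF i] by (simp add: coord_chart_def)
    have 2: "v i = realify a i" if "i \<notin> \<sigma> ` {..<p}" "i < 2 * n" using assms(2) that by (simp add: coord_slice_def)
    show "(if i \<ge> 2 * n then 0 else if i \<in> \<sigma> ` {..<p} then coord_chart p \<sigma> a (inv_into {..<p} \<sigma> i) else v i) = realify a i"
      using 1 2 realify_eq_0[OF a, of i] by (cases "2 * n \<le> i"; cases "i \<in> \<sigma> ` {..<p}") simp_all
  qed
  then show ?thesis unfolding coord_fill_def by (simp only: cplx_realify)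
qed

lemma coord_fill_slice:
  "coord_fill n p \<sigma> v w \<in> S \<Longrightarrow> coord_fill n p \<sigma> v w \<in> coord_slice n p \<sigma> v S"
  by (simp add: coord_slice_def) (simp add: coord_fill_def realify_cplx)

lemma continuous_on_coord_fill: "continuous_on T (coord_fill n p \<sigma> v)"
  unfolding continuous_on_def tendsto_fun_iff
proof (intro ballI allI)
  fix w k
  have c: "((\<lambda>x. x i) \<longlongrightarrow> w i) (at w within T)" if "w \<in> T" for i
    using continuous_on_coord[of T i] that by (auto simp: continuous_on_def)
  assume "w \<in> T"
  then show "((\<lambda>x. coord_fill n p \<sigma> v x k) \<longlongrightarrow> coord_fill n p \<sigma> v w k) (at w within T)"
    unfolding coord_fill_def by (intro tendsto_cplx) (simp add: c)
qed

lemma coord_chart_maps: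
  assumes \<sigma>: "inj_on \<sigma> {..<p}" "\<sigma> ` {..<p} \<subseteq> {..<2 * n}" and S: "openin (top_of_set (cvec n)) S"
    and X_def: "X = coord_slice n p \<sigma> v S"
  shows "continuous_map (top_of_set X) (Euclidean_space p) (coord_chart p \<sigma>)"
    and "inj_on (coord_chart p \<sigma>) X"
    and "open_map (top_of_set X) (Euclidean_space p) (coord_chart p \<sigma>)"
proof -
  have Sc: "S \<subseteq> cvec n" using openin_imp_subset[OF S] .
  have "continuous_on X (coord_chart p \<sigma>)"
    unfolding continuous_on_def tendsto_fun_iff
  proof (intro ballI allI)
    fix a i assume a: "a \<in> X"
    have "((\<lambda>x. x k) \<longlongrightarrow> a k) (at a within X)" for k
      using continuous_on_coord[of X k] a by (auto simp: continuous_on_def)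
    then have "((\<lambda>x. realify x (\<sigma> i)) \<longlongrightarrow> realify a (\<sigma> i)) (at a within X)" by (rule tendsto_realify)
    then show "((\<lambda>x. coord_chart p \<sigma> x i) \<longlongrightarrow> coord_chart p \<sigma> a i) (at a within X)"
      unfolding coord_chart_def by (cases "i < p") simp_all
  qed
  then show "continuous_map (top_of_set X) (Euclidean_space p) (coord_chart p \<sigma>)"
    unfolding Euclidean_space_eq continuous_map_subtopology_eu by (auto simp: coord_chart_def)
  have fc: "coord_fill n p \<sigma> v (coord_chart p \<sigma> a) = a" if "a \<in> X" for a
    using coord_fill_chart[OF \<sigma>(1) _ Sc] that unfolding X_def .
  show "inj_on (coord_chart p \<sigma>) X"
  proof (rule inj_onI)
    fix a b assume ab: "a \<in> X" "b \<in> X" "coord_chart p \<sigma> a = coord_chart p \<sigma> b"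
    show "a = b" using arg_cong[OF ab(3), of "coord_fill n p \<sigma> v"] unfolding fc[OF ab(1)] fc[OF ab(2)] .
  qed
  show "open_map (top_of_set X) (Euclidean_space p) (coord_chart p \<sigma>)"
    unfolding open_map_def
  proof (intro allI impI)
    fix U assume "openin (top_of_set X) U"
    then obtain T where T: "open T" "U = X \<inter> T" by (auto simp: openin_open)
    obtain S' where S': "open S'" "S = cvec n \<inter> S'" using S by (auto simp: openin_open)
    have "coord_chart p \<sigma> ` U = {x. \<forall>i\<ge>p. x i = 0} \<inter> (coord_fill n p \<sigma> v -` (S' \<inter> T))"
    proof (rule Set.set_eqI, rule iffI)
      fix w assume "w \<in> coord_chart p \<sigma> ` U"
      then obtain a where a: "a \<in> U" "w = coord_chart p \<sigma> a" by blast
      then have "coord_fill n p \<sigma> v w = a" using fc T(2) by auto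
      moreover have "a \<in> S' \<inter> T" using a(1) T(2) S'(2) by (auto simp: X_def coord_slice_def)
      ultimately show "w \<in> {x. \<forall>i\<ge>p. x i = 0} \<inter> (coord_fill n p \<sigma> v -` (S' \<inter> T))"
        using a(2) by (auto simp: coord_chart_def)
    next
      fix w assume w: "w \<in> {x. \<forall>i\<ge>p. x i = 0} \<inter> (coord_fill n p \<sigma> v -` (S' \<inter> T))"
      then have wt: "w \<in> topspace (Euclidean_space p)" by (simp add: topspace_Euclidean_space)
      have "coord_fill n p \<sigma> v w \<in> S" using w S'(2) coord_fill_cvec by auto
      then have "coord_fill n p \<sigma> v w \<in> U" unfolding T(2) X_def using coord_fill_slice w by auto
      then show "w \<in> coord_chart p \<sigma> ` U" using coord_chart_fill[OF \<sigma> wt] by (metis imageI)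
    qed
    moreover have "open (coord_fill n p \<sigma> v -` (S' \<inter> T))"
      by (rule open_vimage[OF open_Int[OF S'(1) T(1)] continuous_on_coord_fill])
    ultimately show "openin (Euclidean_space p) (coord_chart p \<sigma> ` U)"
      unfolding Euclidean_space_eq by (auto simp: openin_open)
  qed
qed

section \<open>The dimension of the locus of antipodal maps\<close>

definition skip1 :: "nat \<Rightarrow> nat \<Rightarrow> nat" where "skip1 j i = (if i < j then i else Suc i)"

lemma skip1: assumes "j \<le> m" shows "inj_on (skip1 j) {..<m}" "skip1 j ` {..<m} = {..<Suc m} - {j}"
proof -
  show "inj_on (skip1 j) {..<m}" by (rule inj_onI) (auto simp: skip1_def split: if_splits)
  show "skip1 j ` {..<m} = {..<Suc m} - {j}"
  proof (rule Set.set_eqI, rule iffI)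
    fix i assume i: "i \<in> {..<Suc m} - {j}"
    show "i \<in> skip1 j ` {..<m}"
    proof (cases "i < j")
      case True then show ?thesis using assms by (intro image_eqI[of _ _ i]) (auto simp: skip1_def)
    next
      case False then show ?thesis using i by (intro image_eqI[of _ _ "i - 1"]) (auto simp: skip1_def)
    qed
  qed (use assms in \<open>auto simp: skip1_def split: if_splits\<close>)
qed

text \<open>Every class modulo real scalars has a representative with some real coordinate equal to 1.\<close>

definition rslice :: "nat \<Rightarrow> nat \<Rightarrow> (nat \<Rightarrow> complex) set" where
  "rslice d j = {a \<in> nonZ d. realify a j = 1}"

lemma rslice_eq: "j < 2 * d + 2 \<Longrightarrow> rslice d j = coord_slice (Suc d) (2 * d + 1) (skip1 j) (\<lambda>_. 1) (nonZ d)"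
  unfolding rslice_def coord_slice_def by (auto simp: skip1)

text \<open>Antipodal maps that converge as points of \<^const>\<open>Rat\<close> have parameters that converge up to real
  scalars, and these are then fixed by the normalization of the \<open>j\<close>-th real coordinate.\<close>

lemma rslice_open_map:
  assumes d: "odd d"
  shows "open_map (top_of_set (rslice d j)) (subtopology (Rat_space d) (B1 d)) (\<lambda>a. proj_class (anti_join d a))"
proof (rule open_map_by_sequences[where N = "nondeg_vecs d" and \<pi> = proj_class])
  note d1 = odd_ge_1[OF d]
  show "open_map (top_of_set (nondeg_vecs d)) (Rat_space d) proj_class"
    using proj_quotient(1)[OF d1] by (simp add: Nspace_def)
  show "proj_class ` nondeg_vecs d \<subseteq> topspace (Rat_space d)"
    using quotient_imp_surjective_map[OF proj_quotient(2)[OF d1]] by simp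
  show "anti_join d ` rslice d j \<subseteq> nondeg_vecs d" using nonZ_anti[OF d1] by (auto simp: rslice_def)
  show "proj_class ` anti_join d ` rslice d j \<subseteq> B1 d" unfolding B1_eq[OF d] by (auto simp: rslice_def)
  fix a c
  assume a: "a \<in> rslice d j" and cl: "c \<longlonglongrightarrow> anti_join d a" and c: "\<And>n. c n \<in> nondeg_vecs d" "\<And>n. proj_class (c n) \<in> B1 d"
  have a': "a \<in> nonZ d" "realify a j = 1" using a by (auto simp: rslice_def)
  have cl': "(\<lambda>n. c n i) \<longlonglongrightarrow> anti_join d a i" for i using cl by (simp add: tendsto_fun_iff)
  have "\<forall>n. \<exists>\<beta> s. \<beta> \<in> nonZ d \<and> s \<noteq> 0 \<and> c n = (\<lambda>i. s * anti_join d \<beta> i)"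
  proof
    fix n
    obtain \<beta> where \<beta>: "\<beta> \<in> nonZ d" "proj_class (anti_join d \<beta>) = proj_class (c n)"
      using c(2)[of n] unfolding B1_eq[OF d] by auto
    show "\<exists>\<beta> s. \<beta> \<in> nonZ d \<and> s \<noteq> 0 \<and> c n = (\<lambda>i. s * anti_join d \<beta> i)"
      using \<beta>(1) \<beta>(2)[unfolded proj_class_eq_iff] by blast
  qed
  then obtain \<beta> s where \<beta>: "\<And>n. \<beta> n \<in> nonZ d" "\<And>n. s n \<noteq> 0" "\<And>n. c n = (\<lambda>i. s n * anti_join d (\<beta> n) i)" by metis
  obtain r \<rho> where r: "strict_mono (r :: nat \<Rightarrow> nat)" "\<And>n. \<rho> n \<noteq> (0::real)"
    "\<And>i. (\<lambda>n. complex_of_real (\<rho> n) * \<beta> (r n) i) \<longlonglongrightarrow> a i"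
    by (rule phase_limit[OF d1 nonZ_cvec[OF a'(1)] nonZ_nonzero[OF d1 a'(1)] cl' nonZ_cvec[OF \<beta>(1)] \<beta>(3) \<beta>(2)]) blast
  define b where "b n = (\<lambda>i. complex_of_real (\<rho> n) * \<beta> (r n) i)" for n
  have bl: "(\<lambda>n. b n i) \<longlonglongrightarrow> a i" for i unfolding b_def by (rule r(3))
  have b: "b n \<in> nonZ d" for n unfolding b_def by (rule nonZ_scale[OF d1 r(2) \<beta>(1)])
  have bp: "proj_class (anti_join d (b n)) = proj_class (c (r n))" for n
  proof -
    have "complex_of_real (\<rho> n) \<noteq> 0" using r(2) by simp
    then show ?thesis unfolding b_def anti_mult \<beta>(3) by (simp add: proj_class_mult \<beta>(2))
  qed
  define x where "x n = realify (b n) j" for n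
  have "(\<lambda>n. realify (b n) j) \<longlonglongrightarrow> realify a j" by (rule tendsto_realify) (rule bl)
  then have xl: "x \<longlonglongrightarrow> 1" unfolding x_def a'(2) .
  have "\<forall>\<^sub>F n in sequentially. x n \<noteq> 0" by (rule tendsto_imp_eventually_ne[OF xl]) simp
  then obtain m where m: "\<And>n. n \<ge> m \<Longrightarrow> x n \<noteq> 0" unfolding eventually_sequentially by blast
  define b2 where "b2 n = (\<lambda>i. complex_of_real (1 / x (n + m)) * b (n + m) i)" for n
  have x0: "1 / x (n + m) \<noteq> 0" for n using m[of "n + m"] by simp
  have "b2 n \<in> rslice d j" for n
    unfolding rslice_def using nonZ_scale[OF d1 x0 b] realify_scale[of "1 / x (n + m)" "b (n + m)" j] x0[of n]
    by (simp add: b2_def x_def)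
  moreover have "proj_class (anti_join d (b2 n)) = proj_class (c (r (n + m)))" for n
  proof -
    have nz: "complex_of_real (1 / x (n + m)) \<noteq> 0" using x0[of n] by simp
    show ?thesis unfolding b2_def anti_mult proj_class_mult[OF nz] by (rule bp)
  qed
  moreover have "b2 \<longlonglongrightarrow> a"
    unfolding tendsto_fun_iff
  proof
    fix i
    have "(\<lambda>n. complex_of_real (1 / x (n + m)) * b (n + m) i) \<longlonglongrightarrow> complex_of_real (1 / 1) * a i"
      by (intro tendsto_mult tendsto_of_real tendsto_divide tendsto_const LIMSEQ_ignore_initial_segment xl bl) simp
    then show "(\<lambda>n. b2 n i) \<longlonglongrightarrow> a i" by (simp add: b2_def)
  qed
  ultimately show "\<exists>r b. (\<forall>n. b n \<in> rslice d j) \<and> b \<longlonglongrightarrow> a \<and> (\<forall>n. proj_class (anti_join d (b n)) = proj_class (c (r n)))"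
    by (intro exI[of _ "\<lambda>n. r (n + m)"] exI[of _ b2]) blast
qed

lemma B1_continuous:
  assumes d: "odd d"
  shows "continuous_map (top_of_set (nonZ d)) (subtopology (Rat_space d) (B1 d)) (\<lambda>a. proj_class (anti_join d a))"
proof -
  note d1 = odd_ge_1[OF d]
  have "continuous_map (top_of_set (nonZ d)) (Nspace d) (anti_join d)"
    unfolding Nspace_def continuous_map_subtopology_eu using continuous_on_anti_join nonZ_anti[OF d1] by auto
  from continuous_map_compose[OF this quotient_imp_continuous_map[OF proj_quotient(2)[OF d1]]]
  show ?thesis unfolding continuous_map_in_subtopology B1_eq[OF d] by (simp add: comp_def)
qed

lemma continuous_map_top_of_set_subset:
  assumes "continuous_map (top_of_set S) Y f" "T \<subseteq> S" shows "continuous_map (top_of_set T) Y f"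
  using continuous_map_from_subtopology_mono assms by blast

text \<open>The numerator \<open>z ^ d\<close> has a constant denominator. It shows that the slices are not empty.\<close>

lemma top_coeff_nonZ:
  assumes d: "odd d" shows "(\<lambda>k. if k = d then 1 else 0) \<in> nonZ d"
proof -
  note d1 = odd_ge_1[OF d]
  define a :: "nat \<Rightarrow> complex" where "a = (\<lambda>k. if k = d then 1 else 0)"
  have a: "a \<in> cvec (Suc d)" by (simp add: a_def cvec_def)
  have f: "form d a x y = x ^ d" for x y
  proof -
    have "form d a x y = (\<Sum>k\<le>d. if k = d then x ^ d else 0)" unfolding form_def a_def by (rule sum.cong) auto
    then show ?thesis by simp
  qed
  have "nondeg d (anti_join d a)"
  proof (rule nondegI)
    fix x y :: complex
    assume "(x, y) \<noteq> (0, 0)" "form d (numer d (anti_join d a)) x y = 0" "form d (denom d (anti_join d a)) x y = 0"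
    then show False by (simp add: numer_anti[OF a] denom_anti form_antipodal[OF d] f)
  qed
  then show ?thesis using a nonZ_iff[OF d1] unfolding a_def by blast
qed

text \<open>The slices map injectively and openly to the locus, they cover it, and each has \<open>2d + 1\<close> free real
  coordinates.\<close>

lemma real_dim_B1:
  assumes d: "odd d" shows "real_dim (subtopology (Rat_space d) (B1 d)) = enat (2 * d + 1)"
proof (rule real_dim_eqI)
  note d1 = odd_ge_1[OF d]
  let ?Y = "subtopology (Rat_space d) (B1 d)" and ?Q = "\<lambda>a. proj_class (anti_join d a)"
  have qc: "continuous_map (top_of_set (rslice d j)) ?Y ?Q" for j
    by (rule continuous_map_top_of_set_subset[OF B1_continuous[OF d]]) (auto simp: rslice_def)
  have fib: "finite {y \<in> topspace (top_of_set (rslice d j)). ?Q y = ?Q x} \<and>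
      card {y \<in> topspace (top_of_set (rslice d j)). ?Q y = ?Q x} \<le> 1" if "x \<in> topspace (top_of_set (rslice d j))" for x j
  proof -
    have x: "x \<in> rslice d j" using that by simp
    have "{y \<in> topspace (top_of_set (rslice d j)). ?Q y = ?Q x} \<subseteq> {x}"
    proof
      fix y assume "y \<in> {y \<in> topspace (top_of_set (rslice d j)). ?Q y = ?Q x}"
      then have y: "y \<in> rslice d j" "?Q x = ?Q y" by auto
      have xy: "x \<in> nonZ d" "y \<in> nonZ d" "realify x j = 1" "realify y j = 1" using x y(1) by (auto simp: rslice_def)
      obtain s where s: "anti_join d y = (\<lambda>i. s * anti_join d x i)" using y(2) unfolding proj_class_eq_iff by blast
      obtain r where r: "y = (\<lambda>k. complex_of_real r * x k)"
        by (rule anti_inject[OF d1 nonZ_cvec[OF xy(1)] nonZ_cvec[OF xy(2)] nonZ_nonzero[OF d1 xy(1)] s])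
      have "r = 1" using realify_scale[of r x j] xy(3,4) unfolding r[symmetric] by simp
      then show "y \<in> {x}" using r by simp
    qed
    then show ?thesis using card_mono[of "{x}"] finite_subset[of _ "{x}"] by auto
  qed
  have chart: "continuous_map (top_of_set (rslice d j)) (Euclidean_space (2 * d + 1)) (coord_chart (2 * d + 1) (skip1 j))"
     "inj_on (coord_chart (2 * d + 1) (skip1 j)) (topspace (top_of_set (rslice d j)))"
     "open_map (top_of_set (rslice d j)) (Euclidean_space (2 * d + 1)) (coord_chart (2 * d + 1) (skip1 j))"
    if j: "j < 2 * d + 2" for j
  proof -
    have s: "skip1 j ` {..<2 * d + 1} \<subseteq> {..<2 * Suc d}" using skip1(2)[of j "2 * d + 1"] j by auto
    have i: "inj_on (skip1 j) {..<2 * d + 1}" using skip1(1)[of j "2 * d + 1"] j by simp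
    note c = coord_chart_maps[OF i s open_nonZ[OF d1] rslice_eq[OF j]]
    show "continuous_map (top_of_set (rslice d j)) (Euclidean_space (2 * d + 1)) (coord_chart (2 * d + 1) (skip1 j))" by (rule c(1))
    show "inj_on (coord_chart (2 * d + 1) (skip1 j)) (topspace (top_of_set (rslice d j)))" using c(2) by simp
    show "open_map (top_of_set (rslice d j)) (Euclidean_space (2 * d + 1)) (coord_chart (2 * d + 1) (skip1 j))" by (rule c(3))
  qed
  show "\<exists>f. embedding_map (Euclidean_space (2 * d + 1)) ?Y f"
  proof -
    have "(\<lambda>k. if k = d then 1 else 0) \<in> rslice d (2 * d)"
      using top_coeff_nonZ[OF d] by (simp add: rslice_def realify_def)
    then have ne: "topspace (top_of_set (rslice d (2 * d))) \<noteq> {}" by auto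
    have j: "2 * d < 2 * d + 2" by simp
    show ?thesis
      by (rule real_dim_ge_chart[OF rslice_open_map[OF d] qc ne fib chart[OF j]]) blast+
  qed
  fix m f assume f: "embedding_map (Euclidean_space m) ?Y f"
  have w: "(\<lambda>_. 0) \<in> topspace (Euclidean_space m)" by (simp add: topspace_Euclidean_space)
  have "f (\<lambda>_. 0) \<in> topspace ?Y" 
    by (rule subsetD[OF continuous_map_image_subset_topspace[OF embedding_imp_continuous_inj(1)[OF f]] imageI[OF w]])
  then have "f (\<lambda>_. 0) \<in> B1 d" by simp
  then obtain a where a: "a \<in> nonZ d" "f (\<lambda>_. 0) = ?Q a" unfolding B1_eq[OF d] by blast
  obtain j where j: "j < 2 * d + 2" "realify a j \<noteq> 0"
  proof -
    obtain k where k: "k \<le> d" "a k \<noteq> 0" using nonZ_nonzero[OF d1 a(1)] by blast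
    then have "realify a (2 * k) \<noteq> 0 \<or> realify a (2 * k + 1) \<noteq> 0" by (auto simp: realify_def complex_eq_iff)
    then show thesis using that[of "2 * k"] that[of "2 * k + 1"] k(1) by auto
  qed
  define b where "b = (\<lambda>k. complex_of_real (1 / realify a j) * a k)"
  have r0: "1 / realify a j \<noteq> 0" using j(2) by simp
  have b: "b \<in> rslice d j"
    unfolding rslice_def b_def using nonZ_scale[OF d1 r0 a(1)] realify_scale[of "1 / realify a j" a j] j(2) by simp
  have r0': "complex_of_real (1 / realify a j) \<noteq> 0" using r0 by simp
  have bQ: "f (\<lambda>_. 0) = ?Q b" unfolding a(2) b_def anti_mult proj_class_mult[OF r0'] ..
  have bt: "b \<in> topspace (top_of_set (rslice d j))" using b by simp
  show "m \<le> 2 * d + 1"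
  proof (rule real_dim_le_chart[where X = "top_of_set (rslice d j)" and N = 1 and q = ?Q and x = b])
    show "open_map (top_of_set (rslice d j)) ?Y ?Q" by (rule rslice_open_map[OF d])
    show "continuous_map (top_of_set (rslice d j)) ?Y ?Q" by (rule qc)
  qed (fact fib chart(1,2)[OF j(1)] f w bQ bt)+
qed

section \<open>The dimension of the moduli locus\<close>

text \<open>Enumerates the real coordinates other than the two of \<open>a 0\<close> and the two of \<open>a k\<close>.\<close>

definition skip2 :: "nat \<Rightarrow> nat \<Rightarrow> nat" where "skip2 k i = (if i + 2 < 2 * k then i + 2 else i + 4)"

lemma skip2:
  assumes "1 \<le> k" "k \<le> d"
  shows "inj_on (skip2 k) {..<2 * d - 2}" "skip2 k ` {..<2 * d - 2} = {..<2 * d + 2} - {0, 1, 2 * k, 2 * k + 1}"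
proof -
  show "inj_on (skip2 k) {..<2 * d - 2}" by (rule inj_onI) (auto simp: skip2_def split: if_splits)
  show "skip2 k ` {..<2 * d - 2} = {..<2 * d + 2} - {0, 1, 2 * k, 2 * k + 1}"
  proof (rule Set.set_eqI, rule iffI)
    fix i assume i: "i \<in> {..<2 * d + 2} - {0, 1, 2 * k, 2 * k + 1}"
    show "i \<in> skip2 k ` {..<2 * d - 2}"
    proof (cases "i < 2 * k")
      case True then show ?thesis using assms i by (intro image_eqI[of _ _ "i - 2"]) (auto simp: skip2_def)
    next
      case False then show ?thesis using assms i by (intro image_eqI[of _ _ "i - 4"]) (auto simp: skip2_def)
    qed
  qed (use assms in \<open>auto simp: skip2_def split: if_splits\<close>)
qed

lemma slice_eq:
  assumes "1 \<le> k" "k \<le> d"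
  shows "slice d k = coord_slice (Suc d) (2 * d - 2) (skip2 k) (\<lambda>i. if i = 2 * k then 1 else 0) (nonZ d)"
proof -
  have "(\<forall>i<2 * Suc d. i \<notin> skip2 k ` {..<2 * d - 2} \<longrightarrow> realify a i = (if i = 2 * k then 1 else 0)) \<longleftrightarrow>
     realify a 0 = 0 \<and> realify a 1 = 0 \<and> realify a (2 * k) = 1 \<and> realify a (2 * k + 1) = 0" for a
  proof
    assume *: "\<forall>i<2 * Suc d. i \<notin> skip2 k ` {..<2 * d - 2} \<longrightarrow> realify a i = (if i = 2 * k then 1 else 0)"
    show "realify a 0 = 0 \<and> realify a 1 = 0 \<and> realify a (2 * k) = 1 \<and> realify a (2 * k + 1) = 0"
      using *[unfolded skip2(2)[OF assms], rule_format, of 0] *[unfolded skip2(2)[OF assms], rule_format, of 1]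
        *[unfolded skip2(2)[OF assms], rule_format, of "2 * k"] *[unfolded skip2(2)[OF assms], rule_format, of "2 * k + 1"] assms
      by simp
  qed (unfold skip2(2)[OF assms], use assms in auto)
  then show ?thesis
    unfolding slice_def coord_slice_def by (auto simp: realify_def complex_eq_iff)
qed

text \<open>As for the antipodal locus itself, with slices that map openly and with bounded fibres rather than
  injectively.\<close>

lemma real_dim_moduli_B1:
  assumes d: "d \<ge> 3" "odd d" shows "real_dim (subtopology (moduli_space d) (moduli_B1 d)) = enat (2 * d - 2)"
proof (rule real_dim_eqI)
  note d1 = odd_ge_1[OF d(2)]
  let ?Y = "subtopology (moduli_space d) (moduli_B1 d)" and ?Q = "\<lambda>a. mclass d (anti_join d a)"
  have qc: "continuous_map (top_of_set (slice d k)) ?Y ?Q" for k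
    by (rule continuous_map_top_of_set_subset[OF moduli_B1_continuous[OF d(2)]]) (auto simp: slice_def)
  have fib: "finite {y \<in> topspace (top_of_set (slice d k)). ?Q y = ?Q x} \<and>
      card {y \<in> topspace (top_of_set (slice d k)). ?Q y = ?Q x} \<le> (d + 2) * ((2 * d + 2) * 2)"
    if "k \<le> d" "2 * k \<noteq> d + 1" "x \<in> topspace (top_of_set (slice d k))" for x k
    using slice_fibre[OF d that(1,2), of x] that(3) by simp
  have chart: "continuous_map (top_of_set (slice d k)) (Euclidean_space (2 * d - 2)) (coord_chart (2 * d - 2) (skip2 k))"
     "inj_on (coord_chart (2 * d - 2) (skip2 k)) (topspace (top_of_set (slice d k)))"
     "open_map (top_of_set (slice d k)) (Euclidean_space (2 * d - 2)) (coord_chart (2 * d - 2) (skip2 k))"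
    if k: "1 \<le> k" "k \<le> d" for k
  proof -
    have s: "skip2 k ` {..<2 * d - 2} \<subseteq> {..<2 * Suc d}" using skip2(2)[OF k] by auto
    note c = coord_chart_maps[OF skip2(1)[OF k] s open_nonZ[OF d1] slice_eq[OF k]]
    show "continuous_map (top_of_set (slice d k)) (Euclidean_space (2 * d - 2)) (coord_chart (2 * d - 2) (skip2 k))" by (rule c(1))
    show "inj_on (coord_chart (2 * d - 2) (skip2 k)) (topspace (top_of_set (slice d k)))" using c(2) by simp
    show "open_map (top_of_set (slice d k)) (Euclidean_space (2 * d - 2)) (coord_chart (2 * d - 2) (skip2 k))" by (rule c(3))
  qed
  show "\<exists>f. embedding_map (Euclidean_space (2 * d - 2)) ?Y f"
  proof -
    have k: "1 \<le> d" "d \<le> d" "2 * d \<noteq> d + 1" using d by auto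
    have "(\<lambda>k. if k = d then 1 else 0) \<in> slice d d"
      using top_coeff_nonZ[OF d(2)] d by (simp add: slice_def)
    then have ne: "topspace (top_of_set (slice d d)) \<noteq> {}" by auto
    show ?thesis
      by (rule real_dim_ge_chart[OF slice_open_map[OF d k(2,3)] qc ne fib[OF k(2,3)] chart[OF k(1,2)]]) blast+
  qed
  fix m f assume f: "embedding_map (Euclidean_space m) ?Y f"
  have w: "(\<lambda>_. 0) \<in> topspace (Euclidean_space m)" by (simp add: topspace_Euclidean_space)
  have "f (\<lambda>_. 0) \<in> topspace ?Y" 
    by (rule subsetD[OF continuous_map_image_subset_topspace[OF embedding_imp_continuous_inj(1)[OF f]] imageI[OF w]])
  then have "f (\<lambda>_. 0) \<in> moduli_B1 d" by simp
  then obtain k a where k: "k \<le> d" "k \<noteq> 0" "2 * k \<noteq> d + 1" and a: "a \<in> slice d k" "f (\<lambda>_. 0) = ?Q a"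
    by (rule slice_cover[OF d])
  have k1: "1 \<le> k" using k(2) by simp
  have at: "a \<in> topspace (top_of_set (slice d k))" using a(1) by simp
  show "m \<le> 2 * d - 2"
  proof (rule real_dim_le_chart[where X = "top_of_set (slice d k)" and q = ?Q and x = a])
    show "open_map (top_of_set (slice d k)) ?Y ?Q" by (rule slice_open_map[OF d k(1,3)])
    show "continuous_map (top_of_set (slice d k)) ?Y ?Q" by (rule qc)
  qed (fact fib[OF k(1,3)] chart(1,2)[OF k1 k(1)] f at w a(2))+
qed

section \<open>Connectedness of the parameter space\<close>

text \<open>A pair \<open>(u, v)\<close> stands for the linear factor \<open>u x + v y\<close>, so that factors vanishing at infinity
  are included.\<close>

definition lin_prod :: "(complex \<times> complex) list \<Rightarrow> complex poly" where
  "lin_prod us = prod_list (map (\<lambda>u. [:snd u, fst u:]) us)"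

definition herm :: "complex \<times> complex \<Rightarrow> complex \<times> complex \<Rightarrow> complex" where
  "herm u v = fst u * cnj (fst v) + snd u * cnj (snd v)"

lemma lin_prod_simps: "lin_prod [] = 1" "lin_prod (u # us) = [:snd u, fst u:] * lin_prod us"
  "lin_prod (us @ vs) = lin_prod us * lin_prod vs"
  by (simp_all add: lin_prod_def)

lemma degree_lin_prod: "degree (lin_prod us) \<le> length us"
proof (induction us)
  case (Cons u us)
  then show ?case unfolding lin_prod_simps length_Cons by (rule degree_lin_mult)
qed (simp add: lin_prod_simps)

lemma lin_prod_cvec: "length us = d \<Longrightarrow> coeff (lin_prod us) \<in> cvec (Suc d)"
  using degree_lin_prod[of us] by (auto simp: cvec_def intro!: coeff_eq_0)

lemma form_lin_prod:
  "form (length us) (coeff (lin_prod us)) x y = (\<Prod>u\<leftarrow>us. fst u * x + snd u * y)"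
proof (induction us)
  case Nil then show ?case by (simp add: form_def lin_prod_simps)
next
  case (Cons u us)
  have "form (Suc (length us)) (coeff (lin_prod (u # us))) x y =
      (fst u * x + snd u * y) * form (length us) (coeff (lin_prod us)) x y"
    unfolding lin_prod_simps by (rule form_lin_mult[OF degree_lin_prod])
  then show ?case using Cons by simp
qed

lemma form_lin_prod_eq_0: "length us = d \<Longrightarrow> form d (coeff (lin_prod us)) x y = 0 \<longleftrightarrow> (\<exists>u\<in>set us. fst u * x + snd u * y = 0)"
  using form_lin_prod[of us x y] by (simp add: prod_list_zero_iff image_iff)

lemma poly_factorization:
  fixes p :: "complex poly"
  assumes "p \<noteq> 0" "degree p \<le> d"
  shows "\<exists>us c. length us = d \<and> c \<noteq> 0 \<and> p = smult c (lin_prod us)"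
  using assms
proof (induction d arbitrary: p)
  case 0
  then have "degree p = 0" by simp
  then obtain c where c: "p = [:c:]" by (rule degree_eq_zeroE)
  have "c \<noteq> 0" using 0(1) c by auto
  then show ?case unfolding c by (intro exI[of _ "[]"] exI[of _ c]) (simp add: lin_prod_simps)
next
  case (Suc d)
  show ?case
  proof (cases "degree p \<le> d")
    case True
    then obtain us c where "length us = d" "c \<noteq> 0" "p = smult c (lin_prod us)"
      using Suc.IH[OF Suc.prems(1)] by blast
    \<comment> \<open>The missing degree is made up by a factor with its zero at infinity.\<close>
    then show ?thesis by (intro exI[of _ "(0, 1) # us"] exI[of _ c]) (simp add: lin_prod_simps)
  next
    case False
    then obtain z where "poly p z = 0"
      using fundamental_theorem_of_algebra[of p] by (auto simp: constant_degree)
    then obtain p' where p': "p = [:-z, 1:] * p'" by (meson dvdE poly_eq_0_iff_dvd)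
    have p0: "p' \<noteq> 0" using Suc.prems(1) p' by auto
    have "degree p = Suc (degree p')"
      unfolding p' using p0 by (subst degree_mult_eq) auto
    then have "degree p' \<le> d" using Suc.prems(2) by simp
    then obtain us c where us: "length us = d" "c \<noteq> 0" "p' = smult c (lin_prod us)"
      using Suc.IH[OF p0] by blast
    have "p = smult c (lin_prod ((1, - z) # us))" unfolding p' us(3) lin_prod_simps by (simp only: mult_smult_right fst_conv snd_conv)
    then show ?thesis using us by (intro exI[of _ "(1, - z) # us"] exI[of _ c]) simp
  qed
qed

lemma herm_self: "herm u u = 0 \<longleftrightarrow> u = (0, 0)"
proof -
  have "herm u u = complex_of_real (cmod (fst u) ^ 2 + cmod (snd u) ^ 2)"
    unfolding herm_def of_real_add complex_norm_square ..
  then have "herm u u = 0 \<longleftrightarrow> cmod (fst u) ^ 2 + cmod (snd u) ^ 2 = 0" by (simp only: of_real_eq_0_iff)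
  also have "\<dots> \<longleftrightarrow> u = (0, 0)" by (cases u) (auto simp: add_nonneg_eq_0_iff)
  finally show ?thesis .
qed

lemma herm_cnj: "herm v u = cnj (herm u v)" by (simp add: herm_def mult.commute)

definition nonorth :: "(complex \<times> complex) list \<Rightarrow> bool" where
  "nonorth us \<longleftrightarrow> (\<forall>u\<in>set us. \<forall>v\<in>set us. herm u v \<noteq> 0)"

text \<open>The zero of a linear factor \<open>v\<close> has as its antipode a zero of \<open>u\<close> exactly if \<open>u\<close> and \<open>v\<close> are
  orthogonal. Thus the parameter is nondegenerate if and only if no two factors are orthogonal; for
  \<open>u = v\<close> this says that the factor is not zero.\<close>

lemma lin_prod_nonZ_iff:
  assumes d: "odd d" and us: "length us = d"
  shows "coeff (lin_prod us) \<in> nonZ d \<longleftrightarrow> nonorth us"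
proof -
  note d1 = odd_ge_1[OF d] and cv = lin_prod_cvec[OF us] and z = form_lin_prod_eq_0[OF us]
  let ?a = "coeff (lin_prod us)"
  have A: "coeff (lin_prod us) \<in> nonZ d \<longleftrightarrow>
     (\<forall>x y. (x, y) \<noteq> (0, 0) \<longrightarrow> form d ?a x y = 0 \<longrightarrow> form d ?a (- cnj y) (cnj x) \<noteq> 0)"
    unfolding nonZ_iff[OF d1] nondeg_def common_zero_def numer_anti[OF cv] denom_anti form_antipodal[OF d]
    using cv by auto
  show ?thesis
  proof
    assume nz: "coeff (lin_prod us) \<in> nonZ d"
    have us0: "u \<noteq> (0, 0)" if u: "u \<in> set us" for u
    proof
      assume "u = (0, 0)"
      then have "form d ?a x y = 0" for x y using z u by force
      then show False using nz A[THEN iffD1, rule_format, of 1 0] by auto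
    qed
    show "nonorth us" unfolding nonorth_def
    proof (intro ballI notI)
      fix u v assume uv: "u \<in> set us" "v \<in> set us" and h: "herm u v = 0"
      have "(snd v, - fst v) \<noteq> (0, 0)" using us0[OF uv(2)] by (cases v) auto
      moreover have "form d ?a (snd v) (- fst v) = 0" unfolding z by (intro bexI[OF _ uv(2)]) simp
      moreover have "form d ?a (- cnj (- fst v)) (cnj (snd v)) = 0"
        unfolding z using h by (intro bexI[OF _ uv(1)]) (simp add: herm_def)
      ultimately show False using nz A by blast
    qed
  next
    assume no: "nonorth us"
    show "coeff (lin_prod us) \<in> nonZ d" unfolding A
    proof (intro allI impI notI)
      fix x y assume xy: "(x, y) \<noteq> (0 :: complex, 0 :: complex)" "form d ?a x y = 0" "form d ?a (- cnj y) (cnj x) = 0"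
      obtain v where v: "v \<in> set us" "fst v * x + snd v * y = 0" using xy(2) z by blast
      obtain u where u: "u \<in> set us" "fst u * (- cnj y) + snd u * cnj x = 0" using xy(3) z by blast
      have "herm u v \<noteq> 0" using no u(1) v(1) by (simp add: nonorth_def)
      then have det: "snd u * cnj (snd v) - (- fst u) * cnj (fst v) \<noteq> 0" by (simp add: herm_def add.commute)
      have nz: "(cnj x, cnj y) \<noteq> (0, 0)" using xy(1) by simp
      have "cnj (fst v) * cnj x + cnj (snd v) * cnj y = 0" using arg_cong[OF v(2), of cnj] by simp
      then show False using lin_nonzero[OF det nz] u(2) by simp
    qed
  qed
qed

text \<open>On the complex line through \<open>u\<close> and \<open>u'\<close> each of the other factors excludes at most one parameter,
  and the plane minus finitely many points is connected. With at least one other factor the moving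
  factor never becomes zero on the rest of the line, as it is not orthogonal to that other factor.\<close>

lemma move_factor:
  assumes d: "odd d" and len: "length (xs @ u # ys) = d" and ne: "xs @ ys \<noteq> []"
    and no: "nonorth (xs @ u # ys)" "nonorth (xs @ u' # ys)"
  shows "connected_component (nonZ d) (coeff (lin_prod (xs @ u # ys))) (coeff (lin_prod (xs @ u' # ys)))"
proof -
  define w where "w s = (fst u + s * (fst u' - fst u), snd u + s * (snd u' - snd u))" for s
  define K where "K s = coeff (lin_prod (xs @ w s # ys))" for s
  define bad where "bad = (\<Union>v\<in>set (xs @ ys). {s. herm (w s) v = 0})"
  have hw: "herm (w s) v = herm u v + s * (herm u' v - herm u v)" for s v
    by (simp add: w_def herm_def algebra_simps)
  have "finite {s. herm (w s) v = 0}" if v: "v \<in> set (xs @ ys)" for v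
  proof (rule finite_subset)
    have "herm u v \<noteq> 0" using no(1) v by (auto simp: nonorth_def)
    show "{s. herm (w s) v = 0} \<subseteq> {- herm u v / (herm u' v - herm u v)}"
    proof
      fix s assume "s \<in> {s. herm (w s) v = 0}"
      then have e: "herm u v + s * (herm u' v - herm u v) = 0" using hw by simp
      have nz: "herm u' v - herm u v \<noteq> 0"
      proof
        assume "herm u' v - herm u v = 0"
        then show False using e \<open>herm u v \<noteq> 0\<close> by simp
      qed
      have "s * (herm u' v - herm u v) = - herm u v"
        unfolding eq_neg_iff_add_eq_0 using e by (simp only: add.commute)
      then have "s = - herm u v / (herm u' v - herm u v)" using nonzero_eq_divide_eq[OF nz, of s "- herm u v"] by blast
      then show "s \<in> {- herm u v / (herm u' v - herm u v)}" by simp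
    qed
  qed simp
  then have "finite bad" unfolding bad_def by (intro finite_UN_I) auto
  then have conn: "connected (UNIV - bad)"
    by (intro connected_open_diff_countable) (auto intro: countable_finite)
  have sub: "K s \<in> nonZ d" if s: "s \<notin> bad" for s
  proof -
    have 1: "herm (w s) v \<noteq> 0" if "v \<in> set (xs @ ys)" for v using s that by (auto simp: bad_def)
    have 2: "herm v (w s) \<noteq> 0" if "v \<in> set (xs @ ys)" for v
      using 1[OF that] herm_cnj[of v "w s"] by simp
    have 3: "herm (w s) (w s) \<noteq> 0"
    proof -
      obtain v where "v \<in> set (xs @ ys)" using ne by (meson list.set_sel(1))
      then have "w s \<noteq> (0, 0)" using 1[of v] by (auto simp: herm_def)
      then show ?thesis using herm_self by blast
    qed
    have 4: "herm v v' \<noteq> 0" if "v \<in> set (xs @ ys)" "v' \<in> set (xs @ ys)" for v v'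
      using no(1) that by (auto simp: nonorth_def)
    have "nonorth (xs @ w s # ys)" unfolding nonorth_def
    proof (intro ballI)
      fix v v' assume "v \<in> set (xs @ w s # ys)" "v' \<in> set (xs @ w s # ys)"
      then have "v = w s \<or> v \<in> set (xs @ ys)" "v' = w s \<or> v' \<in> set (xs @ ys)" by auto
      then show "herm v v' \<noteq> 0" using 1 2 3 4 by blast
    qed
    then show ?thesis unfolding K_def using lin_prod_nonZ_iff[OF d, of "xs @ w s # ys"] len by simp
  qed
  have "continuous_on (UNIV - bad) K"
  proof (rule continuous_on_coordinatewise_then_product)
    fix k
    define p0 where "p0 = lin_prod xs * ([:snd u, fst u:] * lin_prod ys)"
    define p1 where "p1 = lin_prod xs * ([:snd u' - snd u, fst u' - fst u:] * lin_prod ys)"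
    have "K s k = coeff p0 k + s * coeff p1 k" for s
    proof -
      have "[:snd (w s), fst (w s):] = [:snd u, fst u:] + smult s [:snd u' - snd u, fst u' - fst u:]" by (simp add: w_def)
      then have "lin_prod (xs @ w s # ys) = p0 + smult s p1"
        unfolding lin_prod_simps p0_def p1_def by (simp only: distrib_left distrib_right mult_smult_left mult_smult_right)
      then show ?thesis by (simp add: K_def)
    qed
    then show "continuous_on (UNIV - bad) (\<lambda>s. K s k)" by (auto intro!: continuous_intros)
  qed
  then have "connected (K ` (UNIV - bad))" using conn by (rule connected_continuous_image)
  moreover have "K ` (UNIV - bad) \<subseteq> nonZ d" using sub by blast
  moreover have "0 \<notin> bad" "1 \<notin> bad"
    using no unfolding bad_def hw nonorth_def by auto
  moreover have "K 0 = coeff (lin_prod (xs @ u # ys))" "K 1 = coeff (lin_prod (xs @ u' # ys))"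
    by (simp_all add: K_def w_def)
  ultimately show ?thesis unfolding connected_component_def by (metis Diff_iff UNIV_I imageI)
qed

lemma nonorth_mono: "nonorth us \<Longrightarrow> set vs \<subseteq> set us \<Longrightarrow> nonorth vs"
  unfolding nonorth_def by blast

text \<open>Each further factor can be moved to \<open>u\<close>, since \<open>u\<close> is already among the factors and thus not
  orthogonal to any of them.\<close>

lemma gather_factors:
  assumes d: "odd d" and "nonorth (replicate (Suc n) u @ rest)" "length (replicate (Suc n) u @ rest) = d"
  shows "connected_component (nonZ d) (coeff (lin_prod (replicate (Suc n) u @ rest))) (coeff (lin_prod (replicate d u)))"
  using assms(2,3)
proof (induction rest arbitrary: n)
  case Nil
  have e: "replicate (Suc n) u @ [] = replicate d u" using Nil(2) by simp
  have "coeff (lin_prod (replicate (Suc n) u @ [])) \<in> nonZ d" using lin_prod_nonZ_iff[OF d Nil(2)] Nil(1) by blast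
  then show ?case unfolding e by (rule connected_component_refl)
next
  case (Cons v rest)
  have no: "nonorth (replicate (Suc n) u @ u # rest)" by (rule nonorth_mono[OF Cons.prems(1)]) auto
  have "connected_component (nonZ d) (coeff (lin_prod (replicate (Suc n) u @ v # rest))) (coeff (lin_prod (replicate (Suc n) u @ u # rest)))"
    by (rule move_factor[OF d Cons.prems(2) _ Cons.prems(1) no]) simp
  moreover have e: "replicate (Suc n) u @ u # rest = replicate (Suc (Suc n)) u @ rest"
    by (simp add: replicate_app_Cons_same)
  moreover have "connected_component (nonZ d) (coeff (lin_prod (replicate (Suc (Suc n)) u @ rest))) (coeff (lin_prod (replicate d u)))"
    using Cons.IH[of "Suc n"] no Cons.prems(2) unfolding e by simp
  ultimately show ?case using connected_component_trans by metis
qed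

text \<open>If \<open>u\<close> and \<open>v\<close> are orthogonal, then neither is orthogonal to \<open>u + v\<close>, which serves as an
  intermediate stop.\<close>

lemma powers_connected:
  assumes d: "odd d" "d \<ge> 2" and u: "herm u u \<noteq> 0" "herm v v \<noteq> 0"
  shows "connected_component (nonZ d) (coeff (lin_prod (replicate d u))) (coeff (lin_prod (replicate d v)))"
proof -
  have step: "connected_component (nonZ d) (coeff (lin_prod (replicate d u))) (coeff (lin_prod (replicate d v)))"
    if h: "herm u u \<noteq> 0" "herm v v \<noteq> 0" "herm u v \<noteq> 0" for u v
  proof -
    have vu: "herm v u \<noteq> 0" using h(3) herm_cnj[of v u] by simp
    obtain m where m: "d = Suc (Suc m)" using d(2) by (metis One_nat_def Suc_1 Suc_le_D Suc_le_mono)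
    have no: "nonorth ([] @ u # replicate (Suc m) u)" "nonorth ([] @ v # replicate (Suc m) u)"
      using h vu by (auto simp: nonorth_def)
    have c1: "connected_component (nonZ d) (coeff (lin_prod ([] @ u # replicate (Suc m) u))) (coeff (lin_prod ([] @ v # replicate (Suc m) u)))"
      by (rule move_factor[OF d(1) _ _ no]) (simp_all add: m)
    have c2: "connected_component (nonZ d) (coeff (lin_prod (replicate (Suc 0) v @ replicate (Suc m) u))) (coeff (lin_prod (replicate d v)))"
      by (rule gather_factors[OF d(1)]) (use no(2) m in simp_all)
    have l1: "[] @ u # replicate (Suc m) u = replicate d u"
      and l2: "replicate (Suc 0) v @ replicate (Suc m) u = [] @ v # replicate (Suc m) u" by (simp_all add: m)
    show ?thesis using connected_component_trans[OF c1 c2[unfolded l2]] unfolding l1 .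
  qed
  show ?thesis
  proof (cases "herm u v = 0")
    case False then show ?thesis using step u by blast
  next
    case True
    define w where "w = (fst u + fst v, snd u + snd v)"
    have vu: "herm v u = 0" using True herm_cnj[of v u] by simp
    have "herm u w = herm u u + herm u v" "herm w v = herm u v + herm v v" "herm w w = herm u w + herm v u + herm v v"
      by (simp_all add: w_def herm_def algebra_simps)
    then have h: "herm u w \<noteq> 0" "herm w v \<noteq> 0" using True u by simp_all
    have "w \<noteq> (0, 0)" using h(1) by (auto simp: herm_def)
    then have "herm w w \<noteq> 0" using herm_self by blast
    then show ?thesis using step[OF u(1) _ h(1)] step[OF _ u(2) h(2)] connected_component_trans by metis
  qed
qed

lemma connected_nonZ:
  assumes d: "odd d" "d \<ge> 2" shows "connected (nonZ d)"
proof -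
  define e where "e = (1 :: complex, 0 :: complex)"
  have e: "herm e e \<noteq> 0" by (simp add: herm_def e_def)
  have d1: "d \<ge> 1" using d by simp
  have base: "connected_component (nonZ d) a (coeff (lin_prod (replicate d e)))" if a: "a \<in> nonZ d" for a
  proof -
    have cv: "a \<in> cvec (Suc d)" by (rule nonZ_cvec[OF a])
    obtain k where k: "k \<le> d" "a k \<noteq> 0" using nonZ_nonzero[OF d1 a] by blast
    have "vec_poly d a \<noteq> 0" using k coeff_vec_poly[of d a k] by auto
    then obtain us c where us: "length us = d" "c \<noteq> 0" "vec_poly d a = smult c (lin_prod us)"
      using poly_factorization[OF _ degree_vec_poly] by blast
    have ac: "a = coeff (vec_poly d a)" using cv by (auto simp: coeff_vec_poly cvec_def fun_eq_iff)
    obtain u rest where ur: "us = u # rest" using us(1) d by (cases us) auto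
    \<comment> \<open>The constant is absorbed into one of the factors.\<close>
    define u' where "u' = (c * fst u, c * snd u)"
    have "[:snd u', fst u':] = smult c [:snd u, fst u:]" by (simp add: u'_def)
    then have "lin_prod (u' # rest) = smult c (lin_prod us)"
      unfolding ur lin_prod_simps by (simp only: mult_smult_left)
    then have a': "a = coeff (lin_prod (replicate (Suc 0) u' @ rest))" using ac us(3) by simp
    have len: "length (replicate (Suc 0) u' @ rest) = d" using us(1) ur by simp
    have no: "nonorth (replicate (Suc 0) u' @ rest)" using a lin_prod_nonZ_iff[OF d(1) len] a' by simp
    have hu: "herm u' u' \<noteq> 0" using no by (auto simp: nonorth_def)
    show ?thesis
      by (subst a') (rule connected_component_trans[OF gather_factors[OF d(1) no len] powers_connected[OF d hu e]])
  qed
  show ?thesis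
    unfolding connected_iff_connected_component
    by (intro ballI) (rule connected_component_trans[OF base connected_component_sym[OF base]])
qed

lemma B1_connected:
  assumes d: "odd d" "d \<ge> 2" shows "connectedin (Rat_space d) (B1 d)" "connectedin (moduli_space d) (moduli_B1 d)"
proof -
  have c: "connectedin (top_of_set (nonZ d)) (nonZ d)"
    using connected_nonZ[OF d] by (simp add: connectedin_subtopology)
  have "continuous_map (top_of_set (nonZ d)) (Rat_space d) (\<lambda>a. proj_class (anti_join d a))"
    using B1_continuous[OF d(1)] by (simp add: continuous_map_in_subtopology)
  from connectedin_continuous_map_image[OF this c] show "connectedin (Rat_space d) (B1 d)" unfolding B1_eq[OF d(1)] .
  have "continuous_map (top_of_set (nonZ d)) (moduli_space d) (\<lambda>a. mclass d (anti_join d a))"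
    using moduli_B1_continuous[OF d(1)] by (simp add: continuous_map_in_subtopology)
  from connectedin_continuous_map_image[OF this c] show "connectedin (moduli_space d) (moduli_B1 d)" unfolding moduli_B1_eq[OF d(1)] .
qed

section \<open>Power series of quotients of affine functions\<close>

definition midx :: "nat \<Rightarrow> (nat \<Rightarrow> nat) set" where "midx n = {\<alpha>. \<forall>i\<ge>n. \<alpha> i = 0}"

definition complex_power_series_at :: "nat \<Rightarrow> ((nat \<Rightarrow> real) \<Rightarrow> complex) \<Rightarrow> (nat \<Rightarrow> real) \<Rightarrow> bool" where
  "complex_power_series_at n f x \<longleftrightarrow> (\<exists>r>0. \<exists>c :: (nat \<Rightarrow> nat) \<Rightarrow> complex.
     \<forall>y\<in>topspace (Euclidean_space n). (\<forall>i<n. \<bar>y i - x i\<bar> < r) \<longrightarrow>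
       ((\<lambda>\<alpha>. c \<alpha> * complex_of_real (\<Prod>i<n. (y i - x i) ^ \<alpha> i)) has_sum f y) (midx n))"

lemma real_analytic_at_Re:
  assumes "complex_power_series_at n f x" shows "real_analytic_at n (\<lambda>y. Re (f y)) x"
proof -
  obtain r c where r: "r > 0" and c: "\<And>y. y \<in> topspace (Euclidean_space n) \<Longrightarrow> (\<forall>i<n. \<bar>y i - x i\<bar> < r) \<Longrightarrow>
       ((\<lambda>\<alpha>. c \<alpha> * complex_of_real (\<Prod>i<n. (y i - x i) ^ \<alpha> i)) has_sum f y) (midx n)"
    using assms unfolding complex_power_series_at_def by blast
  show ?thesis unfolding real_analytic_at_def midx_def[symmetric]
  proof (rule exI, rule conjI, rule r, rule exI, intro ballI impI)
    fix y assume y: "y \<in> topspace (Euclidean_space n)" "\<forall>i<n. \<bar>y i - x i\<bar> < r"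
    show "((\<lambda>\<alpha>. Re (c \<alpha>) * (\<Prod>i<n. (y i - x i) ^ \<alpha> i)) has_sum Re (f y)) (midx n)"
      using has_sum_Re[OF c[OF y]] by (simp del: of_real_prod of_real_power)
  qed
qed

lemma real_analytic_at_Im:
  assumes "complex_power_series_at n f x" shows "real_analytic_at n (\<lambda>y. Im (f y)) x"
proof -
  obtain r c where r: "r > 0" and c: "\<And>y. y \<in> topspace (Euclidean_space n) \<Longrightarrow> (\<forall>i<n. \<bar>y i - x i\<bar> < r) \<Longrightarrow>
       ((\<lambda>\<alpha>. c \<alpha> * complex_of_real (\<Prod>i<n. (y i - x i) ^ \<alpha> i)) has_sum f y) (midx n)"
    using assms unfolding complex_power_series_at_def by blast
  show ?thesis unfolding real_analytic_at_def midx_def[symmetric]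
  proof (rule exI, rule conjI, rule r, rule exI, intro ballI impI)
    fix y assume y: "y \<in> topspace (Euclidean_space n)" "\<forall>i<n. \<bar>y i - x i\<bar> < r"
    show "((\<lambda>\<alpha>. Im (c \<alpha>) * (\<Prod>i<n. (y i - x i) ^ \<alpha> i)) has_sum Im (f y)) (midx n)"
      using has_sum_Im[OF c[OF y]] by (simp del: of_real_prod of_real_power)
  qed
qed

lemma real_analytic_at_cong:
  assumes f: "real_analytic_at n f x" and e: "e > 0"
    and eq: "\<And>y. y \<in> topspace (Euclidean_space n) \<Longrightarrow> (\<forall>i<n. \<bar>y i - x i\<bar> < e) \<Longrightarrow> g y = f y"
  shows "real_analytic_at n g x"
proof -
  obtain r c where r: "r > 0" and c: "\<And>y. y \<in> topspace (Euclidean_space n) \<Longrightarrow> (\<forall>i<n. \<bar>y i - x i\<bar> < r) \<Longrightarrow>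
       ((\<lambda>\<alpha>. c \<alpha> * (\<Prod>i<n. (y i - x i) ^ \<alpha> i)) has_sum f y) {\<alpha>. \<forall>i\<ge>n. \<alpha> i = 0}"
    using f unfolding real_analytic_at_def by blast
  show ?thesis unfolding real_analytic_at_def
  proof (intro exI[of _ "min r e"] conjI exI[of _ c] ballI impI)
    show "min r e > 0" using r e by simp
    fix y assume y: "y \<in> topspace (Euclidean_space n)" "\<forall>i<n. \<bar>y i - x i\<bar> < min r e"
    then have "\<forall>i<n. \<bar>y i - x i\<bar> < r" "\<forall>i<n. \<bar>y i - x i\<bar> < e" by auto
    then show "((\<lambda>\<alpha>. c \<alpha> * (\<Prod>i<n. (y i - x i) ^ \<alpha> i)) has_sum g y) {\<alpha>. \<forall>i\<ge>n. \<alpha> i = 0}"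
      using c[OF y(1)] eq[OF y(1)] by simp
  qed
qed

lemma has_sum_group:
  fixes f :: "'a \<Rightarrow> complex"
  assumes f: "(f has_sum S) A" and m: "m ` A \<subseteq> B" and fin: "\<And>b. b \<in> B \<Longrightarrow> finite {a \<in> A. m a = b}"
  shows "((\<lambda>b. \<Sum>a\<in>{a \<in> A. m a = b}. f a) has_sum S) B"
proof -
  define P where "P = Sigma B (\<lambda>b. {a \<in> A. m a = b})"
  have inj: "inj_on snd P" by (rule inj_onI) (auto simp: P_def)
  have "A = snd ` P"
  proof
    show "A \<subseteq> snd ` P"
    proof
      fix a assume "a \<in> A"
      then have "(m a, a) \<in> P" using m by (auto simp: P_def)
      then show "a \<in> snd ` P" by force
    qed
  qed (auto simp: P_def)
  then have "(f has_sum S) (snd ` P)" using f by simp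
  then have "((f \<circ> snd) has_sum S) P" using has_sum_reindex[OF inj] by blast
  then have P: "((\<lambda>(b, a). f a) has_sum S) (Sigma B (\<lambda>b. {a \<in> A. m a = b}))"
    unfolding P_def comp_def by (simp add: case_prod_beta')
  show ?thesis
    by (rule has_sum_SigmaD[OF P]) (use fin in simp)
qed

lemma sum_lists_length:
  fixes g :: "nat \<Rightarrow> 'a::comm_semiring_1"
  shows "(\<Sum>w\<in>{w \<in> lists {..<n}. length w = k}. prod_list (map g w)) = (\<Sum>j<n. g j) ^ k"
    and "finite {w \<in> lists {..<n::nat}. length w = k}"
proof (induction k)
  case 0
  have e: "{w \<in> lists {..<n}. length w = 0} = {[]}" by auto
  { case 1 show ?case unfolding e by simp }
  { case 2 show ?case unfolding e by simp }
next
  case (Suc k)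
  have e: "{w \<in> lists {..<n}. length w = Suc k} = (\<lambda>(j, w). j # w) ` ({..<n} \<times> {w \<in> lists {..<n}. length w = k})"
    by (auto simp: image_iff length_Suc_conv)
  have inj: "inj_on (\<lambda>(j, w). j # w) ({..<n} \<times> {w \<in> lists {..<n}. length w = k})" by (rule inj_onI) auto
  { case 1
    have "(\<Sum>w\<in>{w \<in> lists {..<n}. length w = Suc k}. prod_list (map g w)) =
        (\<Sum>(j, w)\<in>{..<n} \<times> {w \<in> lists {..<n}. length w = k}. g j * prod_list (map g w))"
      unfolding e sum.reindex[OF inj] by (rule sum.cong) auto
    also have "\<dots> = (\<Sum>j<n. g j) * (\<Sum>w\<in>{w \<in> lists {..<n}. length w = k}. prod_list (map g w))"
      by (simp only: sum_product sum.cartesian_product)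
    finally show ?case using Suc.IH(1) by simp }
  { case 2 show ?case unfolding e using Suc.IH by simp }
qed

text \<open>The geometric series of a sum is expanded into words, for which no multinomial coefficients are
  needed. The partial sums over words of one length are the powers of the sum.\<close>

lemma lists_geometric:
  fixes f :: "nat \<Rightarrow> complex"
  assumes q: "(\<Sum>j<n. cmod (f j)) < 1"
  shows "((\<lambda>w. prod_list (map f w)) has_sum (1 / (1 - (\<Sum>j<n. f j)))) (lists {..<n})"
proof -
  define Q where "Q = (\<Sum>j<n. cmod (f j))"
  have Q: "0 \<le> Q" "Q < 1" using q by (auto simp: Q_def sum_nonneg)
  have norm_prod: "norm (prod_list (map f w)) = prod_list (map (\<lambda>j. cmod (f j)) w)" for w
    by (induction w) (simp_all add: norm_mult)
  have "(\<lambda>w. norm (prod_list (map f w))) summable_on lists {..<n}"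
  proof (rule nonneg_bdd_above_summable_on)
    show "bdd_above (sum (\<lambda>w. norm (prod_list (map f w))) ` {F. F \<subseteq> lists {..<n} \<and> finite F})"
  proof (rule bdd_aboveI2)
    fix F assume F: "F \<in> {F. F \<subseteq> lists {..<n} \<and> finite F}"
    define K where "K = Max (insert 0 (length ` F))"
    have len: "length w \<le> K" if "w \<in> F" for w unfolding K_def using F that by (intro Max_ge) auto
    let ?L = "\<lambda>k. {w \<in> lists {..<n}. length w = k}"
    have "(\<Sum>w\<in>F. norm (prod_list (map f w))) \<le> (\<Sum>w\<in>(\<Union>k\<le>K. ?L k). norm (prod_list (map f w)))"
    proof (rule sum_mono2)
      show "finite (\<Union>k\<le>K. ?L k)" using sum_lists_length(2) by blast
      show "F \<subseteq> (\<Union>k\<le>K. ?L k)"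
      proof
        fix w assume w: "w \<in> F"
        then have "w \<in> ?L (length w)" using F by blast
        then show "w \<in> (\<Union>k\<le>K. ?L k)" using len[OF w] by blast
      qed
    qed simp
    also have "\<dots> = (\<Sum>k\<le>K. \<Sum>w\<in>?L k. norm (prod_list (map f w)))"
      using sum_lists_length(2) by (intro sum.UNION_disjoint) auto
    also have "\<dots> = (\<Sum>k\<le>K. Q ^ k)" unfolding norm_prod sum_lists_length(1) Q_def ..
    also have "\<dots> \<le> suminf (\<lambda>k. Q ^ k)" using Q by (intro sum_le_suminf summable_geometric) auto
    also have "\<dots> = 1 / (1 - Q)" using Q by (intro suminf_geometric) simp
    finally show "(\<Sum>w\<in>F. norm (prod_list (map f w))) \<le> 1 / (1 - Q)" .
  qed
  qed simp
  then have "(\<lambda>w. prod_list (map f w)) summable_on lists {..<n}" by (rule abs_summable_summable)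
  then obtain S where S: "((\<lambda>w. prod_list (map f w)) has_sum S) (lists {..<n})" unfolding summable_on_def by blast
  have "((\<lambda>k. \<Sum>w\<in>{w \<in> lists {..<n}. length w = k}. prod_list (map f w)) has_sum S) UNIV"
    by (rule has_sum_group[OF S]) (use sum_lists_length(2) in auto)
  then have "((\<lambda>k. (\<Sum>j<n. f j) ^ k) has_sum S) UNIV" unfolding sum_lists_length(1) .
  then have "(\<lambda>k. (\<Sum>j<n. f j) ^ k) sums S" by (rule has_sum_imp_sums)
  moreover have "cmod (\<Sum>j<n. f j) < 1" using norm_sum[of f "{..<n}"] q by linarith
  then have "(\<lambda>k. (\<Sum>j<n. f j) ^ k) sums (1 / (1 - (\<Sum>j<n. f j)))" by (rule geometric_sums)
  ultimately have "S = 1 / (1 - (\<Sum>j<n. f j))" by (rule sums_unique2)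
  then show ?thesis using S by simp
qed

lemma prod_list_count:
  fixes h :: "nat \<Rightarrow> 'a::comm_semiring_1"
  assumes "w \<in> lists {..<n}"
  shows "prod_list (map h w) = (\<Prod>i<n. h i ^ count_list w i)"
  using assms
proof (induction w)
  case (Cons j w)
  then have j: "j < n" by simp
  have "(\<Prod>i<n. h i ^ count_list (j # w) i) = (\<Prod>i<n. (if i = j then h j else 1) * h i ^ count_list w i)"
    by (rule prod.cong) auto
  also have "\<dots> = h j * (\<Prod>i<n. h i ^ count_list w i)" using j by (simp add: prod.distrib)
  finally show ?case using Cons by simp
qed simp

lemma length_count: "w \<in> lists {..<n::nat} \<Longrightarrow> length w = (\<Sum>i<n. count_list w i)"
proof (induction w)
  case (Cons j w)
  have "(\<Sum>i<n. count_list (j # w) i) = (\<Sum>i<n. (if i = j then 1 else 0) + count_list w i)"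
    by (rule sum.cong) auto
  then show ?case using Cons by (simp add: sum.distrib)
qed simp

text \<open>With \<open>1 / D = (1 / D0) (1 / (1 - f))\<close>, where \<open>f\<close> is linear and small near \<open>x\<close>, the expansion into
  words applies. The words are grouped by the multi-index counting their letters.\<close>

lemma complex_power_series_recip:
  fixes D :: "(nat \<Rightarrow> real) \<Rightarrow> complex" and e :: "nat \<Rightarrow> complex"
  assumes D: "\<And>y. y \<in> topspace (Euclidean_space n) \<Longrightarrow> D y = D0 + (\<Sum>i<n. e i * complex_of_real (y i - x i))"
    and D0: "D0 \<noteq> 0"
  shows "complex_power_series_at n (\<lambda>y. 1 / D y) x"
proof -
  define E where "E i = - (e i / D0)" for i
  \<comment> \<open>In the cube of radius \<open>1 / M\<close> the moduli of the summands of \<open>f\<close> add up to less than 1.\<close>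
  define M where "M = 1 + (\<Sum>i<n. cmod (E i))"
  have M: "M > 0" unfolding M_def by (simp add: add_pos_nonneg sum_nonneg)
  define cf where "cf \<alpha> = 1 / D0 * (\<Sum>w\<in>{w \<in> lists {..<n}. count_list w = \<alpha>}. prod_list (map E w))" for \<alpha>
  show ?thesis unfolding complex_power_series_at_def
  proof (intro exI[of _ "1 / M"] conjI exI[of _ cf] ballI impI)
    show "1 / M > 0" using M by simp
    fix y assume y: "y \<in> topspace (Euclidean_space n)" "\<forall>i<n. \<bar>y i - x i\<bar> < 1 / M"
    define f where "f i = E i * complex_of_real (y i - x i)" for i
    have "(\<Sum>i<n. cmod (f i)) \<le> (\<Sum>i<n. cmod (E i) * (1 / M))"
    proof (rule sum_mono)
      fix i assume "i \<in> {..<n}"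
      then have "\<bar>y i - x i\<bar> \<le> 1 / M" using y(2) by (simp add: less_imp_le)
      then show "cmod (f i) \<le> cmod (E i) * (1 / M)"
        unfolding f_def norm_mult norm_of_real by (intro mult_left_mono) auto
    qed
    also have "\<dots> = (\<Sum>i<n. cmod (E i)) / M" by (simp add: sum_divide_distrib)
    also have "\<dots> < 1" using M by (simp add: M_def)
    finally have q: "(\<Sum>i<n. cmod (f i)) < 1" .
    have fin: "finite {w \<in> lists {..<n}. count_list w = \<alpha>}" for \<alpha>
    proof (rule finite_subset)
      show "{w \<in> lists {..<n}. count_list w = \<alpha>} \<subseteq> {w \<in> lists {..<n}. length w = (\<Sum>i<n. \<alpha> i)}"
        using length_count by auto
    qed (rule sum_lists_length(2))
    have "((\<lambda>\<alpha>. \<Sum>w\<in>{w \<in> lists {..<n}. count_list w = \<alpha>}. prod_list (map f w)) has_sum (1 / (1 - (\<Sum>i<n. f i)))) (midx n)"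
    proof (rule has_sum_group[OF lists_geometric[OF q] _ fin])
      show "count_list ` lists {..<n} \<subseteq> midx n"
        by (fastforce simp: midx_def count_list_0_iff)
    qed
    then have "((\<lambda>\<alpha>. 1 / D0 * (\<Sum>w\<in>{w \<in> lists {..<n}. count_list w = \<alpha>}. prod_list (map f w))) has_sum (1 / D0 * (1 / (1 - (\<Sum>i<n. f i))))) (midx n)"
      by (rule has_sum_cmult_right)
    moreover have "1 / D0 * (\<Sum>w\<in>{w \<in> lists {..<n}. count_list w = \<alpha>}. prod_list (map f w)) =
        cf \<alpha> * complex_of_real (\<Prod>i<n. (y i - x i) ^ \<alpha> i)" for \<alpha>
    proof -
      have "prod_list (map f w) = prod_list (map E w) * complex_of_real (\<Prod>i<n. (y i - x i) ^ \<alpha> i)"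
        if w: "w \<in> lists {..<n}" "count_list w = \<alpha>" for w
      proof -
        have "prod_list (map f w) = prod_list (map E w) * prod_list (map (\<lambda>i. complex_of_real (y i - x i)) w)"
          by (induction w) (simp_all add: f_def mult_ac)
        then show ?thesis unfolding prod_list_count[OF w(1), of "\<lambda>i. complex_of_real (y i - x i)"] w(2) by simp
      qed
      then show ?thesis unfolding cf_def by (simp add: sum_distrib_right mult.assoc)
    qed
    moreover have "1 / D0 * (1 / (1 - (\<Sum>i<n. f i))) = 1 / D y"
    proof -
      have fi: "D0 * (E i * z) = - (e i * z)" for i z using D0 by (simp add: E_def)
      have "D0 * (1 - (\<Sum>i<n. f i)) = D0 - (\<Sum>i<n. D0 * f i)"
        by (simp only: right_diff_distrib mult_1_right sum_distrib_left)
      also have "\<dots> = D y" unfolding D[OF y(1)] f_def fi by (simp only: sum_negf diff_minus_eq_add)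
      finally have "D0 * (1 - (\<Sum>i<n. f i)) = D y" .
      then show ?thesis by (metis mult_1 times_divide_times_eq)
    qed
    ultimately show "((\<lambda>\<alpha>. cf \<alpha> * complex_of_real (\<Prod>i<n. (y i - x i) ^ \<alpha> i)) has_sum (1 / D y)) (midx n)" by simp
  qed
qed

lemma complex_power_series_cmult:
  assumes "complex_power_series_at n f x" shows "complex_power_series_at n (\<lambda>y. a * f y) x"
proof -
  obtain r c where r: "r > 0" and c: "\<And>y. y \<in> topspace (Euclidean_space n) \<Longrightarrow> (\<forall>i<n. \<bar>y i - x i\<bar> < r) \<Longrightarrow>
       ((\<lambda>\<alpha>. c \<alpha> * complex_of_real (\<Prod>i<n. (y i - x i) ^ \<alpha> i)) has_sum f y) (midx n)"
    using assms unfolding complex_power_series_at_def by blast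
  show ?thesis unfolding complex_power_series_at_def
  proof (intro exI[of _ r] conjI exI[of _ "\<lambda>\<alpha>. a * c \<alpha>"] ballI impI)
    fix y assume y: "y \<in> topspace (Euclidean_space n)" "\<forall>i<n. \<bar>y i - x i\<bar> < r"
    show "((\<lambda>\<alpha>. a * c \<alpha> * complex_of_real (\<Prod>i<n. (y i - x i) ^ \<alpha> i)) has_sum a * f y) (midx n)"
      using has_sum_cmult_right[OF c[OF y], of a] by (simp only: mult.assoc)
  qed (rule r)
qed

lemma complex_power_series_add:
  assumes "complex_power_series_at n f x" "complex_power_series_at n g x"
  shows "complex_power_series_at n (\<lambda>y. f y + g y) x"
proof -
  obtain r c where r: "r > 0" and c: "\<And>y. y \<in> topspace (Euclidean_space n) \<Longrightarrow> (\<forall>i<n. \<bar>y i - x i\<bar> < r) \<Longrightarrow>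
       ((\<lambda>\<alpha>. c \<alpha> * complex_of_real (\<Prod>i<n. (y i - x i) ^ \<alpha> i)) has_sum f y) (midx n)"
    using assms(1) unfolding complex_power_series_at_def by blast
  obtain r' c' where r': "r' > 0" and c': "\<And>y. y \<in> topspace (Euclidean_space n) \<Longrightarrow> (\<forall>i<n. \<bar>y i - x i\<bar> < r') \<Longrightarrow>
       ((\<lambda>\<alpha>. c' \<alpha> * complex_of_real (\<Prod>i<n. (y i - x i) ^ \<alpha> i)) has_sum g y) (midx n)"
    using assms(2) unfolding complex_power_series_at_def by blast
  show ?thesis unfolding complex_power_series_at_def
  proof (intro exI[of _ "min r r'"] conjI exI[of _ "\<lambda>\<alpha>. c \<alpha> + c' \<alpha>"] ballI impI)
    show "min r r' > 0" using r r' by simp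
    fix y assume y: "y \<in> topspace (Euclidean_space n)" "\<forall>i<n. \<bar>y i - x i\<bar> < min r r'"
    then have y': "\<forall>i<n. \<bar>y i - x i\<bar> < r" "\<forall>i<n. \<bar>y i - x i\<bar> < r'" by auto
    show "((\<lambda>\<alpha>. (c \<alpha> + c' \<alpha>) * complex_of_real (\<Prod>i<n. (y i - x i) ^ \<alpha> i)) has_sum f y + g y) (midx n)"
      using has_sum_add[OF c[OF y(1) y'(1)] c'[OF y(1) y'(2)]] by (simp only: distrib_right)
  qed
qed

text \<open>Multiplication by a coordinate shifts the coefficients along the \<open>i\<close>-th index.\<close>

lemma complex_power_series_coord:
  assumes f: "complex_power_series_at n f x" and i: "i < n"
  shows "complex_power_series_at n (\<lambda>y. complex_of_real (y i - x i) * f y) x"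
proof -
  obtain r c where r: "r > 0" and c: "\<And>y. y \<in> topspace (Euclidean_space n) \<Longrightarrow> (\<forall>i<n. \<bar>y i - x i\<bar> < r) \<Longrightarrow>
       ((\<lambda>\<alpha>. c \<alpha> * complex_of_real (\<Prod>i<n. (y i - x i) ^ \<alpha> i)) has_sum f y) (midx n)"
    using f unfolding complex_power_series_at_def by blast
  define up where "up \<alpha> = \<alpha>(i := Suc (\<alpha> i))" for \<alpha> :: "nat \<Rightarrow> nat"
  define down where "down \<alpha> = \<alpha>(i := \<alpha> i - 1)" for \<alpha> :: "nat \<Rightarrow> nat"
  have du: "down (up \<alpha>) = \<alpha>" for \<alpha> by (simp add: down_def up_def)
  have ud: "up (down \<alpha>) = \<alpha>" if "\<alpha> i \<noteq> 0" for \<alpha> using that by (auto simp: down_def up_def fun_eq_iff)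
  have inj: "inj_on up (midx n)" by (rule inj_onI) (metis du)
  show ?thesis unfolding complex_power_series_at_def
  proof (intro exI[of _ r] conjI exI[of _ "\<lambda>\<alpha>. if \<alpha> i = 0 then 0 else c (down \<alpha>)"] ballI impI)
    fix y assume y: "y \<in> topspace (Euclidean_space n)" "\<forall>i<n. \<bar>y i - x i\<bar> < r"
    define mon where "mon \<alpha> = complex_of_real (\<Prod>i<n. (y i - x i) ^ \<alpha> i)" for \<alpha>
    define g where "g = (\<lambda>\<alpha>. (if \<alpha> i = 0 then 0 else c (down \<alpha>)) * mon \<alpha>)"
    have mup: "mon (up \<alpha>) = complex_of_real (y i - x i) * mon \<alpha>" for \<alpha>
    proof -
      have "(\<Prod>j<n. (y j - x j) ^ up \<alpha> j) = (\<Prod>j<n. (if j = i then y i - x i else 1) * (y j - x j) ^ \<alpha> j)"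
        by (rule prod.cong) (auto simp: up_def)
      also have "\<dots> = (y i - x i) * (\<Prod>j<n. (y j - x j) ^ \<alpha> j)" using i by (simp add: prod.distrib)
      finally show ?thesis by (simp only: mon_def of_real_mult)
    qed
    have "((\<lambda>\<alpha>. complex_of_real (y i - x i) * (c \<alpha> * mon \<alpha>)) has_sum complex_of_real (y i - x i) * f y) (midx n)"
      unfolding mon_def by (rule has_sum_cmult_right[OF c[OF y]])
    moreover have "g \<circ> up = (\<lambda>\<alpha>. complex_of_real (y i - x i) * (c \<alpha> * mon \<alpha>))"
    proof
      fix \<alpha>
      have "up \<alpha> i \<noteq> 0" by (simp add: up_def)
      then have "(g \<circ> up) \<alpha> = c \<alpha> * mon (up \<alpha>)" by (simp add: g_def du)
      then show "(g \<circ> up) \<alpha> = complex_of_real (y i - x i) * (c \<alpha> * mon \<alpha>)"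
        unfolding mup by (simp only: mult.left_commute)
    qed
    ultimately have "((g \<circ> up) has_sum complex_of_real (y i - x i) * f y) (midx n)" by (simp only:)
    then have "(g has_sum complex_of_real (y i - x i) * f y) (up ` midx n)"
      using has_sum_reindex[OF inj] by blast
    moreover have "(g has_sum z) (up ` midx n) \<longleftrightarrow> (g has_sum z) (midx n)" for z
    proof (rule has_sum_cong_neutral)
      fix \<alpha> assume "\<alpha> \<in> midx n - up ` midx n"
      then have a: "\<alpha> \<in> midx n" "\<alpha> \<notin> up ` midx n" by auto
      have "\<alpha> i = 0"
      proof (rule ccontr)
        assume "\<alpha> i \<noteq> 0"
        then have "up (down \<alpha>) = \<alpha>" by (rule ud)
        moreover have "down \<alpha> \<in> midx n" using a(1) by (simp add: midx_def down_def)
        ultimately show False using a(2) by (metis imageI)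
      qed
      then show "g \<alpha> = 0" by (simp add: g_def)
    next
      fix \<alpha> assume "\<alpha> \<in> up ` midx n - midx n"
      then show "g \<alpha> = 0" using i by (auto simp: midx_def up_def)
    qed simp
    ultimately show "((\<lambda>\<alpha>. (if \<alpha> i = 0 then 0 else c (down \<alpha>)) * complex_of_real (\<Prod>i<n. (y i - x i) ^ \<alpha> i)) has_sum
       complex_of_real (y i - x i) * f y) (midx n)"
      unfolding g_def mon_def by blast
  qed (rule r)
qed

lemma complex_power_series_sum:
  assumes "finite I" "\<And>i. i \<in> I \<Longrightarrow> complex_power_series_at n (f i) x" "complex_power_series_at n g x"
  shows "complex_power_series_at n (\<lambda>y. g y + (\<Sum>i\<in>I. f i y)) x"
  using assms
proof (induction I)
  case empty then show ?case by simp
next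
  case (insert i I)
  have "complex_power_series_at n (\<lambda>y. f i y + (g y + (\<Sum>i\<in>I. f i y))) x"
    by (rule complex_power_series_add) (use insert in auto)
  moreover have "f i y + (g y + (\<Sum>i\<in>I. f i y)) = g y + (\<Sum>i\<in>insert i I. f i y)" for y
    using insert(1,2) by (simp add: algebra_simps)
  ultimately show ?case by simp
qed

text \<open>Affine over the reals, with complex values; in contrast to complex affine functions these are
  closed under conjugation, which the antipodal coefficients need.\<close>

definition affine_fn :: "nat \<Rightarrow> ((nat \<Rightarrow> real) \<Rightarrow> complex) \<Rightarrow> bool" where
  "affine_fn n f \<longleftrightarrow> (\<exists>A B. \<forall>y\<in>topspace (Euclidean_space n). f y = A + (\<Sum>i<n. B i * complex_of_real (y i)))"

text \<open>The numerator is written as its value at \<open>x\<close> plus a combination of the coordinates \<open>y i - x i\<close>, so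
  that only the reciprocal of the denominator needs a series of its own.\<close>

lemma affine_quotient_analytic:
  assumes N: "affine_fn n N" and D: "affine_fn n D" and x: "x \<in> topspace (Euclidean_space n)" "D x \<noteq> 0"
  shows "complex_power_series_at n (\<lambda>y. N y * (1 / D y)) x"
proof -
  obtain A B where AB: "\<And>y. y \<in> topspace (Euclidean_space n) \<Longrightarrow> N y = A + (\<Sum>i<n. B i * complex_of_real (y i))"
    using N unfolding affine_fn_def by blast
  obtain A' B' where AB': "\<And>y. y \<in> topspace (Euclidean_space n) \<Longrightarrow> D y = A' + (\<Sum>i<n. B' i * complex_of_real (y i))"
    using D unfolding affine_fn_def by blast
  have D': "D y = D x + (\<Sum>i<n. B' i * complex_of_real (y i - x i))" if "y \<in> topspace (Euclidean_space n)" for y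
    unfolding AB'[OF that] AB'[OF x(1)] by (simp add: right_diff_distrib sum_subtractf)
  note R = complex_power_series_recip[OF D' x(2)]
  have "complex_power_series_at n (\<lambda>y. N x * (1 / D y) + (\<Sum>i<n. B i * (complex_of_real (y i - x i) * (1 / D y)))) x"
    by (intro complex_power_series_sum complex_power_series_cmult complex_power_series_coord R) auto
  then obtain r c where r: "r > 0" and c: "\<And>y. y \<in> topspace (Euclidean_space n) \<Longrightarrow> (\<forall>i<n. \<bar>y i - x i\<bar> < r) \<Longrightarrow>
       ((\<lambda>\<alpha>. c \<alpha> * complex_of_real (\<Prod>i<n. (y i - x i) ^ \<alpha> i)) has_sum N x * (1 / D y) + (\<Sum>i<n. B i * (complex_of_real (y i - x i) * (1 / D y)))) (midx n)"
    unfolding complex_power_series_at_def by blast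
  have e: "N x * (1 / D y) + (\<Sum>i<n. B i * (complex_of_real (y i - x i) * (1 / D y))) = N y * (1 / D y)"
    if y: "y \<in> topspace (Euclidean_space n)" for y
  proof -
    have "N y = N x + (\<Sum>i<n. B i * complex_of_real (y i - x i))"
      unfolding AB[OF y] AB[OF x(1)] by (simp add: right_diff_distrib sum_subtractf)
    then show ?thesis by (simp only: distrib_right sum_distrib_right mult.assoc)
  qed
  show ?thesis unfolding complex_power_series_at_def
  proof (intro exI[of _ r] conjI exI[of _ c] ballI impI)
    fix y assume y: "y \<in> topspace (Euclidean_space n)" "\<forall>i<n. \<bar>y i - x i\<bar> < r"
    show "((\<lambda>\<alpha>. c \<alpha> * complex_of_real (\<Prod>i<n. (y i - x i) ^ \<alpha> i)) has_sum N y * (1 / D y)) (midx n)"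
      using c[OF y] unfolding e[OF y(1)] .
  qed (rule r)
qed

lemma affine_fn_const: "affine_fn n (\<lambda>_. a)"
  unfolding affine_fn_def by (intro exI[of _ a] exI[of _ "\<lambda>_. 0"]) simp

lemma affine_fn_coord: "i < n \<Longrightarrow> affine_fn n (\<lambda>y. complex_of_real (y i))"
  unfolding affine_fn_def
  by (intro exI[of _ 0] exI[of _ "\<lambda>j. if j = i then 1 else 0"]) (simp add: if_distrib[of "\<lambda>c. c * _"] cong: if_cong)

lemma affine_fn_lincomb:
  assumes "affine_fn n f" "affine_fn n g" shows "affine_fn n (\<lambda>y. a * f y + b * g y)"
proof -
  obtain A B where 1: "\<And>y. y \<in> topspace (Euclidean_space n) \<Longrightarrow> f y = A + (\<Sum>i<n. B i * complex_of_real (y i))"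
    using assms(1) unfolding affine_fn_def by blast
  obtain A' B' where 2: "\<And>y. y \<in> topspace (Euclidean_space n) \<Longrightarrow> g y = A' + (\<Sum>i<n. B' i * complex_of_real (y i))"
    using assms(2) unfolding affine_fn_def by blast
  show ?thesis unfolding affine_fn_def
  proof (intro exI[of _ "a * A + b * A'"] exI[of _ "\<lambda>i. a * B i + b * B' i"] ballI)
    fix y assume y: "y \<in> topspace (Euclidean_space n)"
    show "a * f y + b * g y = a * A + b * A' + (\<Sum>i<n. (a * B i + b * B' i) * complex_of_real (y i))"
      unfolding 1[OF y] 2[OF y] by (simp add: distrib_left distrib_right sum.distrib sum_distrib_left mult.assoc)
  qed
qed

lemma affine_fn_cnj: assumes "affine_fn n f" shows "affine_fn n (\<lambda>y. cnj (f y))"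
proof -
  obtain A B where 1: "\<And>y. y \<in> topspace (Euclidean_space n) \<Longrightarrow> f y = A + (\<Sum>i<n. B i * complex_of_real (y i))"
    using assms(1) unfolding affine_fn_def by blast
  show ?thesis unfolding affine_fn_def
    by (intro exI[of _ "cnj A"] exI[of _ "\<lambda>i. cnj (B i)"] ballI) (simp add: 1)
qed

lemma affine_fn_fill:
  assumes "inj_on \<sigma> {..<p}" shows "affine_fn p (\<lambda>y. coord_fill n p \<sigma> v y k)"
proof -
  have g: "affine_fn p (\<lambda>y. complex_of_real (if i \<ge> 2 * n then 0 else if i \<in> \<sigma> ` {..<p} then y (inv_into {..<p} \<sigma> i) else v i))" for i
  proof (cases "i \<ge> 2 * n")
    case True then show ?thesis using affine_fn_const[of p 0] by simp
  next
    case False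
    show ?thesis
    proof (cases "i \<in> \<sigma> ` {..<p}")
      case True
      then have "inv_into {..<p} \<sigma> i < p" using inv_into_into[OF True] by simp
      then show ?thesis using affine_fn_coord False True by simp
    next
      case F: False
      then show ?thesis using affine_fn_const[of p "complex_of_real (v i)"] False by simp
    qed
  qed
  have "affine_fn p (\<lambda>y. 1 * complex_of_real (if 2 * k \<ge> 2 * n then 0 else if 2 * k \<in> \<sigma> ` {..<p} then y (inv_into {..<p} \<sigma> (2 * k)) else v (2 * k)) +
     \<i> * complex_of_real (if 2 * k + 1 \<ge> 2 * n then 0 else if 2 * k + 1 \<in> \<sigma> ` {..<p} then y (inv_into {..<p} \<sigma> (2 * k + 1)) else v (2 * k + 1)))"
    by (rule affine_fn_lincomb[OF g g])
  then show ?thesis unfolding coord_fill_def cplx_def Complex_eq mult_1 .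
qed

lemma affine_fn_anti_join:
  assumes "\<And>k. affine_fn n (\<lambda>y. a y k)" shows "affine_fn n (\<lambda>y. anti_join d (a y) i)"
proof (cases "i \<le> d")
  case True then show ?thesis using assms by (simp add: anti_join_def join_coeffs_def)
next
  case False
  show ?thesis
  proof (cases "i \<le> 2 * d + 1")
    case True
    have le: "i - Suc d \<le> d" using True by simp
    have "affine_fn n (\<lambda>y. (- 1) ^ (i - Suc d) * cnj (a y (d - (i - Suc d))) + 0 * 0)"
      by (intro affine_fn_lincomb affine_fn_cnj assms affine_fn_const)
    moreover have "(\<lambda>y. anti_join d (a y) i) = (\<lambda>y. (- 1) ^ (i - Suc d) * cnj (a y (d - (i - Suc d))) + 0 * 0)"
      unfolding anti_join_def join_coeffs_def antipodal_coeffs_def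
      by (simp only: False True le if_True if_False mult_zero_left add_0_right)
    ultimately show ?thesis by (simp only:)
  next
    case F: False
    then show ?thesis using False affine_fn_const[of n 0] by (simp add: anti_join_def join_coeffs_def)
  qed
qed

section \<open>Real analyticity of the parametrization\<close>

lemma affine_coords_scale: "s \<noteq> 0 \<Longrightarrow> affine_coords j (\<lambda>i. s * c i) = affine_coords j (c :: nat \<Rightarrow> 'a::field)"
  by (simp add: affine_coords_def)

lemma Rat_chart: "the_elem ((\<lambda>c. realify (affine_coords j c)) ` proj_class c) = realify (affine_coords j c)"
proof -
  have "(\<lambda>c. realify (affine_coords j c)) ` proj_class c = {realify (affine_coords j c)}"
    using proj_class_self[of c] by (auto simp: proj_class_def affine_coords_scale)
  then show ?thesis by simp
qed

lemma param_chart: "the_elem ((\<lambda>a. affine_coords j (realify a)) ` real_class a) = affine_coords j (realify a)"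
proof -
  have "affine_coords j (realify (\<lambda>k. complex_of_real r * a k)) = affine_coords j (realify a)" if "r \<noteq> 0" for r
  proof -
    have "realify (\<lambda>k. complex_of_real r * a k) = (\<lambda>i. r * realify a i)" by (rule ext) (rule realify_scale)
    then show ?thesis using affine_coords_scale[OF that, of j "realify a"] by simp
  qed
  then have "(\<lambda>a. affine_coords j (realify a)) ` real_class a = {affine_coords j (realify a)}"
    using real_class_self[of a] by (auto simp: real_class_def)
  then show ?thesis by simp
qed

lemma Xi_continuous: assumes d: "odd d" shows "continuous_map (param_space d) (Rat_space d) (Xi d)"
proof -
  have e: "subtopology (coord_space (Suc d)) (topspace (coord_space (Suc d)) - Z_locus d) = top_of_set (nonZ d)"
    unfolding nonZ_def coord_space_eq subtopology_subtopology by (rule arg_cong[of _ _ "top_of_set"]) auto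
  have q: "quotient_map (top_of_set (nonZ d)) (param_space d) real_class"
    unfolding param_space_def e by (rule quotient_map_quotient_topology)
  have "continuous_map (top_of_set (nonZ d)) (Rat_space d) (Xi d \<circ> real_class)"
    using B1_continuous[OF d] by (simp add: continuous_map_in_subtopology comp_def Xi_real_class)
  then show ?thesis by (rule continuous_compose_quotient_map[OF q])
qed

text \<open>In the affine charts the inverse of a chart of the parameters puts 1 into the \<open>j\<close>-th real coordinate,
  which is an affine map. The homogeneous coordinates of the image are then real affine functions, and
  its affine coordinates are quotients of such functions.\<close>

lemma Xi_analytic:
  assumes d: "odd d"
  shows "real_analytic_map (param_space d) (2 * d + 1) (param_charts d) (Rat_space d) (2 * (2 * d + 1)) (Rat_charts d) (Xi d)"
proof -
  note d1 = odd_ge_1[OF d]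
  let ?n = "2 * d + 1"
  have main: "real_analytic_at ?n (\<lambda>y. the_elem ((\<lambda>c. realify (affine_coords j' c)) ` Xi d (inv_into U u y)) i) (u p)"
    if j: "j < 2 * d + 2" and U: "U = {A \<in> topspace (param_space d). \<forall>a\<in>A. realify a j \<noteq> 0}"
      and u: "u = (\<lambda>A. the_elem ((\<lambda>a. affine_coords j (realify a)) ` A))"
      and p: "p \<in> U" and Xp: "\<forall>c\<in>Xi d p. c j' \<noteq> 0" for j j' U u p i
  proof -
    have sj: "skip1 j ` {..<?n} \<subseteq> {..<2 * Suc d}" "inj_on (skip1 j) {..<?n}"
      using skip1[of j ?n] j by auto
    \<comment> \<open>The inverse of the chart, as a map into representatives of the classes.\<close>
    define fill where "fill = coord_fill (Suc d) ?n (skip1 j) (\<lambda>_. 1)"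
    have uc: "u (real_class a) = coord_chart ?n (skip1 j) (\<lambda>k. complex_of_real (1 / realify a j) * a k)" if a: "a \<in> cvec (Suc d)" for a
    proof
      fix i
      have "realify a (Suc i) = 0" "\<not> i < j" if "\<not> i < ?n" using realify_eq_0[OF a, of "Suc i"] that j by auto
      then show "u (real_class a) i = coord_chart ?n (skip1 j) (\<lambda>k. complex_of_real (1 / realify a j) * a k) i"
        unfolding u param_chart coord_chart_def realify_scale by (cases "i < ?n") (auto simp: affine_coords_def skip1_def)
    qed
    have norm: "(\<lambda>k. complex_of_real (1 / realify a j) * a k) \<in> rslice d j \<and>
        real_class (\<lambda>k. complex_of_real (1 / realify a j) * a k) = real_class a"
      if a: "a \<in> nonZ d" "realify a j \<noteq> 0" for a
    proof -
      have r0: "1 / realify a j \<noteq> 0" using a(2) by simp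
      have "realify (\<lambda>k. complex_of_real (1 / realify a j) * a k) j = 1" unfolding realify_scale using a(2) by simp
      then show ?thesis unfolding rslice_def using nonZ_scale[OF d1 r0 a(1)] real_class_mult[OF r0] by blast
    qed
    have fu: "real_class (fill (u A)) = A" if A: "A \<in> U" for A
    proof -
      obtain a where a: "a \<in> nonZ d" "A = real_class a" using A unfolding U topspace_param by blast
      have aj: "realify a j \<noteq> 0" using A real_class_self[of a] unfolding U a(2) by blast
      note nm = norm[OF a(1) aj]
      have "fill (u A) = (\<lambda>k. complex_of_real (1 / realify a j) * a k)"
        unfolding a(2) uc[OF nonZ_cvec[OF a(1)]] fill_def
        by (rule coord_fill_chart[OF sj(2), where S = "nonZ d"]) (use nm rslice_eq[OF j] nonZ_cvec in auto)
      then show ?thesis using nm a(2) by simp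
    qed
    then have inj: "inj_on u U" by (metis inj_onI)
    have uE: "u A \<in> topspace (Euclidean_space ?n)" if A: "A \<in> U" for A
    proof -
      obtain a where a: "a \<in> nonZ d" "A = real_class a" using A unfolding U topspace_param by blast
      show ?thesis unfolding a(2) uc[OF nonZ_cvec[OF a(1)]] by (simp add: coord_chart_def topspace_Euclidean_space)
    qed
    have fs: "real_class (fill y) \<in> U \<and> u (real_class (fill y)) = y"
      if y: "y \<in> topspace (Euclidean_space ?n)" "fill y \<in> nonZ d" for y
    proof -
      have "fill y \<in> rslice d j" using coord_fill_slice[of "Suc d" ?n "skip1 j" "\<lambda>_. 1" y "nonZ d"] y(2) rslice_eq[OF j]
        unfolding fill_def by blast
      then have f1: "realify (fill y) j = 1" by (simp add: rslice_def)
      have "u (real_class (fill y)) = coord_chart ?n (skip1 j) (fill y)"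
        unfolding uc[OF nonZ_cvec[OF y(2)]] f1 by simp
      also have "\<dots> = y" unfolding fill_def by (rule coord_chart_fill[OF sj(2,1) y(1)])
      finally have 1: "u (real_class (fill y)) = y" .
      have "realify b j \<noteq> 0" if "b \<in> real_class (fill y)" for b
        using that f1 by (auto simp: real_class_def realify_scale)
      then have "real_class (fill y) \<in> U" unfolding U topspace_param using y(2) by blast
      then show ?thesis using 1 by blast
    qed
    define x where "x = u p"
    have xE: "x \<in> topspace (Euclidean_space ?n)" unfolding x_def by (rule uE[OF p])
    have pf: "p = real_class (fill x)" using fu[OF p] by (simp add: x_def)
    have fx: "fill x \<in> nonZ d"
    proof -
      obtain a where a: "a \<in> nonZ d" "p = real_class a" using p unfolding U topspace_param by blast
      have "fill x \<in> real_class a" using pf a(2) real_class_self by metis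
      then obtain r where "r \<noteq> 0" "fill x = (\<lambda>k. complex_of_real r * a k)" unfolding real_class_def by blast
      then show ?thesis using nonZ_scale[OF d1 _ a(1)] by simp
    qed
    have Dx: "anti_join d (fill x) j' \<noteq> 0"
      using Xp proj_class_self unfolding pf Xi_real_class by blast
    obtain S' where S': "open S'" "nonZ d = cvec (Suc d) \<inter> S'" using open_nonZ[OF d1] by (auto simp: openin_open)
    have "open (fill -` S')" unfolding fill_def by (rule open_vimage[OF S'(1) continuous_on_coord_fill])
    then have "openin (Euclidean_space ?n) (topspace (Euclidean_space ?n) \<inter> fill -` S')"
      unfolding Euclidean_space_eq by (auto simp: openin_open)
    moreover have "x \<in> topspace (Euclidean_space ?n) \<inter> fill -` S'" using xE fx S'(2) by simp
    ultimately obtain e where e: "e > 0" "\<And>y. y \<in> topspace (Euclidean_space ?n) \<Longrightarrow> (\<forall>i<?n. \<bar>y i - x i\<bar> < e) \<Longrightarrow>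
       y \<in> topspace (Euclidean_space ?n) \<inter> fill -` S'" by (rule Euclidean_cube) blast
    have val: "the_elem ((\<lambda>c. realify (affine_coords j' c)) ` Xi d (inv_into U u y)) i = realify (affine_coords j' (anti_join d (fill y))) i"
      if y: "y \<in> topspace (Euclidean_space ?n)" "\<forall>i<?n. \<bar>y i - x i\<bar> < e" for y
    proof -
      have "fill y \<in> nonZ d" using e(2)[OF y] coord_fill_cvec unfolding S'(2) fill_def by auto
      note f = fs[OF y(1) this]
      have "inv_into U u y = real_class (fill y)" using inv_into_f_f[OF inj, of "real_class (fill y)"] f by simp
      then show ?thesis by (simp only: Xi_real_class Rat_chart)
    qed
    have aff: "affine_fn ?n (\<lambda>y. anti_join d (fill y) m)" for m
      unfolding fill_def by (rule affine_fn_anti_join) (rule affine_fn_fill[OF sj(2)])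
    have ps: "complex_power_series_at ?n (\<lambda>y. affine_coords j' (anti_join d (fill y)) m) x" for m
      using affine_quotient_analytic[OF aff aff xE Dx, of "if m < j' then m else Suc m"]
      by (simp add: affine_coords_def)
    have "real_analytic_at ?n (\<lambda>y. realify (affine_coords j' (anti_join d (fill y))) i) x"
      unfolding realify_def using real_analytic_at_Re[OF ps] real_analytic_at_Im[OF ps] by (cases "even i") simp_all
    from real_analytic_at_cong[OF this e(1) val] show ?thesis unfolding x_def .
  qed
  show ?thesis unfolding real_analytic_map_def
  proof (intro conjI Xi_continuous[OF d] ballI)
    fix C assume "C \<in> param_charts d"
    then obtain j where j: "j < 2 * d + 2" "C = ({A \<in> topspace (param_space d). \<forall>a\<in>A. realify a j \<noteq> 0},
       \<lambda>A. the_elem ((\<lambda>a. affine_coords j (realify a)) ` A))" unfolding param_charts_def by blast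
    show "case C of (U, u) \<Rightarrow> \<forall>(V, v)\<in>Rat_charts d. \<forall>p\<in>U. Xi d p \<in> V \<longrightarrow>
        (\<forall>i<2 * (2 * d + 1). real_analytic_at (2 * d + 1) (\<lambda>y. v (Xi d (inv_into U u y)) i) (u p))"
      unfolding j(2) prod.case
    proof (intro ballI)
      fix C' assume "C' \<in> Rat_charts d"
      then obtain j' where j': "C' = ({\<phi> \<in> Rat d. \<forall>c\<in>\<phi>. c j' \<noteq> 0},
         \<lambda>\<phi>. the_elem ((\<lambda>c. realify (affine_coords j' c)) ` \<phi>))" unfolding Rat_charts_def by blast
      show "case C' of (V, v) \<Rightarrow> \<forall>p\<in>{A \<in> topspace (param_space d). \<forall>a\<in>A. realify a j \<noteq> 0}. Xi d p \<in> V \<longrightarrow>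
        (\<forall>i<2 * (2 * d + 1). real_analytic_at (2 * d + 1)
          (\<lambda>y. v (Xi d (inv_into {A \<in> topspace (param_space d). \<forall>a\<in>A. realify a j \<noteq> 0}
             (\<lambda>A. the_elem ((\<lambda>a. affine_coords j (realify a)) ` A)) y)) i)
          (the_elem ((\<lambda>a. affine_coords j (realify a)) ` p)))"
        unfolding j' prod.case
        by (intro ballI impI allI, rule main[OF j(1) refl refl]) blast+
    qed
  qed
qed

section \<open>Parametrization, connectedness and dimensions\<close>

theorem corollary2:
  fixes d :: nat
  assumes "d \<ge> 3" and "odd d"
  shows "(\<forall>a \<in> topspace (coord_space (Suc d)) - Z_locus d.
            Xi d (real_class a) = proj_class (join_coeffs d a (antipodal_coeffs d a)))
    \<and> bij_betw (Xi d) (topspace (param_space d)) (B1 d)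
    \<and> real_analytic_map (param_space d) (2 * d + 1) (param_charts d)
        (Rat_space d) (2 * (2 * d + 1)) (Rat_charts d) (Xi d)
    \<and> connectedin (Rat_space d) (B1 d)
    \<and> connectedin (moduli_space d) (moduli_B1 d)
    \<and> real_dim (subtopology (Rat_space d) (B1 d)) = enat (2 * d + 1)
    \<and> real_dim (subtopology (moduli_space d) (moduli_B1 d)) = enat (2 * d - 2)"
proof (intro conjI)
  show "\<forall>a \<in> topspace (coord_space (Suc d)) - Z_locus d.
      Xi d (real_class a) = proj_class (join_coeffs d a (antipodal_coeffs d a))"
    using Xi_real_class unfolding anti_join_def by blast
  show "bij_betw (Xi d) (topspace (param_space d)) (B1 d)"
    by (rule Xi_bij[OF assms(2)])
  show "real_analytic_map (param_space d) (2 * d + 1) (param_charts d)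
      (Rat_space d) (2 * (2 * d + 1)) (Rat_charts d) (Xi d)"
    by (rule Xi_analytic[OF assms(2)])
  have "d \<ge> 2" using assms(1) by simp
  then show "connectedin (Rat_space d) (B1 d)" "connectedin (moduli_space d) (moduli_B1 d)"
    using B1_connected[OF assms(2)] by simp_all
  show "real_dim (subtopology (Rat_space d) (B1 d)) = enat (2 * d + 1)"
    by (rule real_dim_B1[OF assms(2)])
  show "real_dim (subtopology (moduli_space d) (moduli_B1 d)) = enat (2 * d - 2)"
    by (rule real_dim_moduli_B1[OF assms])
qed

end
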